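(* Let $\Gamma$ be a group satisfying at least one of the following conditions. (1) $\Gamma$ contains a finite-index subgroup $H$ such that $H\cong F_m\times F_n$ for some $m\ge2$, $n\ge2$. (2) $\Gamma$ contains a finite-index subgroup $H$ such that $H\cong F_m\times\mathbb{Z}^d$ for some $m\ge2$, $d\ge1$. Then $\Gamma$ is not $\mathrm{UB}$-flexibly BS-rigid.
   Context: $F_m$ is a free group with a basis of cardinality $m$. Write $[n]=\{1,\dots,n\}$ and $\mathrm{Sym}(n)$ for the symmetric group on $[n]$. For $\sigma\in\mathrm{Sym}(n)$ and $\tau\in\mathrm{Sym}(N)$ with $N\ge n$, $d(\sigma,\tau)=d(\tau,\sigma)=\frac1n|\{x\in[n]\mid\sigma x\neq\tau x\}|$. For $f\colon\Gamma\to\mathrm{Sym}(n)$ and finite $Q\subset\Gamma$, $N_{f,Q}$ is the distribution on $2^Q$ of $\{\gamma\in Q\mid f(\gamma)x=x\}$ with $x$ uniform in $[n]$; $d_{\mathrm{TV}}$ is total variation distance (half the $\ell^1$ distance). A group $\Gamma$ is UB-flexibly (unboundedly flexibly) BS-rigid if for every sequence of functions $(f_\ell\colon\Gamma\to\mathrm{Sym}(n_\ell))_{\ell=1}^\infty$ with $n_\ell\to\infty$ and $d(f_\ell(\gamma_1\gamma_2),f_\ell(\gamma_1)f_\ell(\gamma_2))\to0$ for all $\gamma_1,\gamma_2\in\Gamma$: if there is a sequence of homomorphisms $(g_\ell\colon\Gamma\to\mathrm{Sym}(n_\ell))_{\ell=1}^\infty$ with $d_{\mathrm{TV}}(N_{f_\ell,Q},N_{g_\ell,Q})\to0$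 for every finite $Q\subset\Gamma$, then there are homomorphisms $(h_\ell\colon\Gamma\to\mathrm{Sym}(N_\ell))_{\ell=1}^\infty$ with $n_\ell\le N_\ell<\infty$ (no other bound on $N_\ell$) such that $d(f_\ell(\gamma),h_\ell(\gamma))\to0$ for all $\gamma\in\Gamma$. *)

theory Defs
  imports
    "HOL-Algebra.Sym_Groups"
    "HOL-Algebra.Product_Groups"
    "HOL-Probability.Probability_Mass_Function"
begin

section \<open>Free groups\<close>

text \<open>A letter is a generator or the formal inverse of one: \<open>(x, True)\<close> stands for \<open>x\<close> and
  \<open>(x, False)\<close> for its inverse. The free group on \<open>X\<close> consists of the reduced words over \<open>X\<close>.\<close>

fun inv_letter :: "'x \<times> bool \<Rightarrow> 'x \<times> bool" where
  "inv_letter (x, b) = (x, \<not> b)"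

definition reduced :: "('x \<times> bool) list \<Rightarrow> bool" where
  "reduced w \<longleftrightarrow> successively (\<lambda>a b. b \<noteq> inv_letter a) w"

text \<open>The reduced form of \<open>a # w\<close> for a reduced word \<open>w\<close>.\<close>

fun push :: "'x \<times> bool \<Rightarrow> ('x \<times> bool) list \<Rightarrow> ('x \<times> bool) list" where
  "push a [] = [a]"
| "push a (b # w) = (if b = inv_letter a then w else a # b # w)"

definition free_group :: "'x set \<Rightarrow> ('x \<times> bool) list monoid" where
  "free_group X =
     \<lparr>carrier = {w. reduced w \<and> fst ` set w \<subseteq> X}, mult = foldr push, one = []\<rparr>"

abbreviation free_group_rank :: "nat \<Rightarrow> (nat \<times> bool) list monoid" where
  "free_group_rank m \<equiv> free_group {..<m}"

lemma inv_letter_inv_letter [simp]: "inv_letter (inv_letter a) = a"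
  by (cases a) auto

lemma inv_letter_inject [simp]: "inv_letter a = inv_letter b \<longleftrightarrow> a = b"
  by (metis inv_letter_inv_letter)

lemma fst_inv_letter [simp]: "fst (inv_letter a) = fst a"
  by (cases a) auto

lemma reduced_Nil [simp]: "reduced []"
  by (simp add: reduced_def)

lemma reduced_Cons: "reduced (a # w) \<longleftrightarrow> reduced w \<and> (w = [] \<or> hd w \<noteq> inv_letter a)"
  by (auto simp: reduced_def successively_Cons)

lemma reduced_push: "reduced w \<Longrightarrow> reduced (push a w)"
  by (cases w) (auto simp: reduced_Cons)

lemma push_inv_push: "reduced w \<Longrightarrow> push (inv_letter a) (push a w) = w"
  by (cases w; cases "tl w") (auto simp: reduced_Cons)

lemma reduced_foldr_push: "reduced w \<Longrightarrow> reduced (foldr push u w)"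
  by (induction u) (auto intro: reduced_push)

lemma set_push: "set (push a w) \<subseteq> insert a (set w)"
  by (cases w) auto

lemma set_foldr_push: "set (foldr push u w) \<subseteq> set u \<union> set w"
  by (induction u) (use set_push in fastforce)+

lemma foldr_push_assoc:
  assumes w: "reduced w"
  shows "foldr push (foldr push u v) w = foldr push u (foldr push v w)"
proof -
  have push: "foldr push (push a v) w = push a (foldr push v w)" for a v
  proof (cases v)
    case (Cons b v')
    then show ?thesis
      using push_inv_push[OF reduced_foldr_push[OF w], of "inv_letter a" v'] by auto
  qed simp
  show ?thesis
    by (induction u) (simp_all add: push)
qed

lemma foldr_push_inverse: "foldr push (rev (map inv_letter u)) u = []"
  by (induction u) (simp_all add: foldr_append)

lemma group_free_group: "group (free_group X)"
proof (rule groupI)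
  fix u v assume "u \<in> carrier (free_group X)" "v \<in> carrier (free_group X)"
  then show "u \<otimes>\<^bsub>free_group X\<^esub> v \<in> carrier (free_group X)"
    using set_foldr_push[of u v] by (fastforce simp: free_group_def reduced_foldr_push)
next
  fix u assume u: "u \<in> carrier (free_group X)"
  have "reduced (rev (map inv_letter u))"
    using u by (auto simp: free_group_def reduced_def successively_map
        elim!: successively_mono dest: sym)
  then have "rev (map inv_letter u) \<in> carrier (free_group X)"
    using u by (auto simp: free_group_def)
  then show "\<exists>v \<in> carrier (free_group X). v \<otimes>\<^bsub>free_group X\<^esub> u = \<one>\<^bsub>free_group X\<^esub>"
    by (rule bexI[rotated]) (simp add: free_group_def foldr_push_inverse)
qed (auto simp: free_group_def foldr_push_assoc)

text \<open>Universal property: every map from \<open>X\<close> to a group extends uniquely to the free group.\<close>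

definition (in monoid) eval_word :: "('x \<Rightarrow> 'a) \<Rightarrow> ('x \<times> bool) list \<Rightarrow> 'a" where
  "eval_word \<phi> w = foldr (\<lambda>(x, b) g. (if b then \<phi> x else inv (\<phi> x)) \<otimes> g) w \<one>"

lemma (in group) eval_word_closed:
  "\<phi> \<in> X \<rightarrow> carrier G \<Longrightarrow> fst ` set w \<subseteq> X \<Longrightarrow> eval_word \<phi> w \<in> carrier G"
  by (induction w) (auto simp: eval_word_def Pi_iff)

lemma (in group) eval_word_push:
  assumes "\<phi> \<in> X \<rightarrow> carrier G" "fst a \<in> X" "fst ` set w \<subseteq> X"
  shows "eval_word \<phi> (push a w) = eval_word \<phi> [a] \<otimes> eval_word \<phi> w"
proof (cases w)
  case Nil
  then show ?thesis using assms by (cases a) (auto simp: eval_word_def Pi_iff)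
next
  case (Cons b v)
  have "eval_word \<phi> v \<in> carrier G"
    by (rule eval_word_closed) (use assms Cons in auto)
  moreover have "\<phi> (fst a) \<in> carrier G"
    using assms by auto
  ultimately show ?thesis
    using Cons by (cases a) (auto simp: eval_word_def m_assoc[symmetric])
qed

lemma (in group) eval_word_hom:
  assumes \<phi>: "\<phi> \<in> X \<rightarrow> carrier G"
  shows "eval_word \<phi> \<in> hom (free_group X) G"
proof (rule homI)
  fix u v assume u: "u \<in> carrier (free_group X)" and v: "v \<in> carrier (free_group X)"
  have vX: "fst ` set v \<subseteq> X" using v by (auto simp: free_group_def)
  have "fst ` set u \<subseteq> X" using u by (auto simp: free_group_def)
  then have "eval_word \<phi> (foldr push u v) = eval_word \<phi> u \<otimes> eval_word \<phi> v"
  proof (induction u)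
    case Nil
    then show ?case using eval_word_closed[OF \<phi> vX] by (simp add: eval_word_def)
  next
    case (Cons a u)
    have uv: "fst ` set (foldr push u v) \<subseteq> X"
      using set_foldr_push[of u v] Cons.prems vX by fastforce
    have cl: "eval_word \<phi> u \<in> carrier G" "eval_word \<phi> v \<in> carrier G" "eval_word \<phi> [a] \<in> carrier G"
      by (rule eval_word_closed[OF \<phi>]; use Cons.prems vX in simp)+
    have "eval_word \<phi> (a # u) = eval_word \<phi> [a] \<otimes> eval_word \<phi> u"
      using Cons.prems \<phi> by (cases a) (auto simp: eval_word_def Pi_iff)
    then show ?case
      using Cons eval_word_push[OF \<phi> _ uv, of a] cl by (simp add: m_assoc)
  qed
  then show "eval_word \<phi> (u \<otimes>\<^bsub>free_group X\<^esub> v) = eval_word \<phi> u \<otimes> eval_word \<phi> v"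
    by (simp add: free_group_def)
qed (use eval_word_closed[OF \<phi>] in \<open>auto simp: free_group_def\<close>)

lemma (in group) eval_word_generator:
  "\<phi> \<in> X \<rightarrow> carrier G \<Longrightarrow> x \<in> X \<Longrightarrow> eval_word \<phi> [(x, True)] = \<phi> x"
  by (auto simp: eval_word_def Pi_iff)

lemma (in group) hom_free_group_unique:
  assumes h: "h \<in> hom (free_group X) G" and w: "w \<in> carrier (free_group X)"
  shows "h w = eval_word (\<lambda>x. h [(x, True)]) w"
proof -
  interpret F: group "free_group X" by (rule group_free_group)
  interpret h: group_hom "free_group X" G h
    by unfold_locales (rule h)
  have gen: "[(x, b)] \<in> carrier (free_group X)" if "x \<in> X" for x b
    using that by (auto simp: free_group_def reduced_Cons)
  have inv_gen: "inv\<^bsub>free_group X\<^esub> [(x, True)] = [(x, False)]" if "x \<in> X" for x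
    by (rule F.inv_equality) (use gen that in \<open>auto simp: free_group_def\<close>)
  show ?thesis using w
  proof (induction w)
    case Nil
    then show ?case using h.hom_one by (simp add: eval_word_def free_group_def)
  next
    case (Cons a w)
    obtain x b where a: "a = (x, b)" by fastforce
    have x: "x \<in> X" and wF: "w \<in> carrier (free_group X)"
      using Cons.prems a by (auto simp: free_group_def reduced_Cons)
    have "a # w = [a] \<otimes>\<^bsub>free_group X\<^esub> w"
      using Cons.prems by (cases w) (auto simp: free_group_def reduced_Cons)
    then have "h (a # w) = h [a] \<otimes> h w"
      using h.hom_mult[of "[a]" w] gen[OF x] wF a by simp
    moreover have "h [(x, False)] = inv (h [(x, True)])"
      using h.hom_inv[OF gen[OF x]] inv_gen[OF x] by metis
    ultimately show ?case
      using Cons.IH[OF wF] a by (auto simp: eval_word_def)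
  qed
qed


section \<open>Flexible BS-rigidity\<close>

text \<open>The distance of \<open>\<sigma> \<in> Sym(n)\<close> and \<open>\<tau> \<in> Sym(N)\<close> with \<open>n \<le> N\<close>. The smaller degree \<open>n\<close> is an
  explicit argument, since elements of \<^const>\<open>sym_group\<close> are functions on all of \<open>nat\<close>.\<close>

definition perm_dist :: "nat \<Rightarrow> (nat \<Rightarrow> nat) \<Rightarrow> (nat \<Rightarrow> nat) \<Rightarrow> real" where
  "perm_dist n \<sigma> \<tau> = real (card {x \<in> {1..n}. \<sigma> x \<noteq> \<tau> x}) / real n"

text \<open>For \<open>f : \<Gamma> \<rightarrow> Sym(n)\<close> with \<open>n > 0\<close>, the distribution \<open>N\<^sub>f\<^sub>,\<^sub>Q\<close> on the subsets of \<open>Q\<close>.\<close>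

definition stab_pmf :: "nat \<Rightarrow> ('a \<Rightarrow> nat \<Rightarrow> nat) \<Rightarrow> 'a set \<Rightarrow> 'a set pmf" where
  "stab_pmf n f Q = map_pmf (\<lambda>x. {\<gamma> \<in> Q. f \<gamma> x = x}) (pmf_of_set {1..n})"

definition tv_dist :: "'b set \<Rightarrow> 'b pmf \<Rightarrow> 'b pmf \<Rightarrow> real" where
  "tv_dist \<Omega> p q = (\<Sum>\<omega>\<in>\<Omega>. \<bar>pmf p \<omega> - pmf q \<omega>\<bar>) / 2"

text \<open>In the following definition sequences are indexed from 0 instead of 1.\<close>

definition UB_flexibly_BS_rigid :: "('a, 'b) monoid_scheme \<Rightarrow> bool" where
  "UB_flexibly_BS_rigid G \<longleftrightarrow>
     (\<forall>(n :: nat \<Rightarrow> nat) (f :: nat \<Rightarrow> 'a \<Rightarrow> nat \<Rightarrow> nat).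
        (\<forall>l. 0 < n l) \<and>
        (\<forall>l. f l \<in> carrier G \<rightarrow> carrier (sym_group (n l))) \<and>
        filterlim n at_top sequentially \<and>
        (\<forall>\<gamma>\<^sub>1 \<in> carrier G. \<forall>\<gamma>\<^sub>2 \<in> carrier G.
           (\<lambda>l. perm_dist (n l) (f l (\<gamma>\<^sub>1 \<otimes>\<^bsub>G\<^esub> \<gamma>\<^sub>2)) (f l \<gamma>\<^sub>1 \<otimes>\<^bsub>sym_group (n l)\<^esub> f l \<gamma>\<^sub>2))
             \<longlonglongrightarrow> 0) \<and>
        (\<exists>g :: nat \<Rightarrow> 'a \<Rightarrow> nat \<Rightarrow> nat.
           (\<forall>l. g l \<in> hom G (sym_group (n l))) \<and>
           (\<forall>Q. finite Q \<and> Q \<subseteq> carrier G \<longrightarrow>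
              (\<lambda>l. tv_dist (Pow Q) (stab_pmf (n l) (f l) Q) (stab_pmf (n l) (g l) Q))
                \<longlonglongrightarrow> 0))
        \<longrightarrow>
        (\<exists>(N :: nat \<Rightarrow> nat) (h :: nat \<Rightarrow> 'a \<Rightarrow> nat \<Rightarrow> nat).
           (\<forall>l. n l \<le> N l) \<and>
           (\<forall>l. h l \<in> hom G (sym_group (N l))) \<and>
           (\<forall>\<gamma> \<in> carrier G. (\<lambda>l. perm_dist (n l) (f l \<gamma>) (h l \<gamma>)) \<longlonglongrightarrow> 0)))"

end

theory Submission
  imports Defs
begin

text \<open>Since \<open>F\<^sub>m \<times> \<Lambda>\<close> retracts onto \<open>F\<^sub>2 \<times> \<int>\<close> and since actions can be induced from subgroups of finite
  index, it suffices to build a bad asymptotic action of \<open>F\<^sub>2 \<times> \<int>\<close>. On \<open>(\<int>/n)\<^sup>3\<close> with \<open>n = 2 M\<^sup>2\<close> let the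
  central generator \<open>t\<close> act by \<open>z \<mapsto> z + M\<close>. It commutes with the translations in \<open>x\<close> and \<open>y\<close>, with the
  two shears of the \<open>(x, y)\<close>-plane and with \<open>z \<mapsto> z + x\<close>; these five maps have no almost invariant
  set of intermediate density (Fourier transform and ping-pong on the dual group). A sixth map, which
  translates \<open>x\<close> on one half of the range of \<open>z\<close> only, commutes with \<open>t\<close> up to an error \<open>1 / M\<close>, but does
  not commute at all with \<open>t ^ M\<close>. If an honest action \<open>t', \<sigma>'\<close> were close to \<open>t, \<sigma>\<close>, the set where
  \<open>t' ^ j\<close> and \<open>t ^ j\<close> agree would be almost invariant under the five maps uniformly in \<open>j\<close>, hence would
  stay large up to \<open>j = M\<close>: a contradiction. Spreading the six maps over six sheets encodes
  them by two generators.

  An element of \<open>F\<^sub>2\<close> displaces \<open>z\<close> by one of finitely many integral affine functions of \<open>(x, y)\<close>, which almost never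
  equals a nonzero multiple \<open>M e\<close> modulo \<open>n\<close> with \<open>e\<close> fixed. So the points fixed
  by \<open>w t ^ e\<close> are asymptotically the same as in the honest action in which \<open>F\<^sub>2\<close> acts as before and \<open>t\<close>
  rotates an additional coordinate.\<close>

section \<open>Fourier analysis on a discrete cube\<close>

text \<open>Closeness on the generators says nothing about \<open>t ^ M\<close>: the error of a
  power grows linearly in the exponent, and \<open>M\<close> tends to infinity. Expansion stops this
  growth. The set where the two \<open>j\<close>-th powers agree has a boundary that is small
  uniformly in \<open>j\<close>, so its density is never intermediate; one further step loses only a
  tiny proportion, so a density above 7/8 cannot jump below 1/8 and has to come back above 7/8. The
  modulus \<open>2 * M\<^sup>2\<close> balances two demands: \<open>t ^ M\<close> must be the
  translation by half the modulus, which exchanges the two halves seen by the sixth map, whereas a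
  single step \<open>M\<close> may cross the borders of the halves only for a proportion
  \<open>1 / M\<close> of the points. The shear of \<open>z\<close> by \<open>x\<close> is present
  because functions of \<open>z\<close> alone are invariant under the other four maps. The
  contradiction is drawn from an injection of the model and from commutation relations alone, which
  is why it holds however many points are added to the honest action.\<close>

definition character :: "int \<Rightarrow> int \<Rightarrow> complex" where
  "character n m = cis (2 * pi * real_of_int m / real_of_int n)"

lemma norm_character [simp]: "norm (character n m) = 1"
  by (simp add: character_def)

lemma character_0 [simp]: "character n 0 = 1"
  by (simp add: character_def)

lemma character_add: "character n (a + b) = character n a * character n b"
  by (simp add: character_def cis_mult add_divide_distrib distrib_left)

lemma cnj_character: "cnj (character n a) = character n (- a)"
  by (simp add: character_def cis_cnj)

lemma character_eq_1_iff:
  assumes "n > 0"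
  shows "character n m = 1 \<longleftrightarrow> n dvd m"
proof
  assume "character n m = 1"
  then have "cos (2 * pi * real_of_int m / real_of_int n) = 1"
    by (metis character_def cis.simps(1) one_complex.simps(1))
  then obtain k :: int where "2 * pi * real_of_int m / real_of_int n = k * 2 * pi"
    using cos_one_2pi_int by auto
  then have "real_of_int m = real_of_int (n * k)"
    using assms by (simp add: field_simps)
  then show "n dvd m" by (metis of_int_eq_iff dvd_triv_left)
next
  assume "n dvd m"
  then obtain k where "m = n * k" by blast
  then have "2 * pi * real_of_int m / real_of_int n = 2 * pi * of_int k"
    using assms by simp
  then show "character n m = 1"
    unfolding character_def by (metis Ints_of_int cis_multiple_2pi)
qed

lemma character_cong:
  assumes "n > 0" "n dvd a - b"
  shows "character n a = character n b"
  using character_add[of n "a - b" b] character_eq_1_iff[OF assms(1), of "a - b"] assms(2) by simp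

text \<open>Multiplication by \<open>character (2 * h) m\<close> shifts the index by one, and the
  end terms at \<open>h\<close> and \<open>- h\<close> agree because they differ by a full period.
  So the sum is fixed by a factor that differs from 1 unless \<open>2 * h\<close> divides
  \<open>m\<close>.\<close>

lemma sum_character:
  assumes h: "h > 0"
  shows "(\<Sum>k\<in>{-h..<h}. character (2 * h) (k * m)) = (if 2 * h dvd m then of_int (2 * h) else 0)"
proof (cases "2 * h dvd m")
  case True
  then have "character (2 * h) (k * m) = 1" for k
    using character_eq_1_iff[of "2 * h"] h by simp
  then show ?thesis using True h by simp
next
  case False
  let ?f = "\<lambda>k. character (2 * h) (k * m)"
  let ?S = "\<Sum>k\<in>{-h..<h}. ?f k"
  have "character (2 * h) m * ?S = (\<Sum>k\<in>{-h..<h}. ?f (k + 1))"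
    by (simp add: sum_distrib_left character_add[symmetric] algebra_simps)
  also have "\<dots> = (\<Sum>k\<in>{-h+1..<h+1}. ?f k)"
    by (rule sum.reindex_bij_witness[of _ "\<lambda>k. k - 1" "\<lambda>k. k + 1"]) auto
  also have "\<dots> = (\<Sum>k\<in>insert h {-h+1..<h}. ?f k)"
    by (rule sum.cong) (use h in auto)
  also have "\<dots> = ?f h + (\<Sum>k\<in>{-h+1..<h}. ?f k)" by simp
  also have "?f h = ?f (- h)"
    by (rule character_cong) (use h in \<open>auto simp: algebra_simps\<close>)
  also have "?f (- h) + (\<Sum>k\<in>{-h+1..<h}. ?f k) = (\<Sum>k\<in>insert (-h) {-h+1..<h}. ?f k)" by simp
  also have "\<dots> = ?S"
    by (rule sum.cong) (use h in auto)
  finally have "(character (2 * h) m - 1) * ?S = 0" by (simp add: algebra_simps)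
  then show ?thesis using False character_eq_1_iff[of "2 * h" m] h by auto
qed

type_synonym point = "int \<times> int \<times> int"

definition cube :: "int \<Rightarrow> point set" where
  "cube n = {0..<n} \<times> {0..<n} \<times> {0..<n}"

text \<open>Frequencies are represented by residues centred at 0, so that signs and absolute values
  of coordinates make sense; ping-pong is played with them.\<close>

definition dual_cube :: "int \<Rightarrow> point set" where
  "dual_cube h = {-h..<h} \<times> {-h..<h} \<times> {-h..<h}"

fun pairing :: "point \<Rightarrow> point \<Rightarrow> int" where
  "pairing (a, b, c) (x, y, z) = a * x + b * y + c * z"

definition fourier :: "int \<Rightarrow> (point \<Rightarrow> complex) \<Rightarrow> point \<Rightarrow> complex" where
  "fourier n g \<xi> = (\<Sum>x\<in>cube n. g x * character n (pairing \<xi> x))"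

lemma finite_cube [simp]: "finite (cube n)" by (simp add: cube_def)
lemma finite_dual_cube [simp]: "finite (dual_cube n)" by (simp add: dual_cube_def)

lemma card_cube: "n \<ge> 0 \<Longrightarrow> card (cube n) = nat n ^ 3"
  by (simp add: cube_def card_cartesian_product power3_eq_cube)

lemma sum_character_pairing:
  assumes h: "h > 0" and x: "x \<in> cube (2 * h)" and y: "y \<in> cube (2 * h)"
  shows "(\<Sum>\<xi>\<in>dual_cube h. character (2 * h) (pairing \<xi> x) * cnj (character (2 * h) (pairing \<xi> y)))
    = (if x = y then of_int (2 * h) ^ 3 else 0)"
proof -
  obtain x1 x2 x3 where xx: "x = (x1, x2, x3)" by (cases x)
  obtain y1 y2 y3 where yy: "y = (y1, y2, y3)" by (cases y)
  let ?e = "character (2 * h)"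
  have dv: "2 * h dvd u - v \<longleftrightarrow> u = v" if "0 \<le> u" "u < 2 * h" "0 \<le> v" "v < 2 * h" for u v
    using that by (metis mod_pos_pos_trivial mod_eq_dvd_iff)
  have e: "?e (pairing (a, b, c) x) * cnj (?e (pairing (a, b, c) y))
      = ?e (a * (x1 - y1)) * (?e (b * (x2 - y2)) * ?e (c * (x3 - y3)))" for a b c
    by (simp add: xx yy cnj_character character_add[symmetric] algebra_simps)
  have "(\<Sum>\<xi>\<in>dual_cube h. ?e (pairing \<xi> x) * cnj (?e (pairing \<xi> y)))
     = (\<Sum>(a, b, c)\<in>dual_cube h. ?e (a * (x1 - y1)) * (?e (b * (x2 - y2)) * ?e (c * (x3 - y3))))"
    by (rule sum.cong[OF refl]) (use e in \<open>auto\<close>)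
  also have "\<dots> = (\<Sum>a\<in>{-h..<h}. ?e (a * (x1 - y1))) * ((\<Sum>b\<in>{-h..<h}. ?e (b * (x2 - y2))) *
      (\<Sum>c\<in>{-h..<h}. ?e (c * (x3 - y3))))"
    by (simp only: dual_cube_def sum.cartesian_product[symmetric] sum_distrib_left[symmetric]
        sum_distrib_right[symmetric])
  also have "\<dots> = (if x = y then of_int (2 * h) ^ 3 else 0)"
    using x y dv by (auto simp: sum_character[OF h] xx yy cube_def power3_eq_cube)
  finally show ?thesis .
qed

text \<open>After expanding the square and summing over the frequencies first, orthogonality leaves
  only the diagonal. The transform is not normalized, hence the cubic factor.\<close>

lemma parseval:
  assumes h: "h > 0"
  shows "(\<Sum>\<xi>\<in>dual_cube h. (norm (fourier (2 * h) g \<xi>))\<^sup>2)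
    = of_int (2 * h) ^ 3 * (\<Sum>x\<in>cube (2 * h). (norm (g x))\<^sup>2)"
proof -
  let ?C = "cube (2 * h)" and ?e = "\<lambda>\<xi> x. character (2 * h) (pairing \<xi> x)"
  have "of_real (\<Sum>\<xi>\<in>dual_cube h. (norm (fourier (2 * h) g \<xi>))\<^sup>2)
     = (\<Sum>\<xi>\<in>dual_cube h. fourier (2 * h) g \<xi> * cnj (fourier (2 * h) g \<xi>))"
    by (simp add: complex_norm_square[symmetric])
  also have "\<dots> = (\<Sum>\<xi>\<in>dual_cube h. \<Sum>x\<in>?C. \<Sum>y\<in>?C. g x * cnj (g y) * (?e \<xi> x * cnj (?e \<xi> y)))"
    unfolding fourier_def cnj_sum sum_product by (simp add: mult_ac)
  also have "\<dots> = (\<Sum>x\<in>?C. \<Sum>\<xi>\<in>dual_cube h. \<Sum>y\<in>?C. g x * cnj (g y) * (?e \<xi> x * cnj (?e \<xi> y)))"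
    by (rule sum.swap)
  also have "\<dots> = (\<Sum>x\<in>?C. \<Sum>y\<in>?C. \<Sum>\<xi>\<in>dual_cube h. g x * cnj (g y) * (?e \<xi> x * cnj (?e \<xi> y)))"
    by (intro sum.cong refl sum.swap)
  also have "\<dots> = (\<Sum>x\<in>?C. \<Sum>y\<in>?C. g x * cnj (g y) * (if x = y then of_int (2 * h) ^ 3 else 0))"
    by (intro sum.cong refl) (simp add: sum_distrib_left[symmetric] sum_character_pairing[OF h])
  also have "\<dots> = (\<Sum>x\<in>?C. g x * cnj (g x) * of_int (2 * h) ^ 3)"
    by (intro sum.cong refl) (simp add: if_distrib sum.delta' cong: if_cong)
  also have "\<dots> = of_real (of_int (2 * h) ^ 3 * (\<Sum>x\<in>?C. (norm (g x))\<^sup>2))"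
    by (simp add: complex_norm_square[symmetric] sum_distrib_left mult_ac)
  finally show ?thesis using of_real_eq_iff by blast
qed

section \<open>Expansion of translations and shears\<close>

fun trans1 :: "int \<Rightarrow> point \<Rightarrow> point" where "trans1 n (x, y, z) = ((x + 1) mod n, y, z)"
fun trans2 :: "int \<Rightarrow> point \<Rightarrow> point" where "trans2 n (x, y, z) = (x, (y + 1) mod n, z)"
fun shear1 :: "int \<Rightarrow> point \<Rightarrow> point" where "shear1 n (x, y, z) = ((x + y) mod n, y, z)"
fun shear2 :: "int \<Rightarrow> point \<Rightarrow> point" where "shear2 n (x, y, z) = (x, (y + x) mod n, z)"
fun shear3 :: "int \<Rightarrow> point \<Rightarrow> point" where "shear3 n (x, y, z) = (x, y, (z + x) mod n)"

lemma add_mod_cancel: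
  fixes a b c n :: int
  shows "(a + c) mod n = (b + c) mod n \<longleftrightarrow> a mod n = b mod n"
  by (metis add_diff_cancel_right mod_eq_dvd_iff)

lemma bij_betw_cubeI:
  assumes "\<And>x. x \<in> cube n \<Longrightarrow> p x \<in> cube n" "inj_on p (cube n)"
  shows "bij_betw p (cube n) (cube n)"
  using assms by (simp add: bij_betw_def endo_inj_surj image_subset_iff)

lemma bij_betw_moves:
  assumes "n > 0"
  shows "bij_betw (trans1 n) (cube n) (cube n)" "bij_betw (trans2 n) (cube n) (cube n)"
    "bij_betw (shear1 n) (cube n) (cube n)" "bij_betw (shear2 n) (cube n) (cube n)"
    "bij_betw (shear3 n) (cube n) (cube n)"
  by (rule bij_betw_cubeI; use assms in \<open>auto simp: cube_def inj_on_def add_mod_cancel\<close>)+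

text \<open>The spectral measure of the indicator of \<open>E\<close>, scaled so that the total mass
  is the density of \<open>E\<close> and the mass at frequency 0 is the square of the density. A
  bound for the mass away from 0 is therefore a bound for density minus squared density.\<close>

definition mass :: "int \<Rightarrow> point set \<Rightarrow> point set \<Rightarrow> real" where
  "mass n E S = (\<Sum>\<xi>\<in>S. (norm (fourier n (indicator E) \<xi>))\<^sup>2) / real_of_int n ^ 6"

lemma mass_mono: "S \<subseteq> T \<Longrightarrow> finite T \<Longrightarrow> mass n E S \<le> mass n E T"
  unfolding mass_def by (intro divide_right_mono sum_mono2) (auto simp: zero_le_even_power)

lemma mass_Un: "finite S \<Longrightarrow> finite T \<Longrightarrow> S \<inter> T = {} \<Longrightarrow> mass n E (S \<union> T) = mass n E S + mass n E T"
  unfolding mass_def by (simp add: sum.union_disjoint add_divide_distrib)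

lemma mass_Un_le: "finite S \<Longrightarrow> finite T \<Longrightarrow> mass n E (S \<union> T) \<le> mass n E S + mass n E T"
  using mass_Un[of S "T - S" n E] mass_mono[of "T - S" T n E] by simp

lemma mass_le_Un:
  "S \<subseteq> T \<union> U \<Longrightarrow> finite T \<Longrightarrow> finite U \<Longrightarrow> mass n E S \<le> mass n E T + mass n E U"
  by (meson finite_UnI mass_Un_le mass_mono order_trans)

lemma sum_indicator_cube:
  assumes "E \<subseteq> cube n"
  shows "(\<Sum>x\<in>cube n. (norm (indicator E x :: complex))\<^sup>2) = card E"
proof -
  have "(\<Sum>x\<in>cube n. (norm (indicator E x :: complex))\<^sup>2) = (\<Sum>x\<in>cube n. indicator E x)"
    by (intro sum.cong) (auto simp: indicator_def)
  also have "\<dots> = card (cube n \<inter> E)"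
    by (simp add: indicator_def sum.If_cases Int_def)
  also have "cube n \<inter> E = E" using assms by auto
  finally show ?thesis .
qed

lemma mass_dual_cube:
  assumes "h > 0" "E \<subseteq> cube (2 * h)"
  shows "mass (2 * h) E (dual_cube h) = card E / real_of_int (2 * h) ^ 3"
  unfolding mass_def parseval[OF assms(1)] sum_indicator_cube[OF assms(2)]
  using assms(1) by (simp add: field_simps flip: power_add)

lemma mass_zero:
  assumes "E \<subseteq> cube n"
  shows "mass n E {(0, 0, 0)} = (card E / real_of_int n ^ 3)\<^sup>2"
proof -
  have "fourier n (indicator E) (0, 0, 0) = (\<Sum>x\<in>cube n. indicator E x)"
    unfolding fourier_def by (intro sum.cong) auto
  also have "\<dots> = of_nat (card (cube n \<inter> E))"
    by (simp add: indicator_def sum.If_cases Int_def)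
  also have "cube n \<inter> E = E" using assms by auto
  finally show ?thesis
    by (simp add: mass_def power_divide flip: power_mult)
qed

lemma card_le_cube: "E \<subseteq> cube n \<Longrightarrow> n \<ge> 0 \<Longrightarrow> real (card E) \<le> real_of_int n ^ 3"
  using card_mono[of "cube n" E] card_cube[of n]
  by (metis finite_cube of_nat_le_iff of_nat_nat of_nat_power)

text \<open>Parseval for the difference of the indicators, whose modulus is the indicator of the
  symmetric difference.\<close>

lemma norm_fourier_diff:
  assumes h: "h > 0" and E: "E \<subseteq> cube (2 * h)" "E' \<subseteq> cube (2 * h)"
  shows "(\<Sum>\<xi>\<in>dual_cube h. (norm (fourier (2 * h) (indicator E) \<xi> - fourier (2 * h) (indicator E') \<xi>))\<^sup>2)
     = real_of_int (2 * h) ^ 3 * (card (E - E') + card (E' - E))"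
proof -
  let ?C = "cube (2 * h)"
  have fin: "finite E" "finite E'" using E finite_subset[OF _ finite_cube] by auto
  have "fourier (2 * h) (indicator E) \<xi> - fourier (2 * h) (indicator E') \<xi>
      = fourier (2 * h) (\<lambda>x. indicator E x - indicator E' x) \<xi>" for \<xi>
    by (simp add: fourier_def sum_subtractf left_diff_distrib)
  then have "(\<Sum>\<xi>\<in>dual_cube h. (norm (fourier (2 * h) (indicator E) \<xi> - fourier (2 * h) (indicator E') \<xi>))\<^sup>2)
     = real_of_int (2 * h) ^ 3 * (\<Sum>x\<in>?C. (norm (indicator E x - indicator E' x :: complex))\<^sup>2)"
    using parseval[OF h] by simp
  also have "(\<Sum>x\<in>?C. (norm (indicator E x - indicator E' x :: complex))\<^sup>2)
     = (\<Sum>x\<in>?C. (norm (indicator ((E - E') \<union> (E' - E)) x :: complex))\<^sup>2)"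
    by (intro sum.cong) (auto simp: indicator_def)
  also have "\<dots> = card ((E - E') \<union> (E' - E))"
    by (rule sum_indicator_cube) (use E in auto)
  also have "\<dots> = card (E - E') + card (E' - E)"
    using fin by (subst card_Un_disjoint) auto
  finally show ?thesis .
qed

text \<open>Triangle inequality in L2 on \<open>S\<close>: with \<open>N\<close> the number of
  points, \<open>A \<le> B + \<delta> * N\<close> and \<open>B \<le> N\<close>. Squaring gives a
  cross term of at most \<open>2 * \<delta>\<close> and a term
  \<open>\<delta>\<^sup>2 \<le> \<delta>\<close>, hence the 3. The hypothesis has
  \<open>\<delta>\<^sup>2\<close> because a symmetric difference measures a squared
  distance.\<close>

lemma mass_diff:
  assumes h: "h > 0" and E: "E \<subseteq> cube (2 * h)" "E' \<subseteq> cube (2 * h)" and S: "S \<subseteq> dual_cube h"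
    and \<delta>: "0 \<le> \<delta>" "\<delta> \<le> 1"
    and close: "real (card (E - E') + card (E' - E)) \<le> \<delta>\<^sup>2 * real_of_int (2 * h) ^ 3"
  shows "mass (2 * h) E S \<le> mass (2 * h) E' S + 3 * \<delta>"
proof -
  let ?f = "\<lambda>E \<xi>. norm (fourier (2 * h) (indicator E) \<xi>)"
  let ?d = "\<lambda>\<xi>. norm (fourier (2 * h) (indicator E) \<xi> - fourier (2 * h) (indicator E') \<xi>)"
  define N where "N = real_of_int (2 * h) ^ 3"
  have N: "N > 0" "N\<^sup>2 = real_of_int (2 * h) ^ 6" using h by (auto simp: N_def simp flip: power_mult)
  have fin: "finite S" using S finite_subset finite_dual_cube by blast
  define A where "A = L2_set (?f E) S"
  define B where "B = L2_set (?f E') S"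
  have m: "mass (2 * h) E S = A\<^sup>2 / N\<^sup>2" "mass (2 * h) E' S = B\<^sup>2 / N\<^sup>2"
    by (simp_all add: mass_def A_def B_def L2_set_def sum_nonneg N)
  have "(L2_set ?d S)\<^sup>2 \<le> (\<Sum>\<xi>\<in>dual_cube h. (?d \<xi>)\<^sup>2)"
    by (simp add: L2_set_def sum_nonneg sum_mono2[OF _ S])
  also have "\<dots> = N * (card (E - E') + card (E' - E))"
    by (simp only: norm_fourier_diff[OF h E] N_def)
  also have "\<dots> \<le> N * (\<delta>\<^sup>2 * N)"
    using close N(1) by (intro mult_left_mono) (simp_all only: N_def)
  also have "\<dots> = (\<delta> * N)\<^sup>2" by (simp add: power2_eq_square)
  finally have D: "L2_set ?d S \<le> \<delta> * N"
    by (rule power2_le_imp_le) (use \<delta>(1) N(1) in simp)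
  have "mass (2 * h) E' S \<le> mass (2 * h) E' (dual_cube h)"
    by (rule mass_mono[OF S]) simp
  also have "\<dots> \<le> 1"
    unfolding mass_dual_cube[OF h E(2)] using card_le_cube[OF E(2)] h N by (simp add: N_def)
  finally have "B\<^sup>2 \<le> N\<^sup>2" using N(1) unfolding m by simp
  then have B: "B \<le> N" by (rule power2_le_imp_le) (use N(1) in simp)
  have B0: "0 \<le> B" by (simp add: B_def)
  have "A \<le> L2_set (\<lambda>\<xi>. ?f E' \<xi> + ?d \<xi>) S"
    unfolding A_def by (intro L2_set_mono) (auto intro: norm_triangle_sub)
  also have "\<dots> \<le> B + L2_set ?d S" unfolding B_def by (rule L2_set_triangle_ineq)
  also have "\<dots> \<le> B + \<delta> * N" using D by simp
  finally have "A\<^sup>2 \<le> (B + \<delta> * N)\<^sup>2"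
    by (simp add: A_def power_mono)
  also have "\<dots> = B\<^sup>2 + 2 * \<delta> * (B * N) + \<delta> * \<delta> * N\<^sup>2" by (simp add: power2_eq_square algebra_simps)
  also have "\<dots> \<le> B\<^sup>2 + 2 * \<delta> * (N * N) + \<delta> * 1 * N\<^sup>2"
    using \<delta> N B B0 by (intro add_mono mult_mono mult_nonneg_nonneg) auto
  also have "\<dots> = B\<^sup>2 + 3 * \<delta> * N\<^sup>2" by (simp add: power2_eq_square)
  finally have "A\<^sup>2 / N\<^sup>2 \<le> (B\<^sup>2 + 3 * \<delta> * N\<^sup>2) / N\<^sup>2" by (simp add: divide_right_mono)
  then show ?thesis unfolding m using N(1) by (simp add: add_divide_distrib)
qed

text \<open>Change of variables along \<open>p\<close>. For a shear, \<open>w = 1\<close> and \<eta>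
  is the transposed shear of \<xi>; for a translation, \<eta> is \<xi> and \<open>w\<close> is a
  phase.\<close>

lemma fourier_pullback:
  assumes "bij_betw p (cube n) (cube n)"
    and "\<And>x. x \<in> cube n \<Longrightarrow> character n (pairing \<xi> (p x)) = w * character n (pairing \<eta> x)"
  shows "fourier n (indicator E) \<xi> = w * fourier n (indicator {x \<in> cube n. p x \<in> E}) \<eta>"
proof -
  have "fourier n (indicator E) \<xi> = (\<Sum>x\<in>cube n. indicator E (p x) * character n (pairing \<xi> (p x)))"
    unfolding fourier_def by (rule sum.reindex_bij_betw[OF assms(1), symmetric])
  also have "\<dots> = (\<Sum>x\<in>cube n. w * (indicator {x \<in> cube n. p x \<in> E} x * character n (pairing \<eta> x)))"
    by (rule sum.cong) (auto simp: assms(2) indicator_def)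
  also have "\<dots> = w * fourier n (indicator {x \<in> cube n. p x \<in> E}) \<eta>"
    by (simp only: fourier_def sum_distrib_left)
  finally show ?thesis .
qed

text \<open>A set and its preimage under a bijection have equally many points, so the two parts of
  their symmetric difference do as well.\<close>

lemma card_preimage_diff:
  assumes p: "bij_betw p C C" and E: "E \<subseteq> C" and C: "finite C"
  defines "E' \<equiv> {x \<in> C. p x \<in> E}"
  shows "card (E' - E) = card (E - E')" "E - E' = {x \<in> E. p x \<notin> E}"
proof -
  show "E - E' = {x \<in> E. p x \<notin> E}" using E by (auto simp: E'_def)
  have fin: "finite E" "finite E'" using C E by (auto simp: E'_def finite_subset)
  have "bij_betw p E' E"
    unfolding E'_def by (rule bij_betw_subset[OF p]) (use p E in \<open>auto simp: bij_betw_def\<close>)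
  then have "card E' = card E" by (rule bij_betw_same_card)
  moreover have "card E' = card (E' - E) + card (E \<inter> E')" "card E = card (E - E') + card (E \<inter> E')"
    using card_Diff_subset_Int[of E' E] card_Diff_subset_Int[of E E'] fin
      card_mono[of E' "E' \<inter> E"] card_mono[of E "E \<inter> E'"] by (auto simp: Int_commute)
  ultimately show "card (E' - E) = card (E - E')" by simp
qed

section \<open>Ping-pong on the dual group for an almost invariant set\<close>

locale almost_invariant_set =
  fixes h :: int and E :: "point set" and \<delta> :: real
  assumes h: "h > 0" and E: "E \<subseteq> cube (2 * h)" and \<delta>: "0 \<le> \<delta>" "\<delta> \<le> 1"
    and invariant: "\<And>p. p \<in> {trans1 (2 * h), trans2 (2 * h), shear1 (2 * h), shear2 (2 * h), shear3 (2 * h)}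
      \<Longrightarrow> 2 * real (card {x \<in> E. p x \<notin> E}) \<le> \<delta>\<^sup>2 * real_of_int (2 * h) ^ 3"
begin

abbreviation D :: "point set" where "D \<equiv> dual_cube h"
abbreviation \<mu> :: "point set \<Rightarrow> real" where "\<mu> \<equiv> mass (2 * h) E"

lemma finite_Collect_D [simp]: "finite {\<xi> \<in> D. P \<xi>}"
  by (rule finite_subset[OF _ finite_dual_cube]) auto

text \<open>The factor 2 in \<open>invariant\<close> pays for both parts of the symmetric
  difference, which have equal size.\<close>

lemma preimage_close:
  assumes p: "p \<in> {trans1 (2 * h), trans2 (2 * h), shear1 (2 * h), shear2 (2 * h), shear3 (2 * h)}"
  defines "E' \<equiv> {x \<in> cube (2 * h). p x \<in> E}"
  shows "bij_betw p (cube (2 * h)) (cube (2 * h))"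
    "real (card (E - E') + card (E' - E)) \<le> \<delta>\<^sup>2 * real_of_int (2 * h) ^ 3"
proof -
  show bij: "bij_betw p (cube (2 * h)) (cube (2 * h))"
    using p bij_betw_moves[of "2 * h"] h by auto
  show "real (card (E - E') + card (E' - E)) \<le> \<delta>\<^sup>2 * real_of_int (2 * h) ^ 3"
    using invariant[OF p] card_preimage_diff[OF bij E finite_cube] by (simp add: E'_def)
qed

text \<open>The transform of \<open>E\<close> at \<xi> equals that of the preimage of
  \<open>E\<close> at \<open>d \<xi>\<close>, and the preimage is close to \<open>E\<close>. Both
  directions are recorded since the second one handles the inverse of \<open>d\<close>. The map
  \<open>d\<close> is integral, without reduction modulo \<open>2 * h\<close>, so its image has to
  be kept inside \<open>D\<close>.\<close>

lemma mass_dual_move: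
  assumes p: "p \<in> {trans1 (2 * h), trans2 (2 * h), shear1 (2 * h), shear2 (2 * h), shear3 (2 * h)}"
    and d: "\<And>\<xi> x. x \<in> cube (2 * h) \<Longrightarrow> 2 * h dvd pairing \<xi> (p x) - pairing (d \<xi>) x"
    and inj: "inj d" and S: "S \<subseteq> D" "d ` S \<subseteq> D"
  shows "\<mu> S \<le> \<mu> (d ` S) + 3 * \<delta>" "\<mu> (d ` S) \<le> \<mu> S + 3 * \<delta>"
proof -
  define E' where "E' = {x \<in> cube (2 * h). p x \<in> E}"
  note pc = preimage_close[OF p, folded E'_def]
  have E': "E' \<subseteq> cube (2 * h)" by (auto simp: E'_def)
  have "fourier (2 * h) (indicator E) \<xi> = fourier (2 * h) (indicator E') (d \<xi>)" for \<xi>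
    using fourier_pullback[OF pc(1), of \<xi> 1 "d \<xi>" E] character_cong[OF _ d] h by (simp add: E'_def)
  then have "\<mu> S = mass (2 * h) E' (d ` S)"
    unfolding mass_def by (simp add: sum.reindex[OF inj_on_subset[OF inj]])
  then show "\<mu> S \<le> \<mu> (d ` S) + 3 * \<delta>" "\<mu> (d ` S) \<le> \<mu> S + 3 * \<delta>"
    using mass_diff[OF h E' E S(2) \<delta>] mass_diff[OF h E E' S(2) \<delta>] pc(2) by (simp_all add: add.commute)
qed

text \<open>Transposition turns \<open>shear1\<close> into adding \<open>a\<close> to
  \<open>b\<close>, \<open>shear2\<close> into adding \<open>b\<close> to \<open>a\<close>, and
  \<open>shear3\<close> into adding \<open>c\<close> to \<open>a\<close>. The subtracting maps are
  inverses of the first two and come from the second inequality of \<open>mass_dual_move\<close>,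
  applied to the image of \<open>S\<close>.\<close>

lemma mass_shears:
  assumes "S \<subseteq> D" "d ` S \<subseteq> D"
    and "d \<in> {\<lambda>(a, b, c). (a, b + a, c), \<lambda>(a, b, c). (a, b - a, c), \<lambda>(a, b, c). (a + b, b, c),
      \<lambda>(a, b, c). (a - b, b, c), \<lambda>(a, b, c). (a + c, b, c)}"
  shows "\<mu> S \<le> \<mu> (d ` S) + 3 * \<delta>"
proof -
  let ?n = "2 * h"
  have modsub: "?n dvd b * (y mod ?n) - b * y" for b y
    by (metis dvd_minus_mod dvd_mult minus_diff_eq dvd_minus_iff right_diff_distrib)
  have dv: "?n dvd pairing \<xi> (shear1 ?n x) - pairing ((\<lambda>(a, b, c). (a, b + a, c)) \<xi>) x"
    "?n dvd pairing \<xi> (shear2 ?n x) - pairing ((\<lambda>(a, b, c). (a + b, b, c)) \<xi>) x"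
    "?n dvd pairing \<xi> (shear3 ?n x) - pairing ((\<lambda>(a, b, c). (a + c, b, c)) \<xi>) x" for \<xi> x
    using modsub[of "fst \<xi>" "fst x + fst (snd x)"] modsub[of "fst (snd \<xi>)" "fst (snd x) + fst x"]
      modsub[of "snd (snd \<xi>)" "snd (snd x) + fst x"]
    by (cases \<xi>; cases x; simp add: algebra_simps)+
  have inj: "inj (\<lambda>(a :: int, b :: int, c :: int). (a, b + a, c))"
      "inj (\<lambda>(a :: int, b :: int, c :: int). (a + b, b, c))"
      "inj (\<lambda>(a :: int, b :: int, c :: int). (a + c, b, c))"
    by (auto simp: inj_on_def)
  consider "d = (\<lambda>(a, b, c). (a, b + a, c))" | "d = (\<lambda>(a, b, c). (a, b - a, c))"
    | "d = (\<lambda>(a, b, c). (a + b, b, c))" | "d = (\<lambda>(a, b, c). (a - b, b, c))"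
    | "d = (\<lambda>(a, b, c). (a + c, b, c))" using assms(3) by blast
  then show ?thesis
  proof cases
    case 1
    show ?thesis
      using mass_dual_move(1)[of "shear1 ?n" d S] dv(1) inj(1) assms(1,2) unfolding 1 by blast
  next
    case 2
    let ?d = "\<lambda>(a, b, c). (a, b + a, c)"
    have "?d ` d ` S = S" by (force simp: 2 image_iff)
    then show ?thesis
      using mass_dual_move(2)[of "shear1 ?n" ?d "d ` S"] dv(1) inj(1) assms(1,2) by simp
  next
    case 3
    show ?thesis
      using mass_dual_move(1)[of "shear2 ?n" d S] dv(2) inj(2) assms(1,2) unfolding 3 by blast
  next
    case 4
    let ?d = "\<lambda>(a, b, c). (a + b, b, c)"
    have "?d ` d ` S = S" by (force simp: 4 image_iff)
    then show ?thesis
      using mass_dual_move(2)[of "shear2 ?n" ?d "d ` S"] dv(2) inj(2) assms(1,2) by simp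
  next
    case 5
    show ?thesis
      using mass_dual_move(1)[of "shear3 ?n" d S] dv(3) inj(3) assms(1,2) unfolding 5 by blast
  qed
qed

text \<open>The translation multiplies the coefficient at \<xi> by a phase of angle
  \<open>pi * d \<xi> / h\<close>. On the given frequencies this phase has nonpositive real part, so
  its squared distance from 1 is at least 2, while an almost invariant set barely changes under the
  translation.\<close>

lemma mass_off_kernel:
  assumes p: "p \<in> {trans1 (2 * h), trans2 (2 * h)}"
    and d: "\<And>\<xi> x. x \<in> cube (2 * h) \<Longrightarrow> 2 * h dvd pairing \<xi> (p x) - (pairing \<xi> x + d \<xi>)"
  shows "\<mu> {\<xi> \<in> D. h \<le> 2 * \<bar>d \<xi>\<bar> \<and> \<bar>d \<xi>\<bar> \<le> h} \<le> \<delta> / 2"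
proof -
  define E' where "E' = {x \<in> cube (2 * h). p x \<in> E}"
  have p': "p \<in> {trans1 (2 * h), trans2 (2 * h), shear1 (2 * h), shear2 (2 * h), shear3 (2 * h)}"
    using p by auto
  note pc = preimage_close[OF p', folded E'_def]
  have E': "E' \<subseteq> cube (2 * h)" by (auto simp: E'_def)
  let ?n = "2 * h"
  let ?f = "\<lambda>E. fourier ?n (indicator E)"
  let ?R = "{\<xi> \<in> D. h \<le> 2 * \<bar>d \<xi>\<bar> \<and> \<bar>d \<xi>\<bar> \<le> h}"
  have fE: "?f E \<xi> = character ?n (d \<xi>) * ?f E' \<xi>" for \<xi>
    using fourier_pullback[OF pc(1), of \<xi> "character ?n (d \<xi>)" \<xi> E] character_cong[OF _ d] h
    by (simp add: E'_def character_add mult.commute)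
  have "2 * (norm (?f E \<xi>))\<^sup>2 \<le> (norm (?f E \<xi> - ?f E' \<xi>))\<^sup>2" if "\<xi> \<in> ?R" for \<xi>
  proof -
    let ?\<theta> = "2 * pi * real_of_int (d \<xi>) / real_of_int ?n"
    have "real_of_int h \<le> real_of_int (2 * \<bar>d \<xi>\<bar>)" "real_of_int \<bar>d \<xi>\<bar> \<le> real_of_int h"
      unfolding of_int_le_iff using that by blast+
    then have "pi / 2 \<le> \<bar>?\<theta>\<bar>" "\<bar>?\<theta>\<bar> \<le> 3 * pi / 2"
      using h by (auto simp: abs_mult field_simps)
    then have "0 \<le> sin (\<bar>?\<theta>\<bar> - pi / 2)"
      by (intro sin_ge_zero) linarith+
    then have "cos \<bar>?\<theta>\<bar> \<le> 0"
      by (simp add: sin_diff)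
    then have "cos ?\<theta> \<le> 0" by (simp only: cos_abs_real)
    then have "2 \<le> (norm (character ?n (d \<xi>) - 1))\<^sup>2"
      unfolding character_def cmod_power2
      using sin_cos_squared_add3[of ?\<theta>] by (simp add: power2_eq_square algebra_simps)
    moreover have "?f E \<xi> - ?f E' \<xi> = (character ?n (d \<xi>) - 1) * ?f E' \<xi>"
      unfolding fE by (simp only: left_diff_distrib mult_1)
    moreover have "norm (?f E \<xi>) = norm (?f E' \<xi>)"
      unfolding fE by (simp only: norm_mult norm_character mult_1)
    ultimately show ?thesis
      by (simp add: norm_mult power_mult_distrib mult_right_mono)
  qed
  then have "(\<Sum>\<xi>\<in>?R. 2 * (norm (?f E \<xi>))\<^sup>2) \<le> (\<Sum>\<xi>\<in>?R. (norm (?f E \<xi> - ?f E' \<xi>))\<^sup>2)"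
    by (rule sum_mono)
  also have "\<dots> \<le> (\<Sum>\<xi>\<in>D. (norm (?f E \<xi> - ?f E' \<xi>))\<^sup>2)"
    by (rule sum_mono2) auto
  also have "\<dots> = real_of_int ?n ^ 3 * (card (E - E') + card (E' - E))"
    by (rule norm_fourier_diff[OF h E E'])
  also have "\<dots> \<le> real_of_int ?n ^ 3 * (\<delta>\<^sup>2 * real_of_int ?n ^ 3)"
    using pc(2) h by (intro mult_left_mono) auto
  also have "\<dots> = \<delta>\<^sup>2 * real_of_int ?n ^ 6"
    by (simp flip: power_add add: mult_ac)
  finally have "2 * \<mu> ?R \<le> \<delta>\<^sup>2"
    using h by (simp add: mass_def sum_distrib_left[symmetric] divide_le_eq)
  moreover have "\<delta>\<^sup>2 \<le> \<delta>" using \<delta> by (simp add: power2_eq_square mult_left_le)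
  ultimately show ?thesis by simp
qed

text \<open>On this box the shears of the \<open>(a, b)\<close>-plane keep both coordinates below
  \<open>h\<close> in absolute value, so no wrap-around occurs.\<close>

definition central_box :: "point set" where
  "central_box = {\<xi> \<in> D. case \<xi> of (a, b, c) \<Rightarrow> 2 * \<bar>a\<bar> < h \<and> 2 * \<bar>b\<bar> < h}"

text \<open>Outside the box one of the two translations has a phase far from 1; each of the two
  excluded regions costs \<open>\<delta> / 2\<close>.\<close>

lemma mass_central_box:
  assumes "S \<subseteq> D"
  shows "\<mu> S \<le> \<mu> (S \<inter> central_box) + \<delta>"
proof -
  let ?n = "2 * h"
  let ?R1 = "{\<xi> \<in> D. h \<le> 2 * \<bar>fst \<xi>\<bar> \<and> \<bar>fst \<xi>\<bar> \<le> h}"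
  let ?R2 = "{\<xi> \<in> D. h \<le> 2 * \<bar>fst (snd \<xi>)\<bar> \<and> \<bar>fst (snd \<xi>)\<bar> \<le> h}"
  have modsub: "?n dvd b * (y mod ?n) - b * y" for b y
    by (metis dvd_minus_mod dvd_mult minus_diff_eq dvd_minus_iff right_diff_distrib)
  have "?n dvd pairing \<xi> (trans1 ?n x) - (pairing \<xi> x + fst \<xi>)" for \<xi> x
    using modsub[of "fst \<xi>" "fst x + 1"] by (cases \<xi>; cases x; simp add: algebra_simps)
  then have R1: "\<mu> ?R1 \<le> \<delta> / 2" by (intro mass_off_kernel[of "trans1 ?n"]) auto
  have "?n dvd pairing \<xi> (trans2 ?n x) - (pairing \<xi> x + fst (snd \<xi>))" for \<xi> x
    using modsub[of "fst (snd \<xi>)" "fst (snd x) + 1"] by (cases \<xi>; cases x; simp add: algebra_simps)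
  then have R2: "\<mu> ?R2 \<le> \<delta> / 2" by (intro mass_off_kernel[of "trans2 ?n"]) auto
  have "S \<subseteq> (S \<inter> central_box) \<union> (?R1 \<union> ?R2)"
  proof
    fix \<xi> assume "\<xi> \<in> S"
    then have "\<xi> \<in> D" using assms by blast
    then show "\<xi> \<in> (S \<inter> central_box) \<union> (?R1 \<union> ?R2)"
      using \<open>\<xi> \<in> S\<close> by (cases \<xi>) (auto simp: central_box_def dual_cube_def)
  qed
  then have "\<mu> S \<le> \<mu> (S \<inter> central_box) + \<mu> (?R1 \<union> ?R2)"
    using assms by (intro mass_le_Un) (auto intro: finite_subset[OF _ finite_dual_cube])
  moreover have "\<mu> (?R1 \<union> ?R2) \<le> \<mu> ?R1 + \<mu> ?R2" by (rule mass_Un_le) auto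
  ultimately show ?thesis using R1 R2 by simp
qed

text \<open>Each image has mass at least \<open>\<mu> P - 4 * \<delta>\<close>: one \<delta> for
  entering the box, three for the shear. Two disjoint images fit into \<open>P\<close>, so
  \<open>2 * (\<mu> P - 4 * \<delta>) \<le> \<mu> P\<close>.\<close>

lemma ping_pong:
  assumes P: "P \<subseteq> D" and d: "d1 ` (P \<inter> central_box) \<union> d2 ` (P \<inter> central_box) \<subseteq> P"
    and disj: "d1 ` (P \<inter> central_box) \<inter> d2 ` (P \<inter> central_box) = {}"
    and shears: "{d1, d2} \<subseteq> {\<lambda>(a, b, c). (a, b + a, c), \<lambda>(a, b, c). (a, b - a, c),
      \<lambda>(a, b, c). (a + b, b, c), \<lambda>(a, b, c). (a - b, b, c), \<lambda>(a, b, c). (a + c, b, c)}"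
  shows "\<mu> P \<le> 8 * \<delta>"
proof -
  have fin: "finite P" using P finite_subset finite_dual_cube by blast
  have "\<mu> (P \<inter> central_box) \<le> \<mu> (d1 ` (P \<inter> central_box)) + 3 * \<delta>"
    by (rule mass_shears) (use P d shears in auto)
  moreover have "\<mu> (P \<inter> central_box) \<le> \<mu> (d2 ` (P \<inter> central_box)) + 3 * \<delta>"
    by (rule mass_shears) (use P d shears in auto)
  moreover have "\<mu> (d1 ` (P \<inter> central_box)) + \<mu> (d2 ` (P \<inter> central_box)) \<le> \<mu> P"
    using mass_mono[OF d fin, of "2 * h" E] mass_Un[OF _ _ disj, of "2 * h" E] fin by simp
  ultimately show ?thesis using mass_central_box[OF P] by simp
qed

text \<open>Every nonzero frequency lies in one of four open quadrants of the
  \<open>(a, b)\<close>-plane, on one of its two axes, or on the \<open>c\<close>-axis. The bounds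
  add up to 95 = 4 * 8 + 20 + 20 + 23, and the rest of the total mass \<rho> is the mass
  \<open>\<rho>\<^sup>2\<close> at 0.\<close>

lemma density_dichotomy:
  defines "\<rho> \<equiv> card E / real_of_int (2 * h) ^ 3"
  shows "\<rho> * (1 - \<rho>) \<le> 95 * \<delta>"
proof -
  define Q where "Q s t = {\<xi> \<in> D. case \<xi> of (a, b, c) \<Rightarrow> 0 < s * a \<and> 0 < t * b}" for s t :: int
  \<comment> \<open>When \<open>a\<close> and \<open>b\<close> have equal sign, the two additive
    shears keep the quadrant, and their images are told apart by which coordinate is larger in
    absolute value. For opposite signs the subtracting shears do the same.\<close>
  have Q: "\<mu> (Q s t) \<le> 8 * \<delta>" if "(s, t) \<in> {(1, 1), (-1, -1)}" for s t
    by (rule ping_pong[of _ "\<lambda>(a, b, c). (a, b + a, c)" "\<lambda>(a, b, c). (a + b, b, c)"])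
      (use that h in \<open>auto simp: Q_def central_box_def dual_cube_def\<close>)
  have Q': "\<mu> (Q s t) \<le> 8 * \<delta>" if "(s, t) \<in> {(1, -1), (-1, 1)}" for s t
    by (rule ping_pong[of _ "\<lambda>(a, b, c). (a, b - a, c)" "\<lambda>(a, b, c). (a - b, b, c)"])
      (use that h in \<open>auto simp: Q_def central_box_def dual_cube_def\<close>)
  have finQ: "finite (Q s t)" for s t by (simp add: Q_def)
  define A where "A = {\<xi> \<in> D. case \<xi> of (a, b, c) \<Rightarrow> a \<noteq> 0 \<and> b = 0}"
  define B where "B = {\<xi> \<in> D. case \<xi> of (a, b, c) \<Rightarrow> a = 0 \<and> b \<noteq> 0}"
  define Z where "Z = {\<xi> \<in> D. case \<xi> of (a, b, c) \<Rightarrow> a = 0 \<and> b = 0 \<and> c \<noteq> 0}"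
  have fin: "finite A" "finite B" "finite Z" by (simp_all add: A_def B_def Z_def)
  have diag: "\<mu> S \<le> 16 * \<delta>" if "S \<subseteq> Q 1 1 \<union> Q (-1) (-1)" for S
    using mass_le_Un[OF that finQ finQ, of "2 * h" E] Q[of 1 1] Q[of "-1" "-1"] by simp
  \<comment> \<open>A shear moves this axis onto a diagonal, which lies in two quadrants that are
    already bounded; 20 = 16 + 3 + 1.\<close>
  have "\<mu> (A \<inter> central_box) \<le> \<mu> ((\<lambda>(a, b, c). (a, b + a, c)) ` (A \<inter> central_box)) + 3 * \<delta>"
    by (rule mass_shears) (auto simp: A_def central_box_def dual_cube_def)
  moreover have "\<mu> ((\<lambda>(a, b, c). (a, b + a, c)) ` (A \<inter> central_box)) \<le> 16 * \<delta>"
    by (rule diag) (auto simp: A_def Q_def central_box_def dual_cube_def)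
  ultimately have A: "\<mu> A \<le> 20 * \<delta>" using mass_central_box[of A] by (simp add: A_def)
  have "\<mu> (B \<inter> central_box) \<le> \<mu> ((\<lambda>(a, b, c). (a + b, b, c)) ` (B \<inter> central_box)) + 3 * \<delta>"
    by (rule mass_shears) (auto simp: B_def central_box_def dual_cube_def)
  moreover have "\<mu> ((\<lambda>(a, b, c). (a + b, b, c)) ` (B \<inter> central_box)) \<le> 16 * \<delta>"
    by (rule diag) (auto simp: B_def Q_def central_box_def dual_cube_def)
  ultimately have B: "\<mu> B \<le> 20 * \<delta>" using mass_central_box[of B] by (simp add: B_def)
  \<comment> \<open>The \<open>c\<close>-axis is sheared into \<open>A\<close> as a whole: the new
    first coordinate is \<open>c\<close>, which already lies in the right range, so the box is
    bypassed and 23 = 20 + 3.\<close>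
  have "\<mu> Z \<le> \<mu> ((\<lambda>(a, b, c). (a + c, b, c)) ` Z) + 3 * \<delta>"
    by (rule mass_shears) (auto simp: Z_def dual_cube_def)
  moreover have "\<mu> ((\<lambda>(a, b, c). (a + c, b, c)) ` Z) \<le> \<mu> A"
    by (rule mass_mono[OF _ fin(1)]) (auto simp: Z_def A_def dual_cube_def)
  ultimately have Z: "\<mu> Z \<le> 23 * \<delta>" using A by simp
  have "D \<subseteq> {(0, 0, 0)} \<union> (Z \<union> (A \<union> (B \<union> ((Q 1 1 \<union> Q (-1) (-1)) \<union> (Q 1 (-1) \<union> Q (-1) 1)))))"
    by (auto simp: A_def B_def Z_def Q_def)
  then have "\<mu> D \<le> \<mu> {(0, 0, 0)} + \<mu> (Z \<union> (A \<union> (B \<union> ((Q 1 1 \<union> Q (-1) (-1)) \<union> (Q 1 (-1) \<union> Q (-1) 1)))))"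
    by (rule mass_le_Un) (simp_all add: fin finQ)
  also have "\<dots> \<le> \<mu> {(0, 0, 0)} + (\<mu> Z + (\<mu> A + (\<mu> B + ((\<mu> (Q 1 1) + \<mu> (Q (-1) (-1))) + (\<mu> (Q 1 (-1)) + \<mu> (Q (-1) 1))))))"
    by (intro add_mono order_refl order_trans[OF mass_Un_le]) (simp_all add: fin finQ)
  also have "\<dots> \<le> \<mu> {(0, 0, 0)} + 95 * \<delta>"
    using A B Z Q[of 1 1] Q[of "-1" "-1"] Q'[of 1 "-1"] Q'[of "-1" 1] by simp
  finally have "\<rho> \<le> \<rho>\<^sup>2 + 95 * \<delta>"
    unfolding mass_dual_cube[OF h E] mass_zero[OF E] \<rho>_def .
  then show ?thesis by (simp add: power2_eq_square algebra_simps)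
qed

end

section \<open>A finite obstruction\<close>

fun half_trans :: "int \<Rightarrow> point \<Rightarrow> point" where
  "half_trans n (x, y, z) = (if 2 * z < n then (x, y, z) else ((x + 1) mod n, y, z))"

fun drift :: "int \<Rightarrow> int \<Rightarrow> point \<Rightarrow> point" where
  "drift n s (x, y, z) = (x, y, (z + s) mod n)"

text \<open>The order is used: the indices below 5 are the moves that commute with every drift,
  index 5 is the exceptional one.\<close>

definition moves :: "int \<Rightarrow> (point \<Rightarrow> point) list" where
  "moves n = [trans1 n, trans2 n, shear1 n, shear2 n, shear3 n, half_trans n]"

lemma length_moves [simp]: "length (moves n) = 6"
  by (simp add: moves_def)

lemma bij_betw_half_trans: "n > 0 \<Longrightarrow> bij_betw (half_trans n) (cube n) (cube n)"
  by (rule bij_betw_cubeI) (auto simp: cube_def inj_on_def add_mod_cancel split: if_splits)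

lemma bij_betw_drift: "n > 0 \<Longrightarrow> bij_betw (drift n s) (cube n) (cube n)"
  by (rule bij_betw_cubeI) (auto simp: cube_def inj_on_def add_mod_cancel)

lemma set_moves: "set (moves n) = {trans1 n, trans2 n, shear1 n, shear2 n, shear3 n, half_trans n}"
  by (simp add: moves_def)

lemma bij_betw_move: "n > 0 \<Longrightarrow> i < 6 \<Longrightarrow> bij_betw (moves n ! i) (cube n) (cube n)"
  using bij_betw_moves[of n] bij_betw_half_trans[of n] nth_mem[of i "moves n"] by (auto simp: set_moves)

lemma nth_moves_less_5: "i < 5 \<Longrightarrow> moves n ! i \<in> {trans1 n, trans2 n, shear1 n, shear2 n, shear3 n}"
  by (auto simp: moves_def less_Suc_eq numeral_nat)

lemma moves_drift:
  assumes "p \<in> {trans1 n, trans2 n, shear1 n, shear2 n, shear3 n}"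
  shows "p (drift n s v) = drift n s (p v)"
  using assms by (cases v) (auto simp: mod_simps add_ac)

text \<open>A drift by half the modulus exchanges the two halves, so exactly one of the two orders
  of composition translates \<open>x\<close>.\<close>

lemma half_trans_drift:
  assumes "n = 2 * h" "h > 0" "v \<in> cube n"
  shows "half_trans n (drift n h v) \<noteq> drift n h (half_trans n v)"
proof -
  obtain x y z where v: "v = (x, y, z)" by (cases v)
  have b: "0 \<le> x" "x < n" "0 \<le> z" "z < n" using assms by (auto simp: v cube_def)
  have z: "(z + h) mod n = (if z < h then z + h else z - h)"
    using b assms mod_add_self2[of "z - h" n] by (auto simp: algebra_simps)
  have "(x + 1) mod n \<noteq> x"
  proof (cases "x + 1 < n")
    case False
    then have "x + 1 = n" using b by simp
    then show ?thesis using assms by (simp; presburger)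
  qed (use b in simp)
  then show ?thesis using b assms(2) by (auto simp: v z[unfolded assms(1)] assms(1))
qed

text \<open>Here \<delta> is 1/1000, whence 2000000 = 2 * 1000 * 1000. The resulting bound 95/1000
  lies below 7/64 = 1/8 * 7/8, the value of \<open>\<rho> * (1 - \<rho>)\<close> at the ends of the
  excluded interval.\<close>

lemma almost_invariant_dichotomy:
  assumes "h > 0" "E \<subseteq> cube (2 * h)"
    and "\<And>p. p \<in> {trans1 (2 * h), trans2 (2 * h), shear1 (2 * h), shear2 (2 * h), shear3 (2 * h)}
      \<Longrightarrow> real (card {x \<in> E. p x \<notin> E}) \<le> real_of_int (2 * h) ^ 3 / 2000000"
  shows "real (card E) < real_of_int (2 * h) ^ 3 / 8 \<or> real (card E) > 7 / 8 * real_of_int (2 * h) ^ 3"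
proof -
  interpret almost_invariant_set h E "1 / 1000"
  proof
    fix p assume "p \<in> {trans1 (2 * h), trans2 (2 * h), shear1 (2 * h), shear2 (2 * h), shear3 (2 * h)}"
    from assms(3)[OF this]
    show "2 * real (card {x \<in> E. p x \<notin> E}) \<le> (1 / 1000)\<^sup>2 * real_of_int (2 * h) ^ 3"
      by (simp add: power2_eq_square)
  qed (use assms(1,2) in simp_all)
  define \<rho> where "\<rho> = card E / real_of_int (2 * h) ^ 3"
  have "\<rho> * (1 - \<rho>) \<le> 95 / 1000" using density_dichotomy by (simp add: \<rho>_def)
  have "\<rho> < 1 / 8 \<or> \<rho> > 7 / 8"
  proof (rule ccontr)
    assume "\<not> ?thesis"
    then have "0 \<le> (\<rho> - 1 / 8) * (7 / 8 - \<rho>)" by simp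
    moreover have "(\<rho> - 1 / 8) * (7 / 8 - \<rho>) = \<rho> * (1 - \<rho>) - 7 / 64" by (simp add: field_simps)
    ultimately show False using \<open>\<rho> * (1 - \<rho>) \<le> 95 / 1000\<close> by linarith
  qed
  then show ?thesis using assms(1) by (simp add: \<rho>_def field_simps)
qed

lemma card_Collect_bij_betw:
  assumes "bij_betw p A B"
  shows "card {x \<in> A. P (p x)} = card {y \<in> B. P y}"
proof -
  have "bij_betw p {x \<in> A. P (p x)} {y \<in> B. P y}"
    by (rule bij_betw_subset[OF assms]) (use assms in \<open>auto simp: bij_betw_def\<close>)
  then show ?thesis by (rule bij_betw_same_card)
qed

text \<open>The sets \<open>E j\<close> where \<open>t ^^ j\<close> agrees with the drift are almost invariant under the first five
  moves with an error independent of \<open>j\<close>, so by the dichotomy they never become small. For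
  \<open>j = M\<close> this contradicts that \<open>half_trans\<close> does not commute with a drift by \<open>M\<^sup>2\<close>.\<close>

lemma no_commuting_approximation:
  fixes M :: int and \<beta> :: "point \<Rightarrow> 'c"
  defines "n \<equiv> 2 * M\<^sup>2"
  assumes M: "M > 0" and inj: "inj_on \<beta> (cube n)"
    and comm: "\<And>i k. i < 6 \<Longrightarrow> \<sigma> i (t k) = t (\<sigma> i k)"
    and \<sigma>: "\<And>i. i < 6 \<Longrightarrow> real (card {v \<in> cube n. \<sigma> i (\<beta> v) \<noteq> \<beta> ((moves n ! i) v)}) \<le> real_of_int n ^ 3 / 10000000"
    and t: "real (card {v \<in> cube n. t (\<beta> v) \<noteq> \<beta> (drift n M v)}) \<le> real_of_int n ^ 3 / 10000000"
  shows False
proof -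
  let ?C = "cube n" and ?N = "real_of_int n ^ 3"
  have n: "n > 0" using M by (simp add: n_def)
  then have N: "?N > 0" by simp
  let ?T = "\<lambda>j. drift n (int j * M)"
  have Tb: "bij_betw (?T j) ?C ?C" for j using bij_betw_drift[OF n] .
  have TC: "?T j v \<in> ?C" if "v \<in> ?C" for j v using Tb[of j] that bij_betwE by blast
  have TSuc: "drift n M (?T j v) = ?T (Suc j) v" if "v \<in> ?C" for j v
    by (cases v) (simp add: mod_simps algebra_simps)
  have pC: "(moves n ! i) v \<in> ?C" if "i < 6" "v \<in> ?C" for i v
    using bij_betw_move[OF n that(1)] that(2) bij_betwE by blast
  define bad where "bad i = {v \<in> ?C. \<sigma> i (\<beta> v) \<noteq> \<beta> ((moves n ! i) v)}" for i
  define badt where "badt = {v \<in> ?C. t (\<beta> v) \<noteq> \<beta> (drift n M v)}"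
  have fin: "finite (bad i)" "finite badt" for i by (simp_all add: bad_def badt_def)
  have bad_T: "card {v \<in> ?C. ?T j v \<in> bad i} = card (bad i)" for i j
    using card_Collect_bij_betw[OF Tb, of "\<lambda>v. v \<in> bad i" j] by (simp add: bad_def)
  have badt_T: "card {v \<in> ?C. ?T j v \<in> badt} = card badt" for j
    using card_Collect_bij_betw[OF Tb, of "\<lambda>v. v \<in> badt" j] by (simp add: badt_def)
  have \<sigma>t: "\<sigma> i ((t ^^ j) k) = (t ^^ j) (\<sigma> i k)" if "i < 6" for i j k
    by (induction j) (simp_all add: comm[OF that])
  define E where "E j = {v \<in> ?C. (t ^^ j) (\<beta> v) = \<beta> (?T j v)}" for j
  have EC: "E j \<subseteq> ?C" and finE: "finite (E j)" for j by (auto simp: E_def)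
  have step: "card {x \<in> E j. p x \<notin> E j} \<le> ?N / 2000000"
    if p: "p \<in> {trans1 n, trans2 n, shear1 n, shear2 n, shear3 n}" for p j
  proof -
    obtain i where i: "i < 5" "p = moves n ! i"
    proof -
      have "p \<in> set (take 5 (moves n))" using p by (auto simp: moves_def)
      then show ?thesis using that by (auto simp: in_set_conv_nth)
    qed
    \<comment> \<open>A point leaves \<open>E j\<close> only if \<open>\<sigma> i\<close> errs at it
      or at its drifted image. Drifting is a bijection, so the second set is as large as
      \<open>bad i\<close>; this makes the bound independent of \<open>j\<close>.\<close>
    have "{x \<in> E j. p x \<notin> E j} \<subseteq> bad i \<union> {v \<in> ?C. ?T j v \<in> bad i}"
    proof
      fix v assume v: "v \<in> {x \<in> E j. p x \<notin> E j}"
      show "v \<in> bad i \<union> {v \<in> ?C. ?T j v \<in> bad i}"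
      proof (rule ccontr)
        assume nb: "\<not> ?thesis"
        have vC: "v \<in> ?C" and vE: "(t ^^ j) (\<beta> v) = \<beta> (?T j v)" using v by (auto simp: E_def)
        have b: "\<sigma> i (\<beta> v) = \<beta> (p v)" "\<sigma> i (\<beta> (?T j v)) = \<beta> (p (?T j v))"
          using nb vC TC[OF vC] i by (auto simp: bad_def)
        have "(t ^^ j) (\<beta> (p v)) = \<sigma> i ((t ^^ j) (\<beta> v))" using \<sigma>t i b by simp
        also have "\<dots> = \<beta> (p (?T j v))" using vE b by simp
        also have "\<dots> = \<beta> (?T j (p v))" using moves_drift[OF p] by simp
        finally have "p v \<in> E j" using pC[of i v] vC i by (simp add: E_def)
        then show False using v by simp
      qed
    qed
    then have "card {x \<in> E j. p x \<notin> E j} \<le> card (bad i \<union> {v \<in> ?C. ?T j v \<in> bad i})"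
      by (intro card_mono) (auto simp: fin)
    also have "\<dots> \<le> card (bad i) + card {v \<in> ?C. ?T j v \<in> bad i}" by (rule card_Un_le)
    also have "\<dots> = card (bad i) + card (bad i)" by (simp only: bad_T)
    finally have "real (card {x \<in> E j. p x \<notin> E j}) \<le> 2 * real (card (bad i))" by simp
    also have "\<dots> \<le> ?N / 2000000" using \<sigma>[of i] i N unfolding bad_def by simp
    finally show ?thesis .
  qed
  \<comment> \<open>Passing to \<open>Suc j\<close> loses at most \<open>card badt\<close> points,
    which leaves far more than 1/8; the dichotomy then restores 7/8 for the next step.\<close>
  have big: "real (card (E j)) > 7 / 8 * ?N" for j
  proof (induction j)
    case 0
    have "E 0 = ?C" by (auto simp: E_def cube_def)
    then show ?case using card_cube[of n] n by (simp add: of_nat_nat)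
  next
    case (Suc j)
    have "E j \<subseteq> E (Suc j) \<union> {v \<in> ?C. ?T j v \<in> badt}"
      using TC TSuc by (auto simp: E_def badt_def)
    then have "card (E j) \<le> card (E (Suc j) \<union> {v \<in> ?C. ?T j v \<in> badt})"
      by (intro card_mono) (auto simp: finE)
    also have "\<dots> \<le> card (E (Suc j)) + card badt"
      using card_Un_le[of "E (Suc j)" "{v \<in> ?C. ?T j v \<in> badt}"] unfolding badt_T .
    finally have "real (card (E j)) \<le> real (card (E (Suc j))) + real (card badt)" by linarith
    then have "real (card (E (Suc j))) > ?N / 8" using Suc.IH t N unfolding badt_def by linarith
    moreover have "real (card (E (Suc j))) < ?N / 8 \<or> real (card (E (Suc j))) > 7 / 8 * ?N"
      unfolding n_def
      by (rule almost_invariant_dichotomy) (use M EC step in \<open>auto simp: n_def\<close>)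
    ultimately show ?case by simp
  qed
  \<comment> \<open>After \<open>M\<close> steps of length \<open>M\<close> the drift is
    \<open>M\<^sup>2\<close>, which is half of \<open>n\<close>.\<close>
  define J where "J = nat M"
  have J: "int J * M = M\<^sup>2" using M by (simp add: J_def power2_eq_square)
  let ?c = "half_trans n"
  have c: "moves n ! 5 = ?c" by (simp add: moves_def)
  have cb: "bij_betw ?c ?C ?C" by (rule bij_betw_half_trans[OF n])
  have cC: "?c v \<in> ?C" if "v \<in> ?C" for v using cb that bij_betwE by blast
  \<comment> \<open>At a point outside all these sets \<open>half_trans\<close> would commute with
    the drift by half the modulus, which happens nowhere. Yet the sets together have fewer than
    \<open>2 / 8 + 2 / 10000000\<close> times the number of points of the cube.\<close>
  have "?C \<subseteq> (?C - E J) \<union> {v \<in> ?C. ?c v \<notin> E J} \<union> (bad 5 \<union> {v \<in> ?C. ?T J v \<in> bad 5})"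
  proof
    fix v assume v: "v \<in> ?C"
    show "v \<in> (?C - E J) \<union> {v \<in> ?C. ?c v \<notin> E J} \<union> (bad 5 \<union> {v \<in> ?C. ?T J v \<in> bad 5})"
    proof (rule ccontr)
      assume nb: "\<not> ?thesis"
      then have e: "(t ^^ J) (\<beta> v) = \<beta> (?T J v)" "(t ^^ J) (\<beta> (?c v)) = \<beta> (?T J (?c v))"
        and b: "\<sigma> 5 (\<beta> v) = \<beta> (?c v)" "\<sigma> 5 (\<beta> (?T J v)) = \<beta> (?c (?T J v))"
        using v cC[OF v] TC[OF v] by (auto simp: E_def bad_def c)
      have "\<beta> (?c (?T J v)) = \<sigma> 5 ((t ^^ J) (\<beta> v))" using e b by simp
      also have "\<dots> = (t ^^ J) (\<sigma> 5 (\<beta> v))" by (rule \<sigma>t) simp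
      also have "\<dots> = \<beta> (?T J (?c v))" using e b by simp
      finally have "?c (?T J v) = ?T J (?c v)"
        using inj_onD[OF inj] cC TC v by blast
      then show False using half_trans_drift[of n "M\<^sup>2" v] M v unfolding J by (simp add: n_def)
    qed
  qed
  then have "card ?C \<le> card ((?C - E J) \<union> {v \<in> ?C. ?c v \<notin> E J} \<union> (bad 5 \<union> {v \<in> ?C. ?T J v \<in> bad 5}))"
    by (intro card_mono) (auto simp: fin)
  also have "\<dots> \<le> (card (?C - E J) + card {v \<in> ?C. ?c v \<notin> E J}) + (card (bad 5) + card {v \<in> ?C. ?T J v \<in> bad 5})"
    by (intro order_trans[OF card_Un_le] add_mono card_Un_le)
  also have "card {v \<in> ?C. ?c v \<notin> E J} = card (?C - E J)"
    using card_Collect_bij_betw[OF cb, of "\<lambda>v. v \<notin> E J"] by (simp add: set_diff_eq)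
  also have "card {v \<in> ?C. ?T J v \<in> bad 5} = card (bad 5)" by (rule bad_T)
  finally have "real (card ?C) \<le> 2 * real (card (?C - E J)) + 2 * real (card (bad 5))" by linarith
  moreover have "real (card (?C - E J)) = real (card ?C) - real (card (E J))"
    using card_Diff_subset[OF finE EC] card_mono[OF finite_cube EC] by (simp add: of_nat_diff)
  moreover have "real (card ?C) = ?N" using card_cube[of n] n by (simp add: of_nat_nat)
  ultimately show False using big[of J] \<sigma>[of 5] N unfolding bad_def by simp
qed

section \<open>Asymptotic actions and induction from subgroups of finite index\<close>

definition vanishing :: "(nat \<Rightarrow> 'c set) \<Rightarrow> (nat \<Rightarrow> 'c \<Rightarrow> bool) \<Rightarrow> bool" where
  "vanishing \<Omega> P \<longleftrightarrow> (\<lambda>l. real (card {x \<in> \<Omega> l. P l x}) / real (card (\<Omega> l))) \<longlonglongrightarrow> 0"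

lemma vanishing_le:
  assumes "eventually (\<lambda>l. real (card {x \<in> \<Omega> l. P l x}) / real (card (\<Omega> l)) \<le> b l) sequentially"
    and "b \<longlonglongrightarrow> 0"
  shows "vanishing \<Omega> P"
  unfolding vanishing_def
  by (rule tendsto_sandwich[OF _ assms(1) tendsto_const assms(2)]) simp

lemma vanishing_mono:
  assumes "vanishing \<Omega> Q" "\<And>l. finite (\<Omega> l)"
    and "eventually (\<lambda>l. \<forall>x\<in>\<Omega> l. P l x \<longrightarrow> Q l x) sequentially"
  shows "vanishing \<Omega> P"
proof (rule vanishing_le)
  show "eventually (\<lambda>l. real (card {x \<in> \<Omega> l. P l x}) / real (card (\<Omega> l))
      \<le> real (card {x \<in> \<Omega> l. Q l x}) / real (card (\<Omega> l))) sequentially"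
    using assms(3)
  proof eventually_elim
    case (elim l)
    then have "card {x \<in> \<Omega> l. P l x} \<le> card {x \<in> \<Omega> l. Q l x}"
      using assms(2) by (intro card_mono) auto
    then show ?case by (simp add: divide_right_mono)
  qed
qed (use assms(1) in \<open>simp add: vanishing_def\<close>)

lemma vanishing_disj:
  assumes "vanishing \<Omega> P" "vanishing \<Omega> Q"
  shows "vanishing \<Omega> (\<lambda>l x. P l x \<or> Q l x)"
proof (rule vanishing_le)
  show "(\<lambda>l. real (card {x \<in> \<Omega> l. P l x}) / real (card (\<Omega> l))
      + real (card {x \<in> \<Omega> l. Q l x}) / real (card (\<Omega> l))) \<longlonglongrightarrow> 0"
    using tendsto_add[OF assms[unfolded vanishing_def]] by simp
  have "{x \<in> \<Omega> l. P l x \<or> Q l x} = {x \<in> \<Omega> l. P l x} \<union> {x \<in> \<Omega> l. Q l x}" for l by auto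
  then have "card {x \<in> \<Omega> l. P l x \<or> Q l x} \<le> card {x \<in> \<Omega> l. P l x} + card {x \<in> \<Omega> l. Q l x}" for l
    by (simp only: card_Un_le)
  then have "real (card {x \<in> \<Omega> l. P l x \<or> Q l x}) / real (card (\<Omega> l))
      \<le> real (card {x \<in> \<Omega> l. P l x} + card {x \<in> \<Omega> l. Q l x}) / real (card (\<Omega> l))" for l
    by (intro divide_right_mono of_nat_mono) auto
  then show "eventually (\<lambda>l. real (card {x \<in> \<Omega> l. P l x \<or> Q l x}) / real (card (\<Omega> l))
      \<le> real (card {x \<in> \<Omega> l. P l x}) / real (card (\<Omega> l))
        + real (card {x \<in> \<Omega> l. Q l x}) / real (card (\<Omega> l))) sequentially"
    by (intro always_eventually allI) (simp only: of_nat_add add_divide_distrib)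
qed

lemma vanishing_False: "vanishing \<Omega> (\<lambda>l x. False)"
  by (simp add: vanishing_def)

lemma vanishing_Bex:
  assumes "finite I" "\<And>i. i \<in> I \<Longrightarrow> vanishing \<Omega> (P i)"
  shows "vanishing \<Omega> (\<lambda>l x. \<exists>i\<in>I. P i l x)"
  using assms
proof (induction I rule: finite_induct)
  case (insert i I)
  have "vanishing \<Omega> (\<lambda>l x. P i l x \<or> (\<exists>i\<in>I. P i l x))"
    by (intro vanishing_disj insert.IH insert.prems) auto
  then show ?case by simp
qed (simp add: vanishing_False)

lemma vanishing_bij:
  assumes "vanishing \<Omega> P" "\<And>l. bij_betw (p l) (\<Omega> l) (\<Omega> l)"
  shows "vanishing \<Omega> (\<lambda>l x. P l (p l x))"
  using assms(1) unfolding vanishing_def by (simp add: card_Collect_bij_betw[OF assms(2)])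

text \<open>Both laws are images of one uniform point of \<open>A\<close>: points with
  \<open>u x = v x\<close> cancel, and any other point adds at most \<open>2 / card A\<close> to the
  sum before it is halved.\<close>

lemma tv_dist_coupling:
  assumes A: "finite A" "A \<noteq> {}" and S: "finite S"
  shows "tv_dist S (map_pmf u (pmf_of_set A)) (map_pmf v (pmf_of_set A))
    \<le> real (card {x \<in> A. u x \<noteq> v x}) / real (card A)"
proof -
  let ?B = "{x \<in> A. u x \<noteq> v x}"
  have pmf: "pmf (map_pmf w (pmf_of_set A)) \<omega> = real (card {x \<in> A. w x = \<omega>}) / real (card A)"
    for w :: "'a \<Rightarrow> 'b" and \<omega>
    using A by (simp add: pmf_map measure_pmf_of_set vimage_def Int_def)
  have split: "card {x \<in> A. w x = \<omega>} = card {x \<in> ?B. w x = \<omega>} + card {x \<in> A - ?B. w x = \<omega>}"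
    for w :: "'a \<Rightarrow> 'b" and \<omega>
  proof -
    have "{x \<in> A. w x = \<omega>} = {x \<in> ?B. w x = \<omega>} \<union> {x \<in> A - ?B. w x = \<omega>}" by auto
    also have "card \<dots> = card {x \<in> ?B. w x = \<omega>} + card {x \<in> A - ?B. w x = \<omega>}"
      using A by (intro card_Un_disjoint) auto
    finally show ?thesis .
  qed
  have same: "{x \<in> A - ?B. u x = \<omega>} = {x \<in> A - ?B. v x = \<omega>}" for \<omega> by auto
  have le: "(\<Sum>\<omega>\<in>S. real (card {x \<in> ?B. w x = \<omega>})) \<le> real (card ?B)" for w :: "'a \<Rightarrow> 'b"
  proof -
    have "(\<Sum>\<omega>\<in>S. real (card {x \<in> ?B. w x = \<omega>})) = real (card (\<Union>\<omega>\<in>S. {x \<in> ?B. w x = \<omega>}))"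
      using A S by (subst card_UN_disjoint) auto
    also have "\<dots> \<le> real (card ?B)" using A by (intro of_nat_mono card_mono) auto
    finally show ?thesis .
  qed
  have "\<bar>pmf (map_pmf u (pmf_of_set A)) \<omega> - pmf (map_pmf v (pmf_of_set A)) \<omega>\<bar>
      \<le> (real (card {x \<in> ?B. u x = \<omega>}) + real (card {x \<in> ?B. v x = \<omega>})) / real (card A)" for \<omega>
    unfolding pmf split[of u \<omega>] split[of v \<omega>] same diff_divide_distrib[symmetric] abs_divide
    by (simp add: divide_right_mono)
  then have "(\<Sum>\<omega>\<in>S. \<bar>pmf (map_pmf u (pmf_of_set A)) \<omega> - pmf (map_pmf v (pmf_of_set A)) \<omega>\<bar>)
      \<le> (\<Sum>\<omega>\<in>S. (real (card {x \<in> ?B. u x = \<omega>}) + real (card {x \<in> ?B. v x = \<omega>})) / real (card A))"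
    by (rule sum_mono)
  also have "\<dots> = ((\<Sum>\<omega>\<in>S. real (card {x \<in> ?B. u x = \<omega>})) + (\<Sum>\<omega>\<in>S. real (card {x \<in> ?B. v x = \<omega>}))) / real (card A)"
    by (simp only: sum_divide_distrib[symmetric] sum.distrib)
  also have "\<dots> \<le> (real (card ?B) + real (card ?B)) / real (card A)"
    by (intro divide_right_mono add_mono le) simp
  also have "\<dots> = 2 * (real (card ?B) / real (card A))" by simp
  finally show ?thesis unfolding tv_dist_def by linarith
qed

text \<open>The hypotheses of rigidity for an asymptotic action \<open>f\<close> and an honest
  action \<open>g\<close> on arbitrary finite sets. Fixed points are compared for one group element
  at a time; finite sets of elements follow by a union bound.\<close>

definition same_stabilizers ::
  "('a, 'b) monoid_scheme \<Rightarrow> (nat \<Rightarrow> 'c set) \<Rightarrow> (nat \<Rightarrow> 'a \<Rightarrow> 'c \<Rightarrow> 'c) \<Rightarrow> (nat \<Rightarrow> 'a \<Rightarrow> 'c \<Rightarrow> 'c) \<Rightarrow> bool"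
where
  "same_stabilizers G \<Omega> f g \<longleftrightarrow>
     (\<forall>l. finite (\<Omega> l) \<and> \<Omega> l \<noteq> {}) \<and> filterlim (\<lambda>l. card (\<Omega> l)) at_top sequentially \<and>
     (\<forall>l. \<forall>\<gamma>\<in>carrier G. bij_betw (f l \<gamma>) (\<Omega> l) (\<Omega> l) \<and> bij_betw (g l \<gamma>) (\<Omega> l) (\<Omega> l)) \<and>
     (\<forall>\<gamma>\<^sub>1\<in>carrier G. \<forall>\<gamma>\<^sub>2\<in>carrier G.
        vanishing \<Omega> (\<lambda>l x. f l (\<gamma>\<^sub>1 \<otimes>\<^bsub>G\<^esub> \<gamma>\<^sub>2) x \<noteq> f l \<gamma>\<^sub>1 (f l \<gamma>\<^sub>2 x)) \<and>
        (\<forall>l. \<forall>x\<in>\<Omega> l. g l (\<gamma>\<^sub>1 \<otimes>\<^bsub>G\<^esub> \<gamma>\<^sub>2) x = g l \<gamma>\<^sub>1 (g l \<gamma>\<^sub>2 x))) \<and>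
     (\<forall>\<gamma>\<in>carrier G. vanishing \<Omega> (\<lambda>l x. (f l \<gamma> x = x) \<noteq> (g l \<gamma> x = x)))"

text \<open>The conclusion of rigidity with the target degree forgotten: \<beta> places the model
  inside the larger set, and of the honest action only multiplicativity is retained.\<close>

definition approximable ::
  "('a, 'b) monoid_scheme \<Rightarrow> (nat \<Rightarrow> 'c set) \<Rightarrow> (nat \<Rightarrow> 'a \<Rightarrow> 'c \<Rightarrow> 'c) \<Rightarrow> bool"
where
  "approximable G \<Omega> f \<longleftrightarrow> (\<exists>(h :: nat \<Rightarrow> 'a \<Rightarrow> nat \<Rightarrow> nat) \<beta>.
     (\<forall>l. inj_on (\<beta> l) (\<Omega> l)) \<and>
     (\<forall>l. \<forall>\<gamma>\<^sub>1\<in>carrier G. \<forall>\<gamma>\<^sub>2\<in>carrier G. h l (\<gamma>\<^sub>1 \<otimes>\<^bsub>G\<^esub> \<gamma>\<^sub>2) = h l \<gamma>\<^sub>1 \<circ> h l \<gamma>\<^sub>2) \<and>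
     (\<forall>\<gamma>\<in>carrier G. vanishing \<Omega> (\<lambda>l x. h l \<gamma> (\<beta> l x) \<noteq> \<beta> l (f l \<gamma> x))))"

lemma rigid_imp_approximable:
  assumes G: "group G" and rigid: "UB_flexibly_BS_rigid G" and ss: "same_stabilizers G \<Omega> f g"
  shows "approximable G \<Omega> f"
proof -
  interpret group G by (rule G)
  define n where "n l = card (\<Omega> l)" for l
  have fin: "finite (\<Omega> l)" "\<Omega> l \<noteq> {}" and n0: "0 < n l" for l
    using ss by (auto simp: same_stabilizers_def n_def card_gt_0_iff)
  have "\<forall>l. \<exists>a. bij_betw a {1..n l} (\<Omega> l)"
    using ex_bij_betw_nat_finite_1[OF fin(1)] by (auto simp: n_def)
  then obtain \<alpha> where \<alpha>: "bij_betw (\<alpha> l) {1..n l} (\<Omega> l)" for l by metis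
  define \<beta> where "\<beta> l = inv_into {1..n l} (\<alpha> l)" for l
  have \<beta>: "bij_betw (\<beta> l) (\<Omega> l) {1..n l}" for l
    unfolding \<beta>_def by (rule bij_betw_inv_into[OF \<alpha>])
  have inj\<beta>: "inj_on (\<beta> l) (\<Omega> l)" for l using \<beta> bij_betw_def by blast
  have \<beta>\<alpha>: "\<beta> l (\<alpha> l k) = k" if "k \<in> {1..n l}" for l k
    using bij_betw_inv_into_left[OF \<alpha> that] by (simp add: \<beta>_def)
  have \<alpha>\<beta>: "\<alpha> l (\<beta> l x) = x" if "x \<in> \<Omega> l" for l x
    using bij_betw_inv_into_right[OF \<alpha> that] by (simp add: \<beta>_def)
  have \<alpha>in: "\<alpha> l k \<in> \<Omega> l" if "k \<in> {1..n l}" for l k using bij_betwE[OF \<alpha>] that by blast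
  have \<beta>in: "\<beta> l x \<in> {1..n l}" if "x \<in> \<Omega> l" for l x using bij_betwE[OF \<beta>] that by blast
  \<comment> \<open>Transport to the standard interval, extended by the identity so that it becomes
    an element of \<open>sym_group\<close>.\<close>
  define enc where "enc l u k = (if k \<in> {1..n l} then \<beta> l (u (\<alpha> l k)) else k)" for l and u :: "'c \<Rightarrow> 'c" and k
  have enc: "enc l u permutes {1..n l}" if "bij_betw u (\<Omega> l) (\<Omega> l)" for l u
  proof (rule bij_imp_permutes)
    have "bij_betw (\<beta> l \<circ> (u \<circ> \<alpha> l)) {1..n l} {1..n l}"
      by (rule bij_betw_trans[OF bij_betw_trans[OF \<alpha> that] \<beta>])
    then show "bij_betw (enc l u) {1..n l} {1..n l}"
      by (rule bij_betw_cong[THEN iffD1, rotated]) (simp add: enc_def)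
  qed (auto simp: enc_def)
  have enc_eq: "enc l u k = k' \<longleftrightarrow> u (\<alpha> l k) = \<alpha> l k'"
    if "bij_betw u (\<Omega> l) (\<Omega> l)" "k \<in> {1..n l}" "k' \<in> {1..n l}" for l u k k'
    using that \<alpha>\<beta>[of "u (\<alpha> l k)" l] \<beta>\<alpha>[of k' l] \<alpha>in[of k l] bij_betwE[OF that(1)] by (auto simp: enc_def)
  define F where "F l \<gamma> = enc l (f l \<gamma>)" for l \<gamma>
  define K where "K l \<gamma> = enc l (g l \<gamma>)" for l \<gamma>
  have fb: "bij_betw (f l \<gamma>) (\<Omega> l) (\<Omega> l)" and gb: "bij_betw (g l \<gamma>) (\<Omega> l) (\<Omega> l)" if "\<gamma> \<in> carrier G" for l \<gamma>
    using ss that by (auto simp: same_stabilizers_def)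
  have fin': "f l \<gamma> x \<in> \<Omega> l" "g l \<gamma> x \<in> \<Omega> l" if "\<gamma> \<in> carrier G" "x \<in> \<Omega> l" for l \<gamma> x
    using bij_betwE[OF fb] bij_betwE[OF gb] that by auto
  have card\<alpha>: "card {k \<in> {1..n l}. P (\<alpha> l k)} = card {x \<in> \<Omega> l. P x}" for l P
    by (rule card_Collect_bij_betw[OF \<alpha>])
  have F_mult: "(\<lambda>l. perm_dist (n l) (F l (\<gamma>\<^sub>1 \<otimes>\<^bsub>G\<^esub> \<gamma>\<^sub>2)) (F l \<gamma>\<^sub>1 \<otimes>\<^bsub>sym_group (n l)\<^esub> F l \<gamma>\<^sub>2)) \<longlonglongrightarrow> 0"
    if "\<gamma>\<^sub>1 \<in> carrier G" "\<gamma>\<^sub>2 \<in> carrier G" for \<gamma>\<^sub>1 \<gamma>\<^sub>2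
  proof -
    let ?P = "\<lambda>l x. f l (\<gamma>\<^sub>1 \<otimes>\<^bsub>G\<^esub> \<gamma>\<^sub>2) x \<noteq> f l \<gamma>\<^sub>1 (f l \<gamma>\<^sub>2 x)"
    have "{k \<in> {1..n l}. F l (\<gamma>\<^sub>1 \<otimes>\<^bsub>G\<^esub> \<gamma>\<^sub>2) k \<noteq> (F l \<gamma>\<^sub>1 \<circ> F l \<gamma>\<^sub>2) k} = {k \<in> {1..n l}. ?P l (\<alpha> l k)}" for l
      using \<alpha>in \<beta>in \<alpha>\<beta> fin' that inj_on_eq_iff[OF inj\<beta>]
      by (intro Collect_cong conj_cong refl) (simp add: F_def enc_def)
    then have "perm_dist (n l) (F l (\<gamma>\<^sub>1 \<otimes>\<^bsub>G\<^esub> \<gamma>\<^sub>2)) (F l \<gamma>\<^sub>1 \<otimes>\<^bsub>sym_group (n l)\<^esub> F l \<gamma>\<^sub>2)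
        = real (card {x \<in> \<Omega> l. ?P l x}) / real (card (\<Omega> l))" for l
      by (simp only: perm_dist_def sym_group_mult card\<alpha>[of l "?P l"] n_def[symmetric])
    moreover have "vanishing \<Omega> ?P" using ss that by (simp add: same_stabilizers_def)
    ultimately show ?thesis by (simp add: vanishing_def)
  qed
  have K_hom: "K l \<in> hom G (sym_group (n l))" for l
  proof (rule homI)
    fix \<gamma> assume "\<gamma> \<in> carrier G"
    then show "K l \<gamma> \<in> carrier (sym_group (n l))"
      unfolding sym_group_carrier K_def by (intro enc gb)
  next
    fix \<gamma>\<^sub>1 \<gamma>\<^sub>2 assume \<gamma>: "\<gamma>\<^sub>1 \<in> carrier G" "\<gamma>\<^sub>2 \<in> carrier G"
    have "K l (\<gamma>\<^sub>1 \<otimes>\<^bsub>G\<^esub> \<gamma>\<^sub>2) k = K l \<gamma>\<^sub>1 (K l \<gamma>\<^sub>2 k)" for k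
    proof (cases "k \<in> {1..n l}")
      case True
      moreover have "g l (\<gamma>\<^sub>1 \<otimes>\<^bsub>G\<^esub> \<gamma>\<^sub>2) (\<alpha> l k) = g l \<gamma>\<^sub>1 (g l \<gamma>\<^sub>2 (\<alpha> l k))"
        using ss \<gamma> \<alpha>in[OF True] by (simp add: same_stabilizers_def)
      ultimately show ?thesis
        using \<alpha>in[OF True] \<beta>in \<alpha>\<beta> fin' \<gamma> by (simp add: K_def enc_def)
    next
      case False
      then have "K l \<gamma> k = k" for \<gamma> unfolding K_def enc_def by (rule if_not_P)
      then show ?thesis by simp
    qed
    then show "K l (\<gamma>\<^sub>1 \<otimes>\<^bsub>G\<^esub> \<gamma>\<^sub>2) = K l \<gamma>\<^sub>1 \<otimes>\<^bsub>sym_group (n l)\<^esub> K l \<gamma>\<^sub>2"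
      by (simp add: sym_group_def fun_eq_iff)
  qed
  have stab: "(\<lambda>l. tv_dist (Pow Q) (stab_pmf (n l) (F l) Q) (stab_pmf (n l) (K l) Q)) \<longlonglongrightarrow> 0"
    if Q: "finite Q" "Q \<subseteq> carrier G" for Q
  proof -
    let ?P = "\<lambda>l x. \<exists>\<gamma>\<in>Q. (f l \<gamma> x = x) \<noteq> (g l \<gamma> x = x)"
    have "vanishing \<Omega> ?P"
      by (rule vanishing_Bex[OF Q(1)]) (use ss Q in \<open>auto simp: same_stabilizers_def\<close>)
    then have lim: "(\<lambda>l. real (card {x \<in> \<Omega> l. ?P l x}) / real (card (\<Omega> l))) \<longlonglongrightarrow> 0"
      by (simp add: vanishing_def)
    have "tv_dist (Pow Q) (stab_pmf (n l) (F l) Q) (stab_pmf (n l) (K l) Q)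
        \<le> real (card {x \<in> \<Omega> l. ?P l x}) / real (card (\<Omega> l))" for l
    proof -
      let ?A = "{k \<in> {1..n l}. {\<gamma> \<in> Q. F l \<gamma> k = k} \<noteq> {\<gamma> \<in> Q. K l \<gamma> k = k}}"
      have "tv_dist (Pow Q) (stab_pmf (n l) (F l) Q) (stab_pmf (n l) (K l) Q)
          \<le> real (card ?A) / real (card {1..n l})"
        unfolding stab_pmf_def using Q n0[of l] by (intro tv_dist_coupling) auto
      also have "?A = {k \<in> {1..n l}. ?P l (\<alpha> l k)}"
      proof (intro Collect_cong conj_cong refl)
        fix k assume k: "k \<in> {1..n l}"
        have "F l \<gamma> k = k \<longleftrightarrow> f l \<gamma> (\<alpha> l k) = \<alpha> l k" "K l \<gamma> k = k \<longleftrightarrow> g l \<gamma> (\<alpha> l k) = \<alpha> l k"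
          if "\<gamma> \<in> Q" for \<gamma>
          unfolding F_def K_def using Q(2) that by (intro enc_eq fb gb k; blast)+
        then show "{\<gamma> \<in> Q. F l \<gamma> k = k} \<noteq> {\<gamma> \<in> Q. K l \<gamma> k = k} \<longleftrightarrow> ?P l (\<alpha> l k)"
          by blast
      qed
      finally show ?thesis by (simp only: card\<alpha>[of l "?P l"] card_atLeastAtMost n_def[symmetric] diff_Suc_1)
    qed
    then show ?thesis
      by (intro tendsto_sandwich[OF _ _ tendsto_const lim])
        (auto simp: tv_dist_def intro!: sum_nonneg)
  qed
  have "(\<forall>l. 0 < n l) \<and> (\<forall>l. F l \<in> carrier G \<rightarrow> carrier (sym_group (n l))) \<and> filterlim n at_top sequentially \<and>
        (\<forall>\<gamma>\<^sub>1 \<in> carrier G. \<forall>\<gamma>\<^sub>2 \<in> carrier G.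
           (\<lambda>l. perm_dist (n l) (F l (\<gamma>\<^sub>1 \<otimes>\<^bsub>G\<^esub> \<gamma>\<^sub>2)) (F l \<gamma>\<^sub>1 \<otimes>\<^bsub>sym_group (n l)\<^esub> F l \<gamma>\<^sub>2)) \<longlonglongrightarrow> 0) \<and>
        (\<exists>g. (\<forall>l. g l \<in> hom G (sym_group (n l))) \<and>
           (\<forall>Q. finite Q \<and> Q \<subseteq> carrier G \<longrightarrow>
              (\<lambda>l. tv_dist (Pow Q) (stab_pmf (n l) (F l) Q) (stab_pmf (n l) (g l) Q)) \<longlonglongrightarrow> 0))"
  proof (intro conjI exI[of _ K])
    show "\<forall>l. F l \<in> carrier G \<rightarrow> carrier (sym_group (n l))"
      by (intro allI Pi_I) (unfold sym_group_carrier F_def, intro enc fb)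
    show "filterlim n at_top sequentially"
      using ss by (simp add: same_stabilizers_def n_def[abs_def])
  qed (use n0 F_mult K_hom stab in auto)
  from rigid[unfolded UB_flexibly_BS_rigid_def, THEN spec, THEN spec, THEN mp, OF this]
  obtain N h where h: "\<And>l. h l \<in> hom G (sym_group (N l))"
      and lim: "\<And>\<gamma>. \<gamma> \<in> carrier G \<Longrightarrow> (\<lambda>l. perm_dist (n l) (F l \<gamma>) (h l \<gamma>)) \<longlonglongrightarrow> 0"
    by (elim exE conjE) blast
  have "vanishing \<Omega> (\<lambda>l x. h l \<gamma> (\<beta> l x) \<noteq> \<beta> l (f l \<gamma> x))" if \<gamma>: "\<gamma> \<in> carrier G" for \<gamma>
  proof -
    have "card {k \<in> {1..n l}. F l \<gamma> k \<noteq> h l \<gamma> k} = card {x \<in> \<Omega> l. h l \<gamma> (\<beta> l x) \<noteq> \<beta> l (f l \<gamma> x)}" for l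
    proof -
      have "F l \<gamma> (\<beta> l x) = \<beta> l (f l \<gamma> x)" if "x \<in> \<Omega> l" for x
        using \<beta>in[OF that] \<alpha>\<beta>[OF that] by (simp add: F_def enc_def)
      then have "{x \<in> \<Omega> l. h l \<gamma> (\<beta> l x) \<noteq> \<beta> l (f l \<gamma> x)} = {x \<in> \<Omega> l. F l \<gamma> (\<beta> l x) \<noteq> h l \<gamma> (\<beta> l x)}"
        by fastforce
      then show ?thesis
        using card_Collect_bij_betw[OF \<beta>, of l "\<lambda>k. F l \<gamma> k \<noteq> h l \<gamma> k"] by (simp only:)
    qed
    then show ?thesis using lim[OF \<gamma>] by (simp add: vanishing_def perm_dist_def n_def)
  qed
  moreover have "h l (\<gamma>\<^sub>1 \<otimes>\<^bsub>G\<^esub> \<gamma>\<^sub>2) = h l \<gamma>\<^sub>1 \<circ> h l \<gamma>\<^sub>2" if "\<gamma>\<^sub>1 \<in> carrier G" "\<gamma>\<^sub>2 \<in> carrier G" for l \<gamma>\<^sub>1 \<gamma>\<^sub>2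
    using hom_mult[OF h that] by (simp add: sym_group_def)
  ultimately show ?thesis using inj\<beta> unfolding approximable_def by blast
qed

section \<open>Products with a finite set and induced actions\<close>

lemma vanishing_Times:
  assumes R: "finite R" and fin: "\<And>l. finite (\<Omega> l)" and P: "\<And>r. r \<in> R \<Longrightarrow> vanishing \<Omega> (P r)"
  shows "vanishing (\<lambda>l. R \<times> \<Omega> l) (\<lambda>l (r, x). P r l x)"
proof (rule vanishing_le)
  show "(\<lambda>l. \<Sum>r\<in>R. real (card {x \<in> \<Omega> l. P r l x}) / real (card (\<Omega> l))) \<longlonglongrightarrow> 0"
    using P by (intro tendsto_null_sum) (simp add: vanishing_def)
  have "real (card {p \<in> R \<times> \<Omega> l. case p of (r, x) \<Rightarrow> P r l x}) / real (card (R \<times> \<Omega> l))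
      \<le> (\<Sum>r\<in>R. real (card {x \<in> \<Omega> l. P r l x}) / real (card (\<Omega> l)))" for l
  proof (cases "R = {}")
    case False
    have "{p \<in> R \<times> \<Omega> l. case p of (r, x) \<Rightarrow> P r l x} = (SIGMA r:R. {x \<in> \<Omega> l. P r l x})" by auto
    then have "card {p \<in> R \<times> \<Omega> l. case p of (r, x) \<Rightarrow> P r l x} = (\<Sum>r\<in>R. card {x \<in> \<Omega> l. P r l x})"
      using R fin by (simp only:) (subst card_SigmaI, auto)
    then have "real (card {p \<in> R \<times> \<Omega> l. case p of (r, x) \<Rightarrow> P r l x}) / real (card (R \<times> \<Omega> l))
        = (\<Sum>r\<in>R. real (card {x \<in> \<Omega> l. P r l x}) / real (card (\<Omega> l))) / real (card R)"
      by (simp add: card_cartesian_product sum_divide_distrib[symmetric] mult.commute)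
    also have "\<dots> \<le> (\<Sum>r\<in>R. real (card {x \<in> \<Omega> l. P r l x}) / real (card (\<Omega> l))) / 1"
      using R False by (intro divide_left_mono sum_nonneg) (auto simp: Suc_le_eq card_gt_0_iff)
    finally show ?thesis by simp
  qed simp
  then show "eventually (\<lambda>l. real (card {p \<in> R \<times> \<Omega> l. case p of (r, x) \<Rightarrow> P r l x}) / real (card (R \<times> \<Omega> l))
      \<le> (\<Sum>r\<in>R. real (card {x \<in> \<Omega> l. P r l x}) / real (card (\<Omega> l)))) sequentially"
    by simp
qed

lemma vanishing_slice:
  assumes N: "vanishing (\<lambda>l. R \<times> \<Omega> l) P" and R: "finite R" "r \<in> R" and fin: "\<And>l. finite (\<Omega> l)"
  shows "vanishing \<Omega> (\<lambda>l x. P l (r, x))"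
proof (rule vanishing_le)
  show "(\<lambda>l. real (card R) * (real (card {p \<in> R \<times> \<Omega> l. P l p}) / real (card (R \<times> \<Omega> l)))) \<longlonglongrightarrow> 0"
    by (rule tendsto_mult_right_zero[OF N[unfolded vanishing_def]])
  have R0: "real (card R) > 0" using R by (auto simp: card_gt_0_iff)
  have "real (card {x \<in> \<Omega> l. P l (r, x)}) / real (card (\<Omega> l))
      \<le> real (card R) * (real (card {p \<in> R \<times> \<Omega> l. P l p}) / real (card (R \<times> \<Omega> l)))" for l
  proof -
    have "card (Pair r ` {x \<in> \<Omega> l. P l (r, x)}) \<le> card {p \<in> R \<times> \<Omega> l. P l p}"
      using R fin by (intro card_mono) auto
    then have "card {x \<in> \<Omega> l. P l (r, x)} \<le> card {p \<in> R \<times> \<Omega> l. P l p}"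
      by (simp add: card_image inj_on_def)
    then show ?thesis using R0 by (simp add: card_cartesian_product divide_right_mono)
  qed
  then show "eventually (\<lambda>l. real (card {x \<in> \<Omega> l. P l (r, x)}) / real (card (\<Omega> l))
      \<le> real (card R) * (real (card {p \<in> R \<times> \<Omega> l. P l p}) / real (card (R \<times> \<Omega> l)))) sequentially"
    by simp
qed

text \<open>The index is given by right cosets, while the induced action lives on left cosets. The
  inverse of an element chosen in the right coset of \<open>inv x\<close> represents the left coset
  of \<open>x\<close>.\<close>

lemma left_transversal:
  assumes G: "group G" and H: "subgroup H G" and fin: "finite (rcosets\<^bsub>G\<^esub> H)"
  obtains s where "\<And>x. x \<in> carrier G \<Longrightarrow> s x \<in> carrier G"
    "\<And>x. x \<in> carrier G \<Longrightarrow> inv\<^bsub>G\<^esub> s x \<otimes>\<^bsub>G\<^esub> x \<in> H"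
    "\<And>x y. x \<in> carrier G \<Longrightarrow> y \<in> H \<Longrightarrow> s (x \<otimes>\<^bsub>G\<^esub> y) = s x"
    "finite (s ` carrier G)"
proof -
  interpret group G by fact
  interpret subgroup H G by fact
  define c where "c C = (SOME y. y \<in> C)" for C :: "'a set"
  define s where "s x = inv\<^bsub>G\<^esub> c (H #>\<^bsub>G\<^esub> inv\<^bsub>G\<^esub> x)" for x
  have c: "c (H #>\<^bsub>G\<^esub> inv\<^bsub>G\<^esub> x) \<in> H #>\<^bsub>G\<^esub> inv\<^bsub>G\<^esub> x" if "x \<in> carrier G" for x
    unfolding c_def using rcos_self[OF inv_closed[OF that] subgroup_axioms] by (rule someI)
  show thesis
  proof (rule that[of s])
    fix x assume x: "x \<in> carrier G"
    obtain h where h: "h \<in> H" "c (H #>\<^bsub>G\<^esub> inv\<^bsub>G\<^esub> x) = h \<otimes>\<^bsub>G\<^esub> inv\<^bsub>G\<^esub> x"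
      using c[OF x] by (auto simp: r_coset_def)
    then have s: "s x = inv\<^bsub>G\<^esub> (h \<otimes>\<^bsub>G\<^esub> inv\<^bsub>G\<^esub> x)" by (simp add: s_def)
    have hG: "h \<in> carrier G" using h(1) by (rule mem_carrier)
    show "s x \<in> carrier G" using x hG by (simp add: s)
    show "inv\<^bsub>G\<^esub> s x \<otimes>\<^bsub>G\<^esub> x \<in> H" using x hG h(1) by (simp add: s m_assoc)
    fix y assume y: "y \<in> H"
    have "H #>\<^bsub>G\<^esub> inv\<^bsub>G\<^esub> (x \<otimes>\<^bsub>G\<^esub> y) = (H #>\<^bsub>G\<^esub> inv\<^bsub>G\<^esub> y) #>\<^bsub>G\<^esub> inv\<^bsub>G\<^esub> x"
      using x y by (simp add: inv_mult_group coset_mult_assoc[OF subset])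
    also have "H #>\<^bsub>G\<^esub> inv\<^bsub>G\<^esub> y = H" using y by (intro coset_join2 subgroup_axioms) auto
    finally show "s (x \<otimes>\<^bsub>G\<^esub> y) = s x" by (simp add: s_def)
  next
    have "s ` carrier G \<subseteq> (\<lambda>C. inv\<^bsub>G\<^esub> c C) ` (rcosets\<^bsub>G\<^esub> H)"
      by (auto simp: s_def RCOSETS_def)
    then show "finite (s ` carrier G)" using fin finite_surj by blast
  qed
qed

text \<open>Both actions are induced to \<open>G\<close> on \<open>R \<times> \<Omega> l\<close>,
  where rigidity of \<open>G\<close> applies. The honest action found there is then restricted to a
  conjugate of \<open>H\<close> and to a single sheet.\<close>

lemma approximable_finite_index:
  assumes G: "group G" and H: "subgroup H G" and fin: "finite (rcosets\<^bsub>G\<^esub> H)"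
    and rigid: "UB_flexibly_BS_rigid G" and ss: "same_stabilizers (G\<lparr>carrier := H\<rparr>) \<Omega> f g"
  shows "approximable (G\<lparr>carrier := H\<rparr>) \<Omega> f"
proof -
  interpret group G by fact
  interpret subgroup H G by fact
  obtain s where s: "\<And>x. x \<in> carrier G \<Longrightarrow> s x \<in> carrier G"
    and sH: "\<And>x. x \<in> carrier G \<Longrightarrow> inv\<^bsub>G\<^esub> s x \<otimes>\<^bsub>G\<^esub> x \<in> H"
    and s_mult: "\<And>x y. x \<in> carrier G \<Longrightarrow> y \<in> H \<Longrightarrow> s (x \<otimes>\<^bsub>G\<^esub> y) = s x"
    and finR: "finite (s ` carrier G)"
    using left_transversal[OF G H fin] by blast
  define R where "R = s ` carrier G"
  have RG: "r \<in> carrier G" if "r \<in> R" for r using that s by (auto simp: R_def)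
  have sdecomp: "x = s x \<otimes>\<^bsub>G\<^esub> (inv\<^bsub>G\<^esub> s x \<otimes>\<^bsub>G\<^esub> x)" if "x \<in> carrier G" for x
    using that s by (simp add: m_assoc[symmetric])
  have sR: "s r = r" if r: "r \<in> R" for r
  proof -
    obtain x where x: "x \<in> carrier G" "r = s x" using r by (auto simp: R_def)
    have "s x = s (s x \<otimes>\<^bsub>G\<^esub> (inv\<^bsub>G\<^esub> s x \<otimes>\<^bsub>G\<^esub> x))" using sdecomp[OF x(1)] by simp
    also have "\<dots> = s (s x)" using x s sH by (intro s_mult) auto
    finally show ?thesis by (simp add: x)
  qed
  \<comment> \<open>The component in \<open>H\<close> of \<open>\<gamma> r\<close> after splitting
    off its representative; its cocycle identity makes \<open>ind\<close> multiplicative exactly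
    where \<open>f\<close> is.\<close>
  define \<eta> where "\<eta> \<gamma> r = inv\<^bsub>G\<^esub> s (\<gamma> \<otimes>\<^bsub>G\<^esub> r) \<otimes>\<^bsub>G\<^esub> (\<gamma> \<otimes>\<^bsub>G\<^esub> r)" for \<gamma> r
  have \<eta>H: "\<eta> \<gamma> r \<in> H" if "\<gamma> \<in> carrier G" "r \<in> R" for \<gamma> r
    using sH that RG by (simp add: \<eta>_def)
  have \<eta>: "\<gamma> \<otimes>\<^bsub>G\<^esub> r = s (\<gamma> \<otimes>\<^bsub>G\<^esub> r) \<otimes>\<^bsub>G\<^esub> \<eta> \<gamma> r" if "\<gamma> \<in> carrier G" "r \<in> R" for \<gamma> r
    unfolding \<eta>_def using sdecomp that RG by simp
  have sRin: "s (\<gamma> \<otimes>\<^bsub>G\<^esub> r) \<in> R" if "\<gamma> \<in> carrier G" "r \<in> R" for \<gamma> r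
    using that RG by (auto simp: R_def)
  have cocycle: "s (\<gamma>\<^sub>1 \<otimes>\<^bsub>G\<^esub> \<gamma>\<^sub>2 \<otimes>\<^bsub>G\<^esub> r) = s (\<gamma>\<^sub>1 \<otimes>\<^bsub>G\<^esub> s (\<gamma>\<^sub>2 \<otimes>\<^bsub>G\<^esub> r))"
    "\<eta> (\<gamma>\<^sub>1 \<otimes>\<^bsub>G\<^esub> \<gamma>\<^sub>2) r = \<eta> \<gamma>\<^sub>1 (s (\<gamma>\<^sub>2 \<otimes>\<^bsub>G\<^esub> r)) \<otimes>\<^bsub>G\<^esub> \<eta> \<gamma>\<^sub>2 r"
    if "\<gamma>\<^sub>1 \<in> carrier G" "\<gamma>\<^sub>2 \<in> carrier G" "r \<in> R" for \<gamma>\<^sub>1 \<gamma>\<^sub>2 r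
  proof -
    note cl = that(1,2) RG[OF that(3)] RG[OF sRin[OF that(2,3)]] mem_carrier[OF \<eta>H[OF that(2,3)]]
    have eq: "\<gamma>\<^sub>1 \<otimes>\<^bsub>G\<^esub> \<gamma>\<^sub>2 \<otimes>\<^bsub>G\<^esub> r = \<gamma>\<^sub>1 \<otimes>\<^bsub>G\<^esub> s (\<gamma>\<^sub>2 \<otimes>\<^bsub>G\<^esub> r) \<otimes>\<^bsub>G\<^esub> \<eta> \<gamma>\<^sub>2 r"
      using cl \<eta>[OF that(2,3)] by (simp add: m_assoc)
    show s12: "s (\<gamma>\<^sub>1 \<otimes>\<^bsub>G\<^esub> \<gamma>\<^sub>2 \<otimes>\<^bsub>G\<^esub> r) = s (\<gamma>\<^sub>1 \<otimes>\<^bsub>G\<^esub> s (\<gamma>\<^sub>2 \<otimes>\<^bsub>G\<^esub> r))"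
      unfolding eq using cl \<eta>H[OF that(2,3)] by (intro s_mult) auto
    show "\<eta> (\<gamma>\<^sub>1 \<otimes>\<^bsub>G\<^esub> \<gamma>\<^sub>2) r = \<eta> \<gamma>\<^sub>1 (s (\<gamma>\<^sub>2 \<otimes>\<^bsub>G\<^esub> r)) \<otimes>\<^bsub>G\<^esub> \<eta> \<gamma>\<^sub>2 r"
      unfolding \<eta>_def[of "\<gamma>\<^sub>1 \<otimes>\<^bsub>G\<^esub> \<gamma>\<^sub>2"] s12 unfolding eq \<eta>_def[of \<gamma>\<^sub>1]
      using cl s by (simp add: m_assoc)
  qed
  define \<Omega>' where "\<Omega>' l = R \<times> \<Omega> l" for l
  then have \<Omega>'_eq: "\<Omega>' = (\<lambda>l. R \<times> \<Omega> l)" by blast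
  define ind where "ind u l \<gamma> = (\<lambda>(r, x). (s (\<gamma> \<otimes>\<^bsub>G\<^esub> r), u l (\<eta> \<gamma> r) x))"
    for u :: "nat \<Rightarrow> 'a \<Rightarrow> 'c \<Rightarrow> 'c" and l \<gamma>
  have fin\<Omega>: "finite (\<Omega> l)" "\<Omega> l \<noteq> {}" for l using ss by (auto simp: same_stabilizers_def)
  have R: "finite R" "R \<noteq> {}" using finR by (auto simp: R_def)
  have fb: "bij_betw (f l y) (\<Omega> l) (\<Omega> l)" and gb: "bij_betw (g l y) (\<Omega> l) (\<Omega> l)" if "y \<in> H" for l y
    using ss that by (auto simp: same_stabilizers_def)
  have ind_bij: "bij_betw (ind u l \<gamma>) (\<Omega>' l) (\<Omega>' l)"
    if u: "\<And>y. y \<in> H \<Longrightarrow> bij_betw (u l y) (\<Omega> l) (\<Omega> l)" and \<gamma>: "\<gamma> \<in> carrier G" for u l \<gamma>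
  proof -
    have "inj_on (ind u l \<gamma>) (\<Omega>' l)"
    proof (rule inj_onI)
      fix p q assume "p \<in> \<Omega>' l" "q \<in> \<Omega>' l" and eq: "ind u l \<gamma> p = ind u l \<gamma> q"
      then obtain r x r' x' where p: "p = (r, x)" "q = (r', x')"
        and r: "r \<in> R" "r' \<in> R" and x: "x \<in> \<Omega> l" "x' \<in> \<Omega> l" by (auto simp: \<Omega>'_def)
      have ss: "s (\<gamma> \<otimes>\<^bsub>G\<^esub> r) = s (\<gamma> \<otimes>\<^bsub>G\<^esub> r')" using eq by (simp add: ind_def p)
      \<comment> \<open>Applying the inverse of \<gamma> recovers \<open>r\<close> from the
        representative of \<open>\<gamma> r\<close>, so sheets are permuted.\<close>
      have "s (inv\<^bsub>G\<^esub> \<gamma> \<otimes>\<^bsub>G\<^esub> \<gamma> \<otimes>\<^bsub>G\<^esub> r) = s (inv\<^bsub>G\<^esub> \<gamma> \<otimes>\<^bsub>G\<^esub> \<gamma> \<otimes>\<^bsub>G\<^esub> r')"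
        using cocycle(1)[OF inv_closed[OF \<gamma>] \<gamma> r(1)] cocycle(1)[OF inv_closed[OF \<gamma>] \<gamma> r(2)] ss by simp
      then have rr: "r = r'" using \<gamma> r RG sR by simp
      have "u l (\<eta> \<gamma> r) x = u l (\<eta> \<gamma> r) x'" using eq by (simp add: ind_def p rr)
      then have "x = x'" using u[OF \<eta>H[OF \<gamma> r(1)]] x by (auto simp: bij_betw_def inj_on_def)
      then show "p = q" by (simp add: p rr)
    qed
    moreover have "ind u l \<gamma> ` \<Omega>' l \<subseteq> \<Omega>' l"
      using sRin \<gamma> bij_betwE[OF u[OF \<eta>H[OF \<gamma>]]] by (auto simp: ind_def \<Omega>'_def)
    ultimately show ?thesis
      using R fin\<Omega> by (simp add: bij_betw_def endo_inj_surj \<Omega>'_def)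
  qed
  have "same_stabilizers G \<Omega>' (ind f) (ind g)"
    unfolding same_stabilizers_def
  proof (intro conjI allI ballI)
    fix l
    show "finite (\<Omega>' l)" "\<Omega>' l \<noteq> {}" using R fin\<Omega> by (auto simp: \<Omega>'_def)
    fix \<gamma> assume "\<gamma> \<in> carrier G"
    then show "bij_betw (ind f l \<gamma>) (\<Omega>' l) (\<Omega>' l)" "bij_betw (ind g l \<gamma>) (\<Omega>' l) (\<Omega>' l)"
      by (intro ind_bij fb gb; simp)+
  next
    have lim: "filterlim (\<lambda>l. card (\<Omega> l)) at_top sequentially" using ss by (simp add: same_stabilizers_def)
    have le: "card (\<Omega> l) \<le> card (\<Omega>' l)" for l
      using R by (simp add: \<Omega>'_def card_cartesian_product Suc_le_eq card_gt_0_iff)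
    show "filterlim (\<lambda>l. card (\<Omega>' l)) at_top sequentially"
      by (rule filterlim_at_top_mono[OF lim]) (simp add: le)
  next
    fix \<gamma>\<^sub>1 \<gamma>\<^sub>2 assume \<gamma>: "\<gamma>\<^sub>1 \<in> carrier G" "\<gamma>\<^sub>2 \<in> carrier G"
    let ?a = "\<lambda>r. \<eta> \<gamma>\<^sub>1 (s (\<gamma>\<^sub>2 \<otimes>\<^bsub>G\<^esub> r))" and ?b = "\<lambda>r. \<eta> \<gamma>\<^sub>2 r"
    have ab: "?a r \<in> H" "?b r \<in> H" if "r \<in> R" for r using \<eta>H \<gamma> sRin that by auto
    have "vanishing \<Omega>' (\<lambda>l (r, x). f l (?a r \<otimes>\<^bsub>G\<^esub> ?b r) x \<noteq> f l (?a r) (f l (?b r) x))"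
      unfolding \<Omega>'_def
      by (rule vanishing_Times[OF R(1) fin\<Omega>(1)]) (use ss ab in \<open>simp add: same_stabilizers_def\<close>)
    then show "vanishing \<Omega>' (\<lambda>l x. ind f l (\<gamma>\<^sub>1 \<otimes>\<^bsub>G\<^esub> \<gamma>\<^sub>2) x \<noteq> ind f l \<gamma>\<^sub>1 (ind f l \<gamma>\<^sub>2 x))"
    proof (rule vanishing_mono)
      show "finite (\<Omega>' l)" for l using R fin\<Omega> by (simp add: \<Omega>'_def)
    qed (use cocycle \<gamma> in \<open>auto simp: \<Omega>'_def ind_def intro!: always_eventually\<close>)
    fix l p assume "p \<in> \<Omega>' l"
    then show "ind g l (\<gamma>\<^sub>1 \<otimes>\<^bsub>G\<^esub> \<gamma>\<^sub>2) p = ind g l \<gamma>\<^sub>1 (ind g l \<gamma>\<^sub>2 p)"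
      using ss cocycle \<gamma> ab by (auto simp: \<Omega>'_def ind_def same_stabilizers_def)
  next
    fix \<gamma> assume \<gamma>: "\<gamma> \<in> carrier G"
    \<comment> \<open>Whether the sheet \<open>r\<close> is fixed is decided by \<gamma> alone, so
      \<open>ind f\<close> and \<open>ind g\<close> can disagree only in the second
      component.\<close>
    have "vanishing \<Omega>' (\<lambda>l (r, x). (f l (\<eta> \<gamma> r) x = x) \<noteq> (g l (\<eta> \<gamma> r) x = x))"
      unfolding \<Omega>'_def
      by (rule vanishing_Times[OF R(1) fin\<Omega>(1)]) (use ss \<eta>H[OF \<gamma>] in \<open>simp add: same_stabilizers_def\<close>)
    then show "vanishing \<Omega>' (\<lambda>l x. (ind f l \<gamma> x = x) \<noteq> (ind g l \<gamma> x = x))"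
    proof (rule vanishing_mono)
      show "finite (\<Omega>' l)" for l using R fin\<Omega> by (simp add: \<Omega>'_def)
    qed (auto simp: \<Omega>'_def ind_def intro!: always_eventually)
  qed
  then have "approximable G \<Omega>' (ind f)" by (rule rigid_imp_approximable[OF G rigid])
  then obtain h \<beta> where inj: "\<And>l. inj_on (\<beta> l) (\<Omega>' l)"
    and h: "\<And>l \<gamma>\<^sub>1 \<gamma>\<^sub>2. \<gamma>\<^sub>1 \<in> carrier G \<Longrightarrow> \<gamma>\<^sub>2 \<in> carrier G \<Longrightarrow> (h :: nat \<Rightarrow> 'a \<Rightarrow> nat \<Rightarrow> nat) l (\<gamma>\<^sub>1 \<otimes>\<^bsub>G\<^esub> \<gamma>\<^sub>2) = h l \<gamma>\<^sub>1 \<circ> h l \<gamma>\<^sub>2"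
    and neg: "\<And>\<gamma>. \<gamma> \<in> carrier G \<Longrightarrow> vanishing \<Omega>' (\<lambda>l x. h l \<gamma> (\<beta> l x) \<noteq> \<beta> l (ind f l \<gamma> x))"
    unfolding approximable_def by blast
  obtain r where r: "r \<in> R" using R by blast
  note rG = RG[OF r]
  \<comment> \<open>Conjugates by \<open>r\<close> of elements of \<open>H\<close> preserve the
    sheet \<open>r\<close>, and \<open>?k y\<close> acts there as \<open>f l y\<close>, which is the
    content of \<open>indk\<close>.\<close>
  let ?k = "\<lambda>y. r \<otimes>\<^bsub>G\<^esub> y \<otimes>\<^bsub>G\<^esub> inv\<^bsub>G\<^esub> r"
  have kr: "?k y \<otimes>\<^bsub>G\<^esub> r = r \<otimes>\<^bsub>G\<^esub> y" if "y \<in> H" for y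
    using rG mem_carrier[OF that] by (simp add: m_assoc)
  have indk: "ind f l (?k y) (r, x) = (r, f l y x)" if "y \<in> H" for l y x
    using rG mem_carrier[OF that] s_mult[OF rG that] sR[OF r]
    by (simp add: ind_def \<eta>_def kr[OF that] m_assoc[symmetric])
  show ?thesis
    unfolding approximable_def
  proof (intro exI[of _ "\<lambda>l y. h l (?k y)"] exI[of _ "\<lambda>l x. \<beta> l (r, x)"] conjI allI ballI)
    show "inj_on (\<lambda>x. \<beta> l (r, x)) (\<Omega> l)" for l
      using inj[of l] r by (auto simp: inj_on_def \<Omega>'_def)
  next
    fix l y z assume "y \<in> carrier (G\<lparr>carrier := H\<rparr>)" "z \<in> carrier (G\<lparr>carrier := H\<rparr>)"
    then have yz: "y \<in> carrier G" "z \<in> carrier G" by auto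
    have "?k (y \<otimes>\<^bsub>G\<^esub> z) = ?k y \<otimes>\<^bsub>G\<^esub> ?k z"
      using yz rG by (simp add: m_assoc) (simp add: m_assoc[symmetric])
    then show "h l (?k (y \<otimes>\<^bsub>G\<lparr>carrier := H\<rparr>\<^esub> z)) = h l (?k y) \<circ> h l (?k z)"
      using h[of "?k y" "?k z"] yz rG by simp
  next
    fix y assume "y \<in> carrier (G\<lparr>carrier := H\<rparr>)"
    then have y: "y \<in> H" by simp
    have "vanishing \<Omega> (\<lambda>l x. h l (?k y) (\<beta> l (r, x)) \<noteq> \<beta> l (ind f l (?k y) (r, x)))"
      by (rule vanishing_slice[OF _ R(1) r fin\<Omega>(1)]) (use neg[of "?k y", unfolded \<Omega>'_eq] y rG in simp)
    then show "vanishing \<Omega> (\<lambda>l x. h l (?k y) (\<beta> l (r, x)) \<noteq> \<beta> l (r, f l y x))"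
      by (simp only: indk[OF y])
  qed
qed

section \<open>The asymptotic action\<close>

definition perm_group :: "'c set \<Rightarrow> ('c \<Rightarrow> 'c) monoid" where
  "perm_group S = \<lparr>carrier = {p. p permutes S}, mult = (\<circ>), one = id\<rparr>"

lemma perm_group_simps [simp]:
  "carrier (perm_group S) = {p. p permutes S}" "mult (perm_group S) = (\<circ>)" "one (perm_group S) = id"
  by (simp_all add: perm_group_def)

lemma group_perm_group: "group (perm_group S)"
  using permutes_inv permutes_inv_o(2)
  by (auto intro!: groupI simp: permutes_compose permutes_id comp_assoc, blast)

lemma inv_perm_group: "p permutes S \<Longrightarrow> inv\<^bsub>perm_group S\<^esub> p = inv' p"
  by (rule group.inv_equality[OF group_perm_group])
    (auto simp: permutes_inv permutes_inv_o)

text \<open>\<open>eval_word\<close> in a permutation group, written with plain inverses of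
  functions so that the set acted on does not occur in the term.\<close>

primrec word_perm :: "('x \<Rightarrow> 'c \<Rightarrow> 'c) \<Rightarrow> ('x \<times> bool) list \<Rightarrow> 'c \<Rightarrow> 'c" where
  "word_perm \<phi> [] = id"
| "word_perm \<phi> (a # w) = (if snd a then \<phi> (fst a) else inv' (\<phi> (fst a))) \<circ> word_perm \<phi> w"

lemma word_perm_eval_word:
  assumes "\<And>x. \<phi> x permutes S"
  shows "word_perm \<phi> w = monoid.eval_word (perm_group S) \<phi> w"
proof -
  interpret group "perm_group S" by (rule group_perm_group)
  show ?thesis
    by (induction w) (auto simp: eval_word_def inv_perm_group[OF assms])
qed

lemma word_perm_hom:
  assumes "\<And>x. \<phi> x permutes S"
  shows "word_perm \<phi> \<in> hom (free_group X) (perm_group S)"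
proof -
  have "word_perm \<phi> = monoid.eval_word (perm_group S) \<phi>"
    by (rule ext) (rule word_perm_eval_word[OF assms])
  then show ?thesis
    using group.eval_word_hom[OF group_perm_group, of \<phi> X S] assms by simp
qed

lemma word_perm_permutes: "(\<And>x. \<phi> x permutes S) \<Longrightarrow> word_perm \<phi> w permutes S"
  by (induction w) (auto intro!: permutes_compose permutes_inv permutes_id)

section \<open>Almost commuting sequences of permutations\<close>

definition almost_commute :: "(nat \<Rightarrow> 'c set) \<Rightarrow> (nat \<Rightarrow> 'c \<Rightarrow> 'c) \<Rightarrow> (nat \<Rightarrow> 'c \<Rightarrow> 'c) \<Rightarrow> bool" where
  "almost_commute \<Omega> p q \<longleftrightarrow> vanishing \<Omega> (\<lambda>l x. p l (q l x) \<noteq> q l (p l x))"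

lemma almost_commute_sym: "almost_commute \<Omega> p q \<Longrightarrow> almost_commute \<Omega> q p"
  by (simp add: almost_commute_def eq_commute)

lemma almost_commute_refl: "(\<And>l x. p l (q l x) = q l (p l x)) \<Longrightarrow> almost_commute \<Omega> p q"
  by (simp add: almost_commute_def vanishing_False)

text \<open>\<open>t\<close> passes \<open>p\<close> at the point \<open>q x\<close> and then
  \<open>q\<close> at \<open>x\<close>; the first exceptional set is pulled back along the bijection
  \<open>q\<close>.\<close>

lemma almost_commute_comp:
  assumes fin: "\<And>l. finite (\<Omega> l)" and q: "\<And>l. q l permutes \<Omega> l"
    and "almost_commute \<Omega> t p" "almost_commute \<Omega> t q"
  shows "almost_commute \<Omega> t (\<lambda>l. p l \<circ> q l)"
  unfolding almost_commute_def
proof (rule vanishing_mono[OF _ fin])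
  show "vanishing \<Omega> (\<lambda>l x. t l (p l (q l x)) \<noteq> p l (t l (q l x)) \<or> t l (q l x) \<noteq> q l (t l x))"
    using assms(3,4) vanishing_bij[where p = q, OF _ permutes_imp_bij[OF q]]
    unfolding almost_commute_def by (intro vanishing_disj) auto
qed (auto intro!: always_eventually)

lemma almost_commute_inv:
  assumes fin: "\<And>l. finite (\<Omega> l)" and p: "\<And>l. p l permutes \<Omega> l" and "almost_commute \<Omega> t p"
  shows "almost_commute \<Omega> t (\<lambda>l. inv' (p l))"
  unfolding almost_commute_def
proof (rule vanishing_mono[OF _ fin])
  show "vanishing \<Omega> (\<lambda>l x. t l (p l (inv' (p l) x)) \<noteq> p l (t l (inv' (p l) x)))"
    using assms(3) vanishing_bij[where p = "\<lambda>l. inv' (p l)", OF _ permutes_imp_bij[OF permutes_inv[OF p]]]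
    unfolding almost_commute_def by auto
  have "t l (inv' (p l) x) = inv' (p l) (t l x)" if "t l (p l (inv' (p l) x)) = p l (t l (inv' (p l) x))" for l x
    using that permutes_inverses[OF p, of l] by metis
  then show "eventually (\<lambda>l. \<forall>x\<in>\<Omega> l. t l (inv' (p l) x) \<noteq> inv' (p l) (t l x) \<longrightarrow>
      t l (p l (inv' (p l) x)) \<noteq> p l (t l (inv' (p l) x))) sequentially"
    by (auto intro!: always_eventually)
qed

lemma almost_commute_word_perm:
  assumes fin: "\<And>l. finite (\<Omega> l)" and \<phi>: "\<And>l x. \<phi> l x permutes \<Omega> l"
    and t: "\<And>x. almost_commute \<Omega> t (\<lambda>l. \<phi> l x)"
  shows "almost_commute \<Omega> t (\<lambda>l. word_perm (\<phi> l) w)"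
proof (induction w)
  case Nil
  show ?case by (simp add: almost_commute_refl)
next
  case (Cons a w)
  have "almost_commute \<Omega> t (\<lambda>l. if snd a then \<phi> l (fst a) else inv' (\<phi> l (fst a)))"
    using t almost_commute_inv[OF fin \<phi> t] by (cases "snd a") simp_all
  then show ?case
    using almost_commute_comp[OF fin word_perm_permutes[OF \<phi>] _ Cons] by (simp only: word_perm.simps)
qed

section \<open>The model, its generators and the drift\<close>

type_synonym state = "point \<times> nat \<times> int"

definition drift_unit :: "nat \<Rightarrow> int" where "drift_unit l = int l + 1"
definition modulus :: "nat \<Rightarrow> int" where "modulus l = 2 * (drift_unit l)\<^sup>2"

lemma drift_unit_pos: "drift_unit l > 0" by (simp add: drift_unit_def)
lemma modulus_pos: "modulus l > 0" by (simp add: modulus_def drift_unit_def)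

text \<open>Six sheets, so that conjugates of one generator by powers of another can realize the six moves
  on the sheet 0; the last coordinate is inert for \<open>f\<close> and carries the central element for \<open>g\<close>.\<close>

definition model :: "nat \<Rightarrow> state set" where
  "model l = cube (modulus l) \<times> {..<6} \<times> {0..<modulus l}"

definition perm_on :: "'c set \<Rightarrow> ('c \<Rightarrow> 'c) \<Rightarrow> 'c \<Rightarrow> 'c" where
  "perm_on S p x = (if x \<in> S then p x else x)"

definition sheet_shift :: "nat \<Rightarrow> state \<Rightarrow> state" where
  "sheet_shift l = perm_on (model l) (\<lambda>(v, i, u). (v, (i + 1) mod 6, u))"
definition sheet_move :: "nat \<Rightarrow> state \<Rightarrow> state" where
  "sheet_move l = perm_on (model l) (\<lambda>(v, i, u). ((moves (modulus l) ! i) v, i, u))"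
text \<open>The exponent is a parameter, so that all integral powers, including negative ones, are
  given by one formula.\<close>

definition drift_by :: "int \<Rightarrow> nat \<Rightarrow> state \<Rightarrow> state" where
  "drift_by e l = perm_on (model l) (\<lambda>(v, i, u). (drift (modulus l) (drift_unit l * e) v, i, u))"
definition lift_by :: "int \<Rightarrow> nat \<Rightarrow> state \<Rightarrow> state" where
  "lift_by e l = perm_on (model l) (\<lambda>(v, i, u). (v, i, (u + e) mod modulus l))"
definition generator :: "nat \<Rightarrow> nat \<Rightarrow> state \<Rightarrow> state" where
  "generator l x = (if x = 0 then sheet_shift l else if x = 1 then sheet_move l else id)"

lemma finite_model [simp]: "finite (model l)" by (simp add: model_def)

lemma card_model: "real (card (model l)) = 6 * real_of_int (modulus l) ^ 4"
  using card_cube[of "modulus l"] modulus_pos[of l]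
  by (simp add: model_def card_cartesian_product of_nat_nat power_numeral_reduce)

lemma model_nonempty: "model l \<noteq> {}"
  using card_model[of l] modulus_pos[of l] by auto

lemma perm_on_permutes:
  assumes "finite S" "\<And>x. x \<in> S \<Longrightarrow> p x \<in> S" "inj_on p S"
  shows "perm_on S p permutes S"
proof (rule bij_imp_permutes)
  have "bij_betw p S S" using assms by (simp add: bij_betw_def endo_inj_surj image_subset_iff)
  then show "bij_betw (perm_on S p) S S"
    by (rule bij_betw_cong[THEN iffD1, rotated]) (simp add: perm_on_def)
qed (simp add: perm_on_def)

lemma drift_in_cube: "n > 0 \<Longrightarrow> v \<in> cube n \<Longrightarrow> drift n s v \<in> cube n"
  using bij_betwE[OF bij_betw_drift] by blast

lemma move_in_cube: "n > 0 \<Longrightarrow> i < 6 \<Longrightarrow> v \<in> cube n \<Longrightarrow> (moves n ! i) v \<in> cube n"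
  using bij_betwE[OF bij_betw_move] by blast

lemma mod_6_cancel: "i < 6 \<Longrightarrow> j < 6 \<Longrightarrow> Suc i mod 6 = Suc j mod 6 \<Longrightarrow> i = j"
  by (auto simp: mod_Suc split: if_splits)

lemma model_permutes:
  "sheet_shift l permutes model l" "sheet_move l permutes model l"
  "drift_by e l permutes model l" "lift_by e l permutes model l"
proof -
  note n = modulus_pos[of l]
  have perm: "perm_on (model l) p permutes model l"
    if closed: "\<And>v i u. v \<in> cube (modulus l) \<Longrightarrow> i < 6 \<Longrightarrow> 0 \<le> u \<Longrightarrow> u < modulus l \<Longrightarrow> p (v, i, u) \<in> model l"
      and inj: "\<And>v i u w j t. v \<in> cube (modulus l) \<Longrightarrow> i < 6 \<Longrightarrow> 0 \<le> u \<Longrightarrow> u < modulus l \<Longrightarrow>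
        w \<in> cube (modulus l) \<Longrightarrow> j < 6 \<Longrightarrow> 0 \<le> t \<Longrightarrow> t < modulus l \<Longrightarrow>
        p (v, i, u) = p (w, j, t) \<Longrightarrow> (v, i, u) = (w, j, t)" for p
  proof (rule perm_on_permutes[OF finite_model])
    show "p x \<in> model l" if "x \<in> model l" for x
      using that closed by (cases x rule: prod_cases3) (simp add: model_def)
    show "inj_on p (model l)"
    proof (rule inj_onI)
      fix x y assume "x \<in> model l" "y \<in> model l" "p x = p y"
      moreover obtain v i u where "x = (v, i, u)" by (cases x rule: prod_cases3)
      moreover obtain w j t where "y = (w, j, t)" by (cases y rule: prod_cases3)
      ultimately show "x = y" using inj[of v i u w j t] by (simp add: model_def)
    qed
  qed
  show "sheet_shift l permutes model l"
    unfolding sheet_shift_def 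
  proof (rule perm)
    fix v w :: point and i j :: nat and u t :: int assume "i < (6 :: nat)" "j < 6"
      "(case (v, i, u) of (v, i, u) \<Rightarrow> (v, (i + 1) mod 6, u))
        = (case (w, j, t) of (v, i, u) \<Rightarrow> (v, (i + 1) mod 6, u))"
    then show "(v :: point, i, u :: int) = (w, j, t)"
      using mod_6_cancel[of i j] by simp
  qed (simp add: model_def)
  show "sheet_move l permutes model l"
    unfolding sheet_move_def
  proof (rule perm)
    fix v w :: point and i j :: nat and u t :: int assume "v \<in> cube (modulus l)" "w \<in> cube (modulus l)" "i < (6 :: nat)"
      "(case (v, i, u) of (v, i, u) \<Rightarrow> ((moves (modulus l) ! i) v, i, u))
        = (case (w, j, t) of (v, i, u) \<Rightarrow> ((moves (modulus l) ! i) v, i, u))"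
    then show "(v, i, u) = (w, j, t)"
      using inj_onD[OF bij_betw_imp_inj_on[OF bij_betw_move[OF n]], of i v w] by auto
  qed (simp add: model_def move_in_cube[OF n])
  show "drift_by e l permutes model l"
    unfolding drift_by_def
  proof (rule perm)
    fix v w :: point and i j :: nat and u t :: int assume "v \<in> cube (modulus l)" "w \<in> cube (modulus l)"
      "(case (v, i :: nat, u) of (v, i, u) \<Rightarrow> (drift (modulus l) (drift_unit l * e) v, i, u))
        = (case (w, j, t) of (v, i, u) \<Rightarrow> (drift (modulus l) (drift_unit l * e) v, i, u))"
    then show "(v, i, u) = (w, j, t)"
      using inj_onD[OF bij_betw_imp_inj_on[OF bij_betw_drift[OF n]], of "drift_unit l * e" v w] by simp
  qed (simp add: model_def drift_in_cube[OF n])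
  show "lift_by e l permutes model l"
    unfolding lift_by_def
  proof (rule perm)
    fix v w :: point and i j :: nat and u t :: int assume "0 \<le> u" "u < modulus l" "0 \<le> t" "t < modulus l"
      "(case (v, i :: nat, u) of (v, i, u) \<Rightarrow> (v, i, (u + e) mod modulus l))
        = (case (w, j, t) of (v, i, u) \<Rightarrow> (v, i, (u + e) mod modulus l))"
    then show "(v :: point, i, u) = (w, j, t)" by (simp add: add_mod_cancel)
  qed (use n in \<open>simp add: model_def\<close>)
qed

lemma generator_permutes: "generator l x permutes model l"
  by (simp add: generator_def model_permutes permutes_id)

lemma drift_drift: "drift n s (drift n t v) = drift n (s + t) v"
  by (cases v) (simp add: mod_simps algebra_simps)

lemma drift_by_add: "drift_by (d + e) l x = drift_by d l (drift_by e l x)"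
proof -
  obtain v i u where "x = (v, i, u)" by (cases x rule: prod_cases3)
  then show ?thesis
    using drift_in_cube[OF modulus_pos, of v l]
    by (auto simp: drift_by_def perm_on_def model_def drift_drift distrib_left)
qed

lemma lift_by_add: "lift_by (d + e) l x = lift_by d l (lift_by e l x)"
proof -
  obtain v i u where "x = (v, i, u)" by (cases x rule: prod_cases3)
  then show ?thesis
    using modulus_pos[of l] by (auto simp: lift_by_def perm_on_def model_def mod_simps add_ac)
qed

lemma lift_by_generator: "lift_by e l (generator l x s) = generator l x (lift_by e l s)"
proof -
  obtain v i u where "s = (v, i, u)" by (cases s rule: prod_cases3)
  then show ?thesis
    using move_in_cube[OF modulus_pos, of i v l] modulus_pos[of l]
    by (auto simp: lift_by_def generator_def sheet_shift_def sheet_move_def perm_on_def model_def)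
qed

lemma lift_by_word: "lift_by e l (word_perm (generator l) w s) = word_perm (generator l) w (lift_by e l s)"
proof (induction w arbitrary: s)
  case (Cons a w)
  have "lift_by e l (inv' (generator l x) s) = inv' (generator l x) (lift_by e l s)" for x s
    using lift_by_generator[of e l x "inv' (generator l x) s"] permutes_inverses[OF generator_permutes, of l x]
    by metis
  then show ?case using Cons lift_by_generator by simp
qed simp

lemma drift_by_0: "drift_by 0 l x = x"
  using modulus_pos[of l] by (cases x) (auto simp: drift_by_def perm_on_def model_def cube_def)

lemma tendsto_const_over_Suc: "(\<lambda>l. c / real (Suc l)) \<longlonglongrightarrow> 0"
  using tendsto_mult_right_zero[OF LIMSEQ_inverse_real_of_nat, of c] by (simp add: divide_inverse)

text \<open>Only \<open>half_trans\<close> can fail to commute, and only at points whose half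
  changes under the step \<open>M\<close>. These are \<open>2 * M\<close> of the
  \<open>2 * M\<^sup>2\<close> values of \<open>z\<close>, a proportion
  \<open>1 / M\<close>.\<close>

lemma almost_commute_drift_1: "almost_commute model (drift_by 1) (\<lambda>l. generator l x)"
  unfolding almost_commute_def
proof (rule vanishing_le)
  show "(\<lambda>l. 1 / real (Suc l)) \<longlonglongrightarrow> 0" by (rule tendsto_const_over_Suc)
  show "eventually (\<lambda>l. real (card {s \<in> model l. drift_by 1 l (generator l x s) \<noteq> generator l x (drift_by 1 l s)})
      / real (card (model l)) \<le> 1 / real (Suc l)) sequentially"
  proof (intro always_eventually allI)
    fix l
    define M n where "M = drift_unit l" and "n = modulus l"
    have M: "M > 0" and n: "n = 2 * M\<^sup>2" and n0: "n > 0" and MM: "M \<le> M\<^sup>2"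
      using drift_unit_pos[of l] modulus_pos[of l] by (auto simp: M_def n_def modulus_def power2_eq_square)
    \<comment> \<open>The heights from which a step \<open>M\<close> enters the upper half or wraps
      around into the lower one.\<close>
    let ?Z = "{M\<^sup>2 - M..<M\<^sup>2} \<union> {n - M..<n}"
    let ?B = "({0..<n} \<times> {0..<n} \<times> ?Z) \<times> {..<6::nat} \<times> {0..<n}"
    have "{s \<in> model l. drift_by 1 l (generator l x s) \<noteq> generator l x (drift_by 1 l s)} \<subseteq> ?B"
    proof
      fix s assume s: "s \<in> {s \<in> model l. drift_by 1 l (generator l x s) \<noteq> generator l x (drift_by 1 l s)}"
      obtain v i u where "s = (v, i, u)" by (cases s rule: prod_cases3)
      moreover obtain a b z where "v = (a, b, z)" by (cases v rule: prod_cases3)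
      ultimately have sd: "s = ((a, b, z), i, u)" by simp
      have bd: "0 \<le> a" "a < n" "0 \<le> b" "b < n" "0 \<le> z" "z < n" "i < 6" "0 \<le> u" "u < n"
        using s by (auto simp: sd model_def cube_def n_def)
      have sm: "s \<in> model l" "(drift n M (a, b, z), i, u) \<in> model l"
        using s drift_in_cube[OF n0] by (auto simp: sd model_def n_def simp del: drift.simps)
      have mv: "moves n ! i \<in> {trans1 n, trans2 n, shear1 n, shear2 n, shear3 n} \<or> i = 5"
        using nth_moves_less_5[of i n] bd(7) by linarith
      have "z \<in> ?Z"
      proof (rule ccontr)
        assume z: "z \<notin> ?Z"
        have same: "2 * ((z + M) mod n) < n \<longleftrightarrow> 2 * z < n"
          using z bd M MM by (auto simp: n mod_pos_pos_trivial)
        have "drift n M ((moves n ! i) (a, b, z)) = (moves n ! i) (drift n M (a, b, z))"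
          using mv
        proof
          assume "i = 5"
          then show ?thesis using same by (simp add: moves_def)
        qed (simp only: moves_drift)
        moreover have "((moves n ! i) (a, b, z), i, u) \<in> model l"
          using move_in_cube[OF n0, of i "(a, b, z)"] bd by (simp add: model_def n_def cube_def)
        ultimately have "drift_by 1 l (generator l x s) = generator l x (drift_by 1 l s)"
          using sm by (auto simp: sd generator_def sheet_shift_def sheet_move_def drift_by_def perm_on_def
              model_def M_def[symmetric] n_def[symmetric] simp del: drift.simps)
        then show False using s by simp
      qed
      then show "s \<in> ?B" using bd by (auto simp: sd)
    qed
    then have "card {s \<in> model l. drift_by 1 l (generator l x s) \<noteq> generator l x (drift_by 1 l s)} \<le> card ?B"
      by (intro card_mono) auto
    also have "card ?B \<le> nat n * (nat n * (nat M + nat M)) * (6 * nat n)"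
      unfolding card_cartesian_product using card_Un_le[of "{M\<^sup>2 - M..<M\<^sup>2}" "{n - M..<n}"] M
      by (intro mult_mono) auto
    finally have "real (card {s \<in> model l. drift_by 1 l (generator l x s) \<noteq> generator l x (drift_by 1 l s)})
        \<le> real (nat n * (nat n * (nat M + nat M)) * (6 * nat n))" by (rule of_nat_mono)
    also have "\<dots> = 6 * real_of_int n ^ 3 * (2 * real_of_int M)"
      using n0 M by (simp add: of_nat_nat power3_eq_cube)
    also have "\<dots> = real (card (model l)) * (1 / real (Suc l))"
    proof -
      have Ml: "real_of_int M = real (Suc l)" by (simp add: M_def drift_unit_def)
      have "real_of_int n = 2 * (real_of_int M)\<^sup>2" by (simp add: n)
      then show ?thesis unfolding card_model n_def[symmetric] Ml[symmetric] using M
        by (simp add: power_numeral_reduce)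
    qed
    finally show "real (card {s \<in> model l. drift_by 1 l (generator l x s) \<noteq> generator l x (drift_by 1 l s)})
      / real (card (model l)) \<le> 1 / real (Suc l)"
      using model_nonempty[of l] by (simp add: divide_le_eq mult.commute card_gt_0_iff)
  qed
qed

text \<open>Almost commutation is symmetric, so closure under composition and inverses also applies
  to the drift; this leads from exponent 1 to -1 and, by induction, to every integer.\<close>

lemma almost_commute_drift: "almost_commute model (drift_by e) (\<lambda>l. word_perm (generator l) w)"
proof -
  have 1: "almost_commute model (drift_by 1) (\<lambda>l. word_perm (generator l) w)"
    by (rule almost_commute_word_perm) (simp_all add: generator_permutes almost_commute_drift_1)
  have "inv' (drift_by 1 l) = drift_by (- 1) l" for l
    by (rule inv_unique_comp) (auto simp: fun_eq_iff drift_by_0 simp flip: drift_by_add)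
  then have m1: "almost_commute model (drift_by (- 1)) (\<lambda>l. word_perm (generator l) w)"
    using almost_commute_sym[OF almost_commute_inv[OF finite_model _ almost_commute_sym[OF 1]]]
    by (simp add: model_permutes)
  have add: "almost_commute model (drift_by (d + e)) (\<lambda>l. word_perm (generator l) w)"
    if "almost_commute model (drift_by d) (\<lambda>l. word_perm (generator l) w)"
      "almost_commute model (drift_by e) (\<lambda>l. word_perm (generator l) w)" for d e
    using almost_commute_sym[OF almost_commute_comp[OF finite_model _
        almost_commute_sym[OF that(1)] almost_commute_sym[OF that(2)]]]
    by (simp add: model_permutes comp_def flip: drift_by_add)
  show ?thesis
  proof (induction e rule: int_induct[where k = 0])
    case base
    show ?case by (rule almost_commute_refl) (simp add: drift_by_0)
  next
    case (step1 i)
    then show ?case using add[OF _ 1] by blast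
  next
    case (step2 i)
    then show ?case using add[OF _ m1, of i] by simp
  qed
qed

section \<open>Integral lifts of the moves and affine displacements\<close>

definition point_cong :: "int \<Rightarrow> point \<Rightarrow> point \<Rightarrow> bool" where
  "point_cong n v w \<longleftrightarrow> n dvd fst v - fst w \<and> n dvd fst (snd v) - fst (snd w) \<and> n dvd snd (snd v) - snd (snd w)"

text \<open>Lifts of the moves and their inverses to integral points; the identity stands for the
  sheet shift and for the half that \<open>half_trans\<close> leaves alone. The set is finite and
  the same for all moduli.\<close>

definition steps :: "(point \<Rightarrow> point) set" where
  "steps = {id, \<lambda>(x, y, z). (x + 1, y, z), \<lambda>(x, y, z). (x - 1, y, z), \<lambda>(x, y, z). (x, y + 1, z),
     \<lambda>(x, y, z). (x, y - 1, z), \<lambda>(x, y, z). (x + y, y, z), \<lambda>(x, y, z). (x - y, y, z),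
     \<lambda>(x, y, z). (x, y + x, z), \<lambda>(x, y, z). (x, y - x, z), \<lambda>(x, y, z). (x, y, z + x),
     \<lambda>(x, y, z). (x, y, z - x)}"

lemma finite_steps: "finite steps" by (simp add: steps_def)
lemma id_in_steps: "id \<in> steps" by (simp add: steps_def)

lemma point_cong_refl: "point_cong n v v" by (simp add: point_cong_def)

lemma point_cong_trans: "point_cong n u v \<Longrightarrow> point_cong n v w \<Longrightarrow> point_cong n u w"
  unfolding point_cong_def by (metis dvd_add diff_add_cancel add_diff_eq)

lemma steps_cong:
  assumes "s \<in> steps" "point_cong n v w"
  shows "point_cong n (s v) (s w)"
proof -
  obtain x y z x' y' z' where vw: "v = (x, y, z)" "w = (x', y', z')" by (cases v; cases w) auto
  have d: "n dvd x - x'" "n dvd y - y'" "n dvd z - z'"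
    using assms(2) by (auto simp: point_cong_def vw)
  note dvd_add[OF d(1,2)] dvd_diff[OF d(1,2)] dvd_diff[OF d(2,1)] dvd_add[OF d(3,1)] dvd_diff[OF d(3,1)]
  with d show ?thesis
    using assms(1) unfolding steps_def by (auto simp: point_cong_def vw algebra_simps)
qed

lemma moves_step:
  assumes "i < 6"
  shows "\<exists>s\<in>steps. point_cong n ((moves n ! i) v) (s v)"
    and "\<exists>s\<in>steps. point_cong n v (s ((moves n ! i) v))"
proof -
  obtain x y z where v: "v = (x, y, z)" by (cases v)
  have m: "n dvd a mod n - a" "n dvd a - a mod n" for a
    by (simp_all add: dvd_minus_mod) (metis dvd_minus_mod dvd_minus_iff minus_diff_eq)
  have m': "n dvd a - (b mod n - c)" if "b = a + c" for a b c
    using m(2)[of b] that by (simp add: algebra_simps)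
  have "moves n ! i \<in> set (moves n)" using assms by simp
  then have p: "moves n ! i \<in> {trans1 n, trans2 n, shear1 n, shear2 n, shear3 n, half_trans n}"
    by (simp only: set_moves)
  have "(\<exists>s\<in>steps. point_cong n ((moves n ! i) v) (s v)) \<and> (\<exists>s\<in>steps. point_cong n v (s ((moves n ! i) v)))"
    using p
  proof (elim insertE emptyE)
    assume "moves n ! i = trans1 n"
    then show ?thesis
      by (intro conjI bexI[of _ "\<lambda>(x, y, z). (x + 1, y, z)"] bexI[of _ "\<lambda>(x, y, z). (x - 1, y, z)"])
        (simp_all only: steps_def insert_iff simp_thms, simp_all add: point_cong_def v m m')
  next
    assume "moves n ! i = trans2 n"
    then show ?thesis
      by (intro conjI bexI[of _ "\<lambda>(x, y, z). (x, y + 1, z)"] bexI[of _ "\<lambda>(x, y, z). (x, y - 1, z)"])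
        (simp_all only: steps_def insert_iff simp_thms, simp_all add: point_cong_def v m m')
  next
    assume "moves n ! i = shear1 n"
    then show ?thesis
      by (intro conjI bexI[of _ "\<lambda>(x, y, z). (x + y, y, z)"] bexI[of _ "\<lambda>(x, y, z). (x - y, y, z)"])
        (simp_all only: steps_def insert_iff simp_thms, simp_all add: point_cong_def v m m')
  next
    assume "moves n ! i = shear2 n"
    then show ?thesis
      by (intro conjI bexI[of _ "\<lambda>(x, y, z). (x, y + x, z)"] bexI[of _ "\<lambda>(x, y, z). (x, y - x, z)"])
        (simp_all only: steps_def insert_iff simp_thms, simp_all add: point_cong_def v m m')
  next
    assume "moves n ! i = shear3 n"
    then show ?thesis
      by (intro conjI bexI[of _ "\<lambda>(x, y, z). (x, y, z + x)"] bexI[of _ "\<lambda>(x, y, z). (x, y, z - x)"])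
        (simp_all only: steps_def insert_iff simp_thms, simp_all add: point_cong_def v m m')
  next
    assume half_trans: "moves n ! i = half_trans n"
    show ?thesis
    proof (cases "2 * z < n")
      case True
      then show ?thesis
        using half_trans by (intro conjI bexI[of _ id] id_in_steps) (simp_all add: point_cong_def v)
    next
      case False
      then show ?thesis
        using half_trans by (intro conjI bexI[of _ "\<lambda>(x, y, z). (x + 1, y, z)"] bexI[of _ "\<lambda>(x, y, z). (x - 1, y, z)"])
          (simp_all only: steps_def insert_iff simp_thms, simp_all add: point_cong_def v m m')
    qed
  qed
  then show "\<exists>s\<in>steps. point_cong n ((moves n ! i) v) (s v)"
    "\<exists>s\<in>steps. point_cong n v (s ((moves n ! i) v))" by blast+
qed

lemma generator_step:
  assumes "(v, i, u) \<in> model l" "q \<in> {generator l x, inv' (generator l x)}"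
  shows "\<exists>s\<in>steps. \<exists>w j. q (v, i, u) = (w, j, u) \<and> (w, j, u) \<in> model l \<and> point_cong (modulus l) w (s v)"
proof -
  define r where "r = q (v, i, u)"
  obtain w j t where r: "r = (w, j, t)" by (cases r rule: prod_cases3)
  have "q permutes model l"
    using assms(2) generator_permutes permutes_inv[OF generator_permutes] by auto
  then have rm: "r \<in> model l" using assms(1) unfolding r_def by (simp only: permutes_in_image)
  have i: "i < 6" "j < 6" using assms rm by (auto simp: r model_def)
  have id: "\<exists>s\<in>steps. point_cong (modulus l) v (s v)"
    using id_in_steps point_cong_refl by (intro bexI[of _ id]) auto
  have "r = generator l x (v, i, u) \<or> (v, i, u) = generator l x r"
  proof (cases "q = generator l x")
    case True
    then show ?thesis unfolding r_def by blast
  next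
    case False
    then have "q = inv' (generator l x)" using assms(2) by blast
    then show ?thesis
      unfolding r_def using permutes_inverses(1)[OF generator_permutes, of l x "(v, i, u)"] by metis
  qed
  then consider "r = generator l x (v, i, u)" | "(v, i, u) = generator l x r" by blast
  then have "t = u \<and> (\<exists>s\<in>steps. point_cong (modulus l) w (s v))"
  proof cases
    case 1
    then show ?thesis
      using assms(1) moves_step(1)[OF i(1), of "modulus l" v] id
      by (auto simp: r generator_def sheet_shift_def sheet_move_def perm_on_def split: if_splits)
  next
    case 2
    then show ?thesis
      using rm moves_step(2)[OF i(2), of "modulus l" w] id
      by (auto simp: r generator_def sheet_shift_def sheet_move_def perm_on_def split: if_splits)
  qed
  then show ?thesis using rm by (auto simp: r r_def[symmetric])
qed

text \<open>The list may vary with the point, since the sheet and the half decide which step occurs,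
  but its length is that of the word. Hence finitely many lists serve all points and all
  \<open>l\<close>.\<close>

lemma word_perm_steps:
  assumes "(v, i, u) \<in> model l"
  shows "\<exists>ss. set ss \<subseteq> steps \<and> length ss = length w \<and>
    (\<exists>v' j. word_perm (generator l) w (v, i, u) = (v', j, u) \<and> (v', j, u) \<in> model l \<and>
      point_cong (modulus l) v' (foldr (\<lambda>s. s) ss v))"
proof (induction w)
  case Nil
  show ?case using assms by (intro exI[of _ "[]"]) (auto simp: point_cong_refl)
next
  case (Cons a w)
  then obtain ss v' j where ss: "set ss \<subseteq> steps" "length ss = length w"
    and v': "word_perm (generator l) w (v, i, u) = (v', j, u)" "(v', j, u) \<in> model l"
    and c: "point_cong (modulus l) v' (foldr (\<lambda>s. s) ss v)" by blast
  let ?q = "if snd a then generator l (fst a) else inv' (generator l (fst a))"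
  have "?q \<in> {generator l (fst a), inv' (generator l (fst a))}" by simp
  from generator_step[OF v'(2) this]
  obtain s v'' k where s: "s \<in> steps" and v'': "(v'', k, u) \<in> model l" "?q (v', j, u) = (v'', k, u)"
      "point_cong (modulus l) v'' (s v')" by blast
  have "point_cong (modulus l) v'' (foldr (\<lambda>s. s) (s # ss) v)"
    using point_cong_trans[OF v''(3) steps_cong[OF s c]] by simp
  moreover have "word_perm (generator l) (a # w) (v, i, u) = (v'', k, u)"
    using v'(1) v''(2) by (simp only: word_perm.simps o_apply)
  moreover have "set (s # ss) \<subseteq> steps" "length (s # ss) = length (a # w)" using ss s by simp_all
  ultimately show ?case using v''(1) by blast
qed

text \<open>The shape is stable under composition: \<open>z\<close> enters only the third
  coordinate, with coefficient 1. So the displacement of \<open>z\<close> is an affine function of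
  \<open>x\<close> and \<open>y\<close>.\<close>

lemma steps_affine:
  assumes "set ss \<subseteq> steps"
  shows "\<exists>a b c a' b' c' \<alpha> \<beta> \<gamma>. \<forall>x y z. foldr (\<lambda>s. s) ss (x, y, z)
    = (a * x + b * y + c, a' * x + b' * y + c', z + \<alpha> * x + \<beta> * y + \<gamma>)"
  using assms
proof (induction ss)
  case Nil
  have "foldr (\<lambda>s. s) [] (x, y, z) = (1 * x + 0 * y + 0, 0 * x + 1 * y + 0, z + 0 * x + 0 * y + 0)"
    for x y z :: int by simp
  then show ?case by blast
next
  case (Cons s ss)
  then obtain a b c a' b' c' \<alpha> \<beta> \<gamma> where IH: "\<And>x y z. foldr (\<lambda>s. s) ss (x, y, z)
    = (a * x + b * y + c, a' * x + b' * y + c', z + \<alpha> * x + \<beta> * y + \<gamma>)" by auto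
  have "s \<in> steps" using Cons.prems by simp
  then have "\<exists>p q r p' q' r' \<sigma>. \<forall>x y z. s (x, y, z) = (p * x + q * y + r, p' * x + q' * y + r', z + \<sigma> * x)"
    unfolding steps_def
  proof (elim insertE emptyE)
    assume eq: "s = id"
    show ?thesis
      by (rule exI[of _ "1"], rule exI[of _ "0"], rule exI[of _ "0"], rule exI[of _ "0"], rule exI[of _ "1"], rule exI[of _ "0"], rule exI[of _ "0"], simp add: eq)
  next
    assume eq: "s = (\<lambda>(x, y, z). (x + 1, y, z))"
    show ?thesis
      by (rule exI[of _ "1"], rule exI[of _ "0"], rule exI[of _ "1"], rule exI[of _ "0"], rule exI[of _ "1"], rule exI[of _ "0"], rule exI[of _ "0"], simp add: eq)
  next
    assume eq: "s = (\<lambda>(x, y, z). (x - 1, y, z))"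
    show ?thesis
      by (rule exI[of _ "1"], rule exI[of _ "0"], rule exI[of _ "-1"], rule exI[of _ "0"], rule exI[of _ "1"], rule exI[of _ "0"], rule exI[of _ "0"], simp add: eq)
  next
    assume eq: "s = (\<lambda>(x, y, z). (x, y + 1, z))"
    show ?thesis
      by (rule exI[of _ "1"], rule exI[of _ "0"], rule exI[of _ "0"], rule exI[of _ "0"], rule exI[of _ "1"], rule exI[of _ "1"], rule exI[of _ "0"], simp add: eq)
  next
    assume eq: "s = (\<lambda>(x, y, z). (x, y - 1, z))"
    show ?thesis
      by (rule exI[of _ "1"], rule exI[of _ "0"], rule exI[of _ "0"], rule exI[of _ "0"], rule exI[of _ "1"], rule exI[of _ "-1"], rule exI[of _ "0"], simp add: eq)
  next
    assume eq: "s = (\<lambda>(x, y, z). (x + y, y, z))"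
    show ?thesis
      by (rule exI[of _ "1"], rule exI[of _ "1"], rule exI[of _ "0"], rule exI[of _ "0"], rule exI[of _ "1"], rule exI[of _ "0"], rule exI[of _ "0"], simp add: eq)
  next
    assume eq: "s = (\<lambda>(x, y, z). (x - y, y, z))"
    show ?thesis
      by (rule exI[of _ "1"], rule exI[of _ "-1"], rule exI[of _ "0"], rule exI[of _ "0"], rule exI[of _ "1"], rule exI[of _ "0"], rule exI[of _ "0"], simp add: eq)
  next
    assume eq: "s = (\<lambda>(x, y, z). (x, y + x, z))"
    show ?thesis
      by (rule exI[of _ "1"], rule exI[of _ "0"], rule exI[of _ "0"], rule exI[of _ "1"], rule exI[of _ "1"], rule exI[of _ "0"], rule exI[of _ "0"], simp add: eq)
  next
    assume eq: "s = (\<lambda>(x, y, z). (x, y - x, z))"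
    show ?thesis
      by (rule exI[of _ "1"], rule exI[of _ "0"], rule exI[of _ "0"], rule exI[of _ "-1"], rule exI[of _ "1"], rule exI[of _ "0"], rule exI[of _ "0"], simp add: eq)
  next
    assume eq: "s = (\<lambda>(x, y, z). (x, y, z + x))"
    show ?thesis
      by (rule exI[of _ "1"], rule exI[of _ "0"], rule exI[of _ "0"], rule exI[of _ "0"], rule exI[of _ "1"], rule exI[of _ "0"], rule exI[of _ "1"], simp add: eq)
  next
    assume eq: "s = (\<lambda>(x, y, z). (x, y, z - x))"
    show ?thesis
      by (rule exI[of _ "1"], rule exI[of _ "0"], rule exI[of _ "0"], rule exI[of _ "0"], rule exI[of _ "1"], rule exI[of _ "0"], rule exI[of _ "-1"], simp add: eq)
  qed
  then obtain p q r p' q' r' \<sigma> where s: "\<And>x y z. s (x, y, z) = (p * x + q * y + r, p' * x + q' * y + r', z + \<sigma> * x)"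
    by blast
  have "foldr (\<lambda>s. s) (s # ss) (x, y, z) =
     ((p * a + q * a') * x + (p * b + q * b') * y + (p * c + q * c' + r),
      (p' * a + q' * a') * x + (p' * b + q' * b') * y + (p' * c + q' * c' + r'),
      z + (\<alpha> + \<sigma> * a) * x + (\<beta> + \<sigma> * b) * y + (\<gamma> + \<sigma> * c))" for x y z
    by (simp add: IH s algebra_simps)
  then show ?case by blast
qed

lemma modulus_ge: "real (Suc l) \<le> real_of_int (modulus l)"
  by (simp add: modulus_def drift_unit_def power2_eq_square algebra_simps)

text \<open>The model has \<open>6 * n ^ 4\<close> points, so a set is negligible once one of its
  four long coordinates is determined, up to boundedly many choices, by the others.\<close>

lemma vanishing_injective_image:
  assumes F: "\<And>l. F l ` {s \<in> model l. P l s} \<subseteq> T l" "\<And>l. inj_on (F l) {s \<in> model l. P l s}" "\<And>l. finite (T l)"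
    and card: "\<And>l. real (card (T l)) \<le> c * real_of_int (modulus l) ^ 3" and c: "c \<ge> 0"
  shows "vanishing model P"
proof (rule vanishing_le)
  show "(\<lambda>l. c / real (Suc l)) \<longlonglongrightarrow> 0" by (rule tendsto_const_over_Suc)
  show "eventually (\<lambda>l. real (card {s \<in> model l. P l s}) / real (card (model l)) \<le> c / real (Suc l)) sequentially"
  proof (intro always_eventually allI)
    fix l
    let ?n = "real_of_int (modulus l)"
    have n: "?n > 0" using modulus_pos by simp
    have "card {s \<in> model l. P l s} \<le> card (T l)"
      by (rule card_inj_on_le[OF F(2,1,3)])
    then have "real (card {s \<in> model l. P l s}) \<le> c * ?n ^ 3" using card[of l] by linarith
    then have "real (card {s \<in> model l. P l s}) / real (card (model l)) \<le> c * ?n ^ 3 / (6 * ?n ^ 4)"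
      unfolding card_model using n by (intro divide_right_mono) auto
    also have "\<dots> = (c / 6) / ?n" using n by (simp add: power_numeral_reduce)
    also have "\<dots> \<le> c / ?n" using c n by (intro divide_right_mono) auto
    also have "\<dots> \<le> c / real (Suc l)" using modulus_ge[of l] c n by (intro divide_left_mono) auto
    finally show "real (card {s \<in> model l. P l s}) / real (card (model l)) \<le> c / real (Suc l)" .
  qed
qed

lemma affine_quotient_bound:
  fixes n M :: int
  assumes "n > 0" "0 \<le> M" "M \<le> n" "0 \<le> x" "x < n" "0 \<le> y" "y < n"
    and eq: "M * e + \<alpha> * x + \<beta> * y + \<gamma> = n * q"
  shows "\<bar>q\<bar> \<le> \<bar>e\<bar> + \<bar>\<alpha>\<bar> + \<bar>\<beta>\<bar> + \<bar>\<gamma>\<bar>"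
proof -
  have "n * \<bar>q\<bar> = \<bar>M * e + \<alpha> * x + \<beta> * y + \<gamma>\<bar>" using assms(1) by (simp add: eq abs_mult)
  also have "\<dots> \<le> \<bar>M * e\<bar> + \<bar>\<alpha> * x\<bar> + \<bar>\<beta> * y\<bar> + \<bar>\<gamma>\<bar>" by linarith
  also have "\<dots> \<le> n * \<bar>e\<bar> + n * \<bar>\<alpha>\<bar> + n * \<bar>\<beta>\<bar> + n * \<bar>\<gamma>\<bar>"
    using assms mult_right_mono[of 1 n "\<bar>\<gamma>\<bar>"]
    by (intro add_mono) (auto simp: abs_mult mult.commute[of "\<bar>\<alpha>\<bar>"] mult.commute[of "\<bar>\<beta>\<bar>"] intro!: mult_right_mono)
  also have "\<dots> = n * (\<bar>e\<bar> + \<bar>\<alpha>\<bar> + \<bar>\<beta>\<bar> + \<bar>\<gamma>\<bar>)" by (simp add: algebra_simps)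
  finally show ?thesis using assms(1) by simp
qed

lemma drift_unit_le_modulus: "drift_unit l \<le> modulus l"
  using drift_unit_pos[of l] by (simp add: modulus_def power2_eq_square)

text \<open>By \<open>affine_quotient_bound\<close> the quotient by the modulus takes boundedly many
  values. If \<alpha> or \<beta> is nonzero, the quotient and the other variable determine
  \<open>x\<close> or \<open>y\<close>; if both vanish, the divisibility fails for all large
  \<open>l\<close>.\<close>

lemma vanishing_affine:
  assumes e: "e \<noteq> 0"
  shows "vanishing model (\<lambda>l ((x, y, z), i, u). modulus l dvd drift_unit l * e + \<alpha> * x + \<beta> * y + \<gamma>)"
proof -
  define k where "k = \<bar>e\<bar> + \<bar>\<alpha>\<bar> + \<bar>\<beta>\<bar> + \<bar>\<gamma>\<bar>"
  let ?P = "\<lambda>l ((x, y, z), i :: nat, u :: int). modulus l dvd drift_unit l * e + \<alpha> * x + \<beta> * y + \<gamma>"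
  let ?T = "\<lambda>l. {-k..k} \<times> {0..<modulus l} \<times> {0..<modulus l} \<times> {..<6::nat} \<times> {0..<modulus l}"
  let ?q = "\<lambda>l x y. (drift_unit l * e + \<alpha> * x + \<beta> * y + \<gamma>) div modulus l"
  have k: "k \<ge> 0" by (simp add: k_def)
  have T: "finite (?T l)" "real (card (?T l)) \<le> real_of_int (6 * (2 * k + 1)) * real_of_int (modulus l) ^ 3" for l
    using k modulus_pos[of l] by (auto simp: card_cartesian_product of_nat_nat power3_eq_cube)
  have q: "?q l x y \<in> {-k..k}"
    "drift_unit l * e + \<alpha> * x + \<beta> * y + \<gamma> = modulus l * ?q l x y"
    if "?P l ((x, y, z), i, u)" "((x, y, z), i, u) \<in> model l" for l x y z i u
  proof -
    show eq: "drift_unit l * e + \<alpha> * x + \<beta> * y + \<gamma> = modulus l * ?q l x y"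
      using that(1) by simp
    have "\<bar>?q l x y\<bar> \<le> k"
      unfolding k_def using that(2) drift_unit_pos[of l] drift_unit_le_modulus[of l] modulus_pos[of l]
      by (intro affine_quotient_bound[OF _ _ _ _ _ _ _ eq]) (auto simp: model_def cube_def)
    then show "?q l x y \<in> {-k..k}" by auto
  qed
  consider "\<alpha> \<noteq> 0" | "\<beta> \<noteq> 0" | "\<alpha> = 0" "\<beta> = 0" by blast
  then show ?thesis
  proof cases
    case 1
    let ?F = "\<lambda>l ((x, y, z), i, u). (?q l x y, y, z, i, u)"
    show ?thesis
    proof (rule vanishing_injective_image[of ?F _ ?T])
      show "?F l ` {s \<in> model l. ?P l s} \<subseteq> ?T l" for l
        using q(1)[of l] by (auto simp: model_def cube_def simp del: atLeastAtMost_iff)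
      show "inj_on (?F l) {s \<in> model l. ?P l s}" for l
      proof (rule inj_onI)
        fix s t assume s: "s \<in> {s \<in> model l. ?P l s}" and t: "t \<in> {s \<in> model l. ?P l s}" and eq: "?F l s = ?F l t"
        obtain x y z i u where sd: "s = ((x, y, z), i, u)" by (cases s) auto
        obtain x' y' z' i' u' where td: "t = ((x', y', z'), i', u')" by (cases t) auto
        have e1: "drift_unit l * e + \<alpha> * x + \<beta> * y + \<gamma> = modulus l * ?q l x y"
          by (rule q(2)[of l x y z i u]) (use s in \<open>auto simp: sd\<close>)
        have e2: "drift_unit l * e + \<alpha> * x' + \<beta> * y' + \<gamma> = modulus l * ?q l x' y'"
          by (rule q(2)[of l x' y' z' i' u']) (use t in \<open>auto simp: td\<close>)
        have eqq: "?q l x y = ?q l x' y'" using eq unfolding sd td prod.case prod.inject by (rule conjunct1)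
        have oo: "y = y'" using eq unfolding sd td prod.case prod.inject by blast
        have "drift_unit l * e + \<alpha> * x + \<beta> * y + \<gamma> = drift_unit l * e + \<alpha> * x' + \<beta> * y' + \<gamma>"
          by (subst e1, subst e2, subst eqq) (rule refl)
        then have "\<alpha> * x = \<alpha> * x'" using oo by simp
        then show "s = t" using 1 eq by (simp add: sd td)
      qed
    qed (use T k in auto)
  next
    case 2
    let ?F = "\<lambda>l ((x, y, z), i, u). (?q l x y, x, z, i, u)"
    show ?thesis
    proof (rule vanishing_injective_image[of ?F _ ?T])
      show "?F l ` {s \<in> model l. ?P l s} \<subseteq> ?T l" for l
        using q(1)[of l] by (auto simp: model_def cube_def simp del: atLeastAtMost_iff)
      show "inj_on (?F l) {s \<in> model l. ?P l s}" for l
      proof (rule inj_onI)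
        fix s t assume s: "s \<in> {s \<in> model l. ?P l s}" and t: "t \<in> {s \<in> model l. ?P l s}" and eq: "?F l s = ?F l t"
        obtain x y z i u where sd: "s = ((x, y, z), i, u)" by (cases s) auto
        obtain x' y' z' i' u' where td: "t = ((x', y', z'), i', u')" by (cases t) auto
        have e1: "drift_unit l * e + \<alpha> * x + \<beta> * y + \<gamma> = modulus l * ?q l x y"
          by (rule q(2)[of l x y z i u]) (use s in \<open>auto simp: sd\<close>)
        have e2: "drift_unit l * e + \<alpha> * x' + \<beta> * y' + \<gamma> = modulus l * ?q l x' y'"
          by (rule q(2)[of l x' y' z' i' u']) (use t in \<open>auto simp: td\<close>)
        have eqq: "?q l x y = ?q l x' y'" using eq unfolding sd td prod.case prod.inject by (rule conjunct1)
        have oo: "x = x'" using eq unfolding sd td prod.case prod.inject by blast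
        have "drift_unit l * e + \<alpha> * x + \<beta> * y + \<gamma> = drift_unit l * e + \<alpha> * x' + \<beta> * y' + \<gamma>"
          by (subst e1, subst e2, subst eqq) (rule refl)
        then have "\<beta> * y = \<beta> * y'" using oo by simp
        then show "s = t" using 2 eq by (simp add: sd td)
      qed
    qed (use T k in auto)
  next
    case 3
    \<comment> \<open>Once \<open>M > k\<close>, the number \<open>M * e + \<gamma>\<close> is
      nonzero because \<open>M\<close> exceeds the absolute value of \<gamma>, and smaller than
      \<open>2 * M\<^sup>2\<close> in absolute value. So it matters that the drift unit is unbounded
      but of smaller order than the modulus.\<close>
    have "\<not> modulus l dvd drift_unit l * e + \<gamma>" if l: "l \<ge> nat k" for l
    proof
      assume dv: "modulus l dvd drift_unit l * e + \<gamma>"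
      have M: "drift_unit l > k" using l k by (simp add: drift_unit_def)
      have "\<bar>drift_unit l * e + \<gamma>\<bar> \<le> drift_unit l * \<bar>e\<bar> + \<bar>\<gamma>\<bar>"
        using drift_unit_pos[of l] abs_triangle_ineq[of "drift_unit l * e" \<gamma>] by (simp add: abs_mult)
      also have "\<dots> \<le> drift_unit l * (\<bar>e\<bar> + \<bar>\<gamma>\<bar>)"
        using drift_unit_pos[of l] mult_right_mono[of 1 "drift_unit l" "\<bar>\<gamma>\<bar>"] by (simp add: distrib_left)
      also have "\<dots> < modulus l"
        using mult_strict_left_mono[of "\<bar>e\<bar> + \<bar>\<gamma>\<bar>" "2 * drift_unit l" "drift_unit l"] M drift_unit_pos[of l]
        by (simp add: k_def modulus_def power2_eq_square)
      finally have "drift_unit l * e + \<gamma> = 0"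
        using dvd_imp_le_int[OF _ dv] modulus_pos[of l] by force
      then have "drift_unit l * \<bar>e\<bar> = \<bar>\<gamma>\<bar>"
        using drift_unit_pos[of l] by (metis abs_minus_cancel abs_mult abs_of_pos add_eq_0_iff)
      moreover have "drift_unit l * \<bar>e\<bar> \<ge> drift_unit l" using e drift_unit_pos[of l] by (simp add: mult_le_cancel_left1)
      ultimately show False using M by (simp add: k_def)
    qed
    then have "eventually (\<lambda>l. \<forall>s\<in>model l. ?P l s \<longrightarrow> False) sequentially"
      using 3 by (intro eventually_sequentiallyI[of "nat k"]) auto
    then show ?thesis by (rule vanishing_mono[OF vanishing_False finite_model])
  qed
qed

text \<open>At a fixed point the height returns modulo \<open>n\<close>, so the drift
  \<open>M * e\<close> and the affine displacement of one of finitely many lists of steps cancel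
  modulo \<open>n\<close>.\<close>

lemma vanishing_word_drift_fixed:
  assumes e: "e \<noteq> 0"
  shows "vanishing model (\<lambda>l s. word_perm (generator l) w (drift_by e l s) = s)"
proof -
  define L where "L = {ss. set ss \<subseteq> steps \<and> length ss = length w}"
  have L: "finite L" unfolding L_def by (rule finite_lists_length_eq[OF finite_steps])
  define Q where "Q ss l s = (case s of ((x, y, z), i :: nat, u :: int) \<Rightarrow>
    modulus l dvd snd (snd (foldr (\<lambda>s. s) ss (x, y, z + drift_unit l * e))) - z)" for ss :: "(point \<Rightarrow> point) list" and l s
  have "vanishing model (Q ss)" if ss: "ss \<in> L" for ss
  proof -
    obtain a b c a' b' c' \<alpha> \<beta> \<gamma> where aff: "\<And>x y z. foldr (\<lambda>s. s) ss (x, y, z)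
      = (a * x + b * y + c, a' * x + b' * y + c', z + \<alpha> * x + \<beta> * y + \<gamma>)"
      using steps_affine[of ss] ss unfolding L_def by blast
    have "Q ss = (\<lambda>l ((x, y, z), i, u). modulus l dvd drift_unit l * e + \<alpha> * x + \<beta> * y + \<gamma>)"
      by (auto simp: Q_def aff fun_eq_iff algebra_simps)
    then show ?thesis using vanishing_affine[OF e] by simp
  qed
  then have N: "vanishing model (\<lambda>l s. \<exists>ss\<in>L. Q ss l s)" by (rule vanishing_Bex[OF L])
  have "\<exists>ss\<in>L. Q ss l s" if s: "s \<in> model l" and fixed: "word_perm (generator l) w (drift_by e l s) = s" for l s
  proof -
    obtain v i u where "s = (v, i, u)" by (cases s rule: prod_cases3)
    moreover obtain x y z where v: "v = (x, y, z)" by (cases v rule: prod_cases3)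
    ultimately have sd: "s = ((x, y, z), i, u)" by simp
    let ?z = "(z + drift_unit l * e) mod modulus l"
    have d: "drift_by e l s = ((x, y, ?z), i, u)"
      using s by (simp add: drift_by_def perm_on_def sd)
    have "((x, y, ?z), i, u) \<in> model l"
      using permutes_in_image[OF model_permutes(3), of e l s] s d by simp
    moreover have "word_perm (generator l) w ((x, y, ?z), i, u) = ((x, y, z), i, u)"
      using fixed unfolding d unfolding sd .
    ultimately obtain ss where ss: "ss \<in> L"
      and c: "point_cong (modulus l) (x, y, z) (foldr (\<lambda>s. s) ss (x, y, ?z))"
      using word_perm_steps[of "(x, y, ?z)" i u l w] unfolding L_def by auto
    obtain a b c a' b' c' \<alpha> \<beta> \<gamma> where aff: "\<And>x y z. foldr (\<lambda>s. s) ss (x, y, z)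
      = (a * x + b * y + c, a' * x + b' * y + c', z + \<alpha> * x + \<beta> * y + \<gamma>)"
      using steps_affine[of ss] ss unfolding L_def by blast
    have "modulus l dvd z - (?z + \<alpha> * x + \<beta> * y + \<gamma>)"
      using c by (simp add: point_cong_def aff)
    moreover have "modulus l dvd z + drift_unit l * e - ?z" by (rule dvd_minus_mod)
    ultimately have "modulus l dvd (z + drift_unit l * e - ?z) - (z - (?z + \<alpha> * x + \<beta> * y + \<gamma>))"
      by (rule dvd_diff[rotated])
    then have "Q ss l s" by (simp add: Q_def sd aff algebra_simps)
    then show ?thesis using ss by blast
  qed
  then show ?thesis
    by (intro vanishing_mono[OF N finite_model] always_eventually) auto
qed

section \<open>Groups with homomorphisms to a free group and to the integers\<close>

locale central_extension_data = group H for H :: "('a, 'b) monoid_scheme" (structure) +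
  fixes X :: "nat set" and \<pi> :: "'a \<Rightarrow> (nat \<times> bool) list" and e :: "'a \<Rightarrow> int" and a b \<tau> :: 'a
  assumes \<pi>: "\<pi> \<in> hom H (free_group X)" and e: "e \<in> hom H integer_group"
    and closed: "a \<in> carrier H" "b \<in> carrier H" "\<tau> \<in> carrier H"
    and \<pi>_values: "\<pi> a = [(0, True)]" "\<pi> b = [(1, True)]" "\<pi> \<tau> = []"
    and e_values: "e a = 0" "e b = 0" "e \<tau> = 1"
    and \<tau>_commute: "\<tau> \<otimes> a = a \<otimes> \<tau>" "\<tau> \<otimes> b = b \<otimes> \<tau>"
begin

definition P :: "nat \<Rightarrow> 'a \<Rightarrow> state \<Rightarrow> state" where "P l y = word_perm (generator l) (\<pi> y)"
definition f :: "nat \<Rightarrow> 'a \<Rightarrow> state \<Rightarrow> state" where "f l y x = P l y (drift_by (e y) l x)"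
definition g :: "nat \<Rightarrow> 'a \<Rightarrow> state \<Rightarrow> state" where "g l y x = P l y (lift_by (e y) l x)"

lemma P_mult: "y \<in> carrier H \<Longrightarrow> z \<in> carrier H \<Longrightarrow> P l (y \<otimes> z) x = P l y (P l z x)"
  using hom_mult[OF \<pi>, of y z] hom_in_carrier[OF \<pi>]
    hom_mult[OF word_perm_hom[of "generator l" "model l" X], of "\<pi> y" "\<pi> z"]
  by (simp add: P_def generator_permutes)

lemma e_mult: "y \<in> carrier H \<Longrightarrow> z \<in> carrier H \<Longrightarrow> e (y \<otimes> z) = e y + e z"
  using hom_mult[OF e] by simp

lemma P_permutes: "P l y permutes model l"
  unfolding P_def by (rule word_perm_permutes) (rule generator_permutes)

lemma bij_betw_model_comp:
  "p permutes model l \<Longrightarrow> q permutes model l \<Longrightarrow> bij_betw (\<lambda>x. p (q x)) (model l) (model l)"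
  using permutes_imp_bij[OF permutes_compose[of q "model l" p]] by (simp add: comp_def)

text \<open>\<open>P\<close> is multiplicative and \<open>e\<close> additive, so the only error
  arises when \<open>drift_by (e y)\<close> passes \<open>P l z\<close>, at the point already moved
  by \<open>drift_by (e z)\<close>.\<close>

lemma f_mult:
  assumes "y \<in> carrier H" "z \<in> carrier H"
  shows "vanishing model (\<lambda>l x. f l (y \<otimes> z) x \<noteq> f l y (f l z x))"
proof -
  have "vanishing model (\<lambda>l x. drift_by (e y) l (P l z x) \<noteq> P l z (drift_by (e y) l x))"
    using almost_commute_drift unfolding almost_commute_def P_def .
  from vanishing_bij[where p = "drift_by (e z)", OF this permutes_imp_bij[OF model_permutes(3)]]
  show ?thesis
    by (rule vanishing_mono[OF _ finite_model])
      (auto simp: f_def P_mult e_mult assms drift_by_add intro!: always_eventually)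
qed

text \<open>If \<open>e y = 0\<close>, the two maps coincide. Otherwise \<open>g\<close> has no
  fixed points once the modulus exceeds the absolute value of \<open>e y\<close>, because the last
  coordinate moves, and \<open>f\<close> has few by the affine estimate.\<close>

lemma fixed_points:
  assumes "y \<in> carrier H"
  shows "vanishing model (\<lambda>l x. (f l y x = x) \<noteq> (g l y x = x))"
proof (cases "e y = 0")
  case True
  have "lift_by 0 l x = x" for l x
    using modulus_pos[of l] by (cases x rule: prod_cases3) (auto simp: lift_by_def perm_on_def model_def)
  then have "f l y x = g l y x" for l x by (simp add: f_def g_def True drift_by_0)
  then show ?thesis by (simp add: vanishing_False)
next
  case False
  have "g l y x \<noteq> x" if l: "nat \<bar>e y\<bar> \<le> l" and x: "x \<in> model l" for l x
  proof -
    obtain v i u where xd: "x = (v, i, u)" by (cases x rule: prod_cases3)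
    have n: "\<bar>e y\<bar> < modulus l" using l modulus_ge[of l] by linarith
    have lift: "lift_by (e y) l x = (v, i, (u + e y) mod modulus l)"
      using x by (simp add: lift_by_def perm_on_def xd)
    then have "(v, i, (u + e y) mod modulus l) \<in> model l"
      using permutes_in_image[OF model_permutes(4), of "e y" l x] x by simp
    from word_perm_steps[OF this, of "\<pi> y"] have "snd (snd (g l y x)) = (u + e y) mod modulus l"
      unfolding g_def P_def lift by fastforce
    moreover have "(u + e y) mod modulus l \<noteq> u"
    proof
      assume "(u + e y) mod modulus l = u"
      then have "modulus l dvd e y"
        by (metis add_diff_cancel_left' dvd_minus_mod)
      then show False using dvd_imp_le_int[OF False] n modulus_pos[of l] by fastforce
    qed
    ultimately show ?thesis by (auto simp: xd)
  qed
  then have "eventually (\<lambda>l. \<forall>x\<in>model l. (f l y x = x) \<noteq> (g l y x = x) \<longrightarrow> P l y (drift_by (e y) l x) = x) sequentially"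
    by (intro eventually_sequentiallyI[of "nat \<bar>e y\<bar>"]) (auto simp: f_def)
  from vanishing_mono[OF vanishing_word_drift_fixed[OF False] finite_model this[unfolded P_def]]
  show ?thesis .
qed

lemma same_stabilizers_model: "same_stabilizers H model f g"
  unfolding same_stabilizers_def
proof (intro conjI allI ballI)
  show "filterlim (\<lambda>l. card (model l)) at_top sequentially"
  proof (rule filterlim_at_top_mono[OF filterlim_ident])
    have "l \<le> card (model l)" for l
    proof -
      have 1: "1 \<le> real_of_int (modulus l)" using modulus_pos[of l] by simp
      have "real l \<le> real_of_int (modulus l) ^ 1" using modulus_ge[of l] by simp
      also have "\<dots> \<le> real_of_int (modulus l) ^ 4" using 1 by (intro power_increasing) auto
      also have "\<dots> \<le> real (card (model l))" unfolding card_model using 1 by simp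
      finally show ?thesis by simp
    qed
    then show "eventually (\<lambda>l. l \<le> card (model l)) sequentially" by simp
  qed
next
  fix l y z x assume "y \<in> carrier H" "z \<in> carrier H"
  then show "g l (y \<otimes> z) x = g l y (g l z x)"
    by (simp add: g_def P_mult e_mult lift_by_add lift_by_word[of _ l "\<pi> z", folded P_def])
next
  fix l y
  show "bij_betw (f l y) (model l) (model l)" "bij_betw (g l y) (model l) (model l)"
    unfolding f_def g_def by (intro bij_betw_model_comp P_permutes model_permutes)+
qed (use model_nonempty f_mult fixed_points in auto)

text \<open>On the model, \<open>a\<close> shifts the six sheets cyclically, so
  \<open>a [^] (6 - i)\<close> undoes \<open>a [^] i\<close> and \<open>c i\<close> acts as a
  conjugate of \<open>b\<close>: go from sheet 0 to sheet \<open>i\<close>, perform the move,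
  return.\<close>

definition c :: "nat \<Rightarrow> 'a" where "c i = a [^] (6 - i) \<otimes> (b \<otimes> a [^] i)"

lemma c_closed: "c i \<in> carrier H" by (simp add: c_def closed)

lemma e_pow: "e (a [^] (i :: nat)) = 0"
proof (induction i)
  case 0
  show ?case using e_mult[of \<one> \<one>] by simp
qed (simp add: e_mult closed e_values)

lemma e_c: "e (c i) = 0"
  by (simp add: c_def e_mult closed e_pow e_values)

lemma \<tau>_pow: "\<tau> \<otimes> a [^] (i :: nat) = a [^] i \<otimes> \<tau>"
proof (induction i)
  case (Suc i)
  have "\<tau> \<otimes> (a [^] i \<otimes> a) = a [^] i \<otimes> (\<tau> \<otimes> a)"
    using Suc closed by (simp add: m_assoc[symmetric])
  also have "\<dots> = a [^] i \<otimes> a \<otimes> \<tau>" using closed by (simp add: \<tau>_commute m_assoc)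
  finally show ?case by simp
qed (simp add: closed)

lemma \<tau>_c: "\<tau> \<otimes> c i = c i \<otimes> \<tau>"
proof -
  have "\<tau> \<otimes> c i = a [^] (6 - i) \<otimes> (\<tau> \<otimes> b \<otimes> a [^] i)"
    using closed \<tau>_pow[of "6 - i"] by (simp add: c_def m_assoc[symmetric])
  also have "\<dots> = a [^] (6 - i) \<otimes> (b \<otimes> (\<tau> \<otimes> a [^] i))"
    using closed by (simp add: \<tau>_commute m_assoc)
  also have "\<dots> = c i \<otimes> \<tau>" using closed by (simp add: \<tau>_pow c_def m_assoc)
  finally show ?thesis .
qed

lemma P_pow:
  assumes "(v, j, u) \<in> model l"
  shows "P l (a [^] (i :: nat)) (v, j, u) = (v, (j + i) mod 6, u)"
  using assms
proof (induction i arbitrary: j)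
  case 0
  have "P l \<one> x = x" for x
    using P_mult[of \<one> \<one> l x] permutes_inj[OF P_permutes, of l "\<one>"] by (simp add: inj_eq)
  then show ?case using 0 by (simp add: model_def)
next
  case (Suc i)
  have "P l a (v, j, u) = (v, (j + 1) mod 6, u)"
    using Suc.prems by (simp add: P_def \<pi>_values generator_def sheet_shift_def perm_on_def)
  then have "P l (a [^] Suc i) (v, j, u) = P l (a [^] i) (v, (j + 1) mod 6, u)"
    by (simp add: P_mult closed)
  also have "\<dots> = (v, ((j + 1) mod 6 + i) mod 6, u)"
    by (rule Suc.IH) (use Suc.prems in \<open>auto simp: model_def\<close>)
  finally show ?case by (simp add: mod_simps)
qed

lemma f_c:
  assumes v: "v \<in> cube (modulus l)" and u: "u \<in> {0..<modulus l}" and i: "i < 6"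
  shows "f l (c i) (v, 0, u) = ((moves (modulus l) ! i) v, 0, u)"
proof -
  have "P l (c i) (v, 0, u) = P l (a [^] (6 - i)) (P l b (P l (a [^] i) (v, 0, u)))"
    by (simp add: c_def P_mult closed)
  also have "P l (a [^] i) (v, 0, u) = (v, i, u)"
    using P_pow[of v 0 u l i] v u i by (simp add: model_def)
  also have "P l b (v, i, u) = ((moves (modulus l) ! i) v, i, u)"
    using v u i by (simp add: P_def \<pi>_values generator_def sheet_move_def perm_on_def model_def)
  also have "P l (a [^] (6 - i)) \<dots> = ((moves (modulus l) ! i) v, 0, u)"
    using P_pow[of "(moves (modulus l) ! i) v" i u l "6 - i"] move_in_cube[OF modulus_pos i v] u i
    by (simp add: model_def)
  finally show ?thesis by (simp add: f_def e_c drift_by_0)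
qed

lemma f_\<tau>:
  assumes "v \<in> cube (modulus l)" "u \<in> {0..<modulus l}"
  shows "f l \<tau> (v, 0, u) = (drift (modulus l) (drift_unit l) v, 0, u)"
  using assms by (simp add: f_def P_def \<pi>_values e_values drift_by_def perm_on_def model_def)

text \<open>For one large \<open>l\<close>, a slice of sheet 0 with fixed last coordinate is a copy
  of the cube on which the honest images of \<open>c i\<close> and \<tau> contradict
  \<open>no_commuting_approximation\<close>.\<close>

lemma not_approximable: "\<not> approximable H model f"
proof
  assume "approximable H model f"
  then obtain h \<beta> where inj: "\<And>l. inj_on (\<beta> l) (model l)"
    and h: "\<And>l y z. y \<in> carrier H \<Longrightarrow> z \<in> carrier H \<Longrightarrow> (h :: nat \<Rightarrow> 'a \<Rightarrow> nat \<Rightarrow> nat) l (y \<otimes> z) = h l y \<circ> h l z"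
    and neg: "\<And>y. y \<in> carrier H \<Longrightarrow> vanishing model (\<lambda>l x. h l y (\<beta> l x) \<noteq> \<beta> l (f l y x))"
    unfolding approximable_def by blast
  define bad where "bad l x \<longleftrightarrow> (\<exists>y\<in>insert \<tau> (c ` {..<6}). h l y (\<beta> l x) \<noteq> \<beta> l (f l y x))" for l x
  have "vanishing model bad"
    unfolding bad_def by (rule vanishing_Bex) (use neg c_closed closed in auto)
  \<comment> \<open>60000000 = 6 * 10000000: measured against a single sheet, the error becomes the
    one allowed by the finite obstruction.\<close>
  then have "eventually (\<lambda>l. real (card {x \<in> model l. bad l x}) / real (card (model l)) < 1 / 60000000) sequentially"
    unfolding vanishing_def by (rule order_tendstoD) simp
  then obtain l where l: "real (card {x \<in> model l. bad l x}) / real (card (model l)) < 1 / 60000000"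
    by (meson eventually_sequentially order_refl)
  let ?n = "modulus l"
  let ?C = "cube ?n"
  note n = modulus_pos[of l]
  have total: "real (card {x \<in> model l. bad l x}) < real_of_int ?n * (real_of_int ?n ^ 3 / 10000000)"
  proof -
    have "real (card {x \<in> model l. bad l x}) < 1 / 60000000 * real (card (model l))"
      using l model_nonempty[of l] by (simp add: divide_less_eq card_gt_0_iff)
    then show ?thesis by (simp add: card_model power_numeral_reduce)
  qed
  \<comment> \<open>Averaging over the last coordinate: if every slice exceeded the bound, the bad
    points of sheet 0 alone would exceed the total.\<close>
  have "\<exists>u\<in>{0..<?n}. real (card {v \<in> ?C. bad l (v, 0, u)}) \<le> real_of_int ?n ^ 3 / 10000000"
  proof (rule ccontr)
    assume "\<not> ?thesis"
    then have "real_of_int ?n ^ 3 / 10000000 \<le> real (card {v \<in> ?C. bad l (v, 0, u)})" if "u \<in> {0..<?n}" for u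
      using that by (meson linear)
    then have "(\<Sum>u\<in>{0..<?n}. real_of_int ?n ^ 3 / 10000000) \<le> (\<Sum>u\<in>{0..<?n}. real (card {v \<in> ?C. bad l (v, 0, u)}))"
      by (intro sum_mono)
    also have "\<dots> = real (card (SIGMA u:{0..<?n}. {v \<in> ?C. bad l (v, 0, u)}))"
      by (subst card_SigmaI) auto
    also have "\<dots> \<le> real (card {x \<in> model l. bad l x})"
    proof (intro of_nat_mono card_inj_on_le)
      show "inj_on (\<lambda>(u, v). (v, 0, u)) (SIGMA u:{0..<?n}. {v \<in> ?C. bad l (v, 0, u)})"
        by (auto simp: inj_on_def)
    qed (auto simp: model_def)
    finally show False using total n by (simp add: of_nat_nat)
  qed
  then obtain u where u: "u \<in> {0..<?n}"
    and cu: "real (card {v \<in> ?C. bad l (v, 0, u)}) \<le> real_of_int ?n ^ 3 / 10000000" by blast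
  have C: "real (card {v \<in> ?C. h l y (\<beta> l (v, 0, u)) \<noteq> \<beta> l (q v, 0, u)}) \<le> real_of_int ?n ^ 3 / 10000000"
    if y: "y \<in> insert \<tau> (c ` {..<6})" and q: "\<And>v. v \<in> ?C \<Longrightarrow> f l y (v, 0, u) = (q v, 0, u)" for y q
  proof -
    have "{v \<in> ?C. h l y (\<beta> l (v, 0, u)) \<noteq> \<beta> l (q v, 0, u)} \<subseteq> {v \<in> ?C. bad l (v, 0, u)}"
    proof
      fix v assume v: "v \<in> {v \<in> ?C. h l y (\<beta> l (v, 0, u)) \<noteq> \<beta> l (q v, 0, u)}"
      then have "h l y (\<beta> l (v, 0, u)) \<noteq> \<beta> l (f l y (v, 0, u))" using q[of v] by simp
      then have "bad l (v, 0, u)" using y unfolding bad_def by blast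
      then show "v \<in> {v \<in> ?C. bad l (v, 0, u)}" using v by simp
    qed
    then have "card {v \<in> ?C. h l y (\<beta> l (v, 0, u)) \<noteq> \<beta> l (q v, 0, u)} \<le> card {v \<in> ?C. bad l (v, 0, u)}"
      by (intro card_mono) auto
    then show ?thesis using cu by linarith
  qed
  show False
  proof (rule no_commuting_approximation[OF drift_unit_pos, of "\<lambda>v. \<beta> l (v, 0, u)" l "\<lambda>i. h l (c i)" "h l \<tau>", folded modulus_def])
    show "inj_on (\<lambda>v. \<beta> l (v, 0, u)) ?C"
    proof (rule inj_onI)
      fix v w assume "v \<in> ?C" "w \<in> ?C" "\<beta> l (v, 0, u) = \<beta> l (w, 0, u)"
      then show "v = w" using inj_onD[OF inj[of l], of "(v, 0, u)" "(w, 0, u)"] u by (simp add: model_def)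
    qed
    show "h l (c i) (h l \<tau> k) = h l \<tau> (h l (c i) k)" for i k
      using h[OF c_closed closed(3), of l i] h[OF closed(3) c_closed, of l i] by (simp add: \<tau>_c fun_eq_iff)
  next
    fix i :: nat assume i: "i < 6"
    show "real (card {v \<in> ?C. h l (c i) (\<beta> l (v, 0, u)) \<noteq> \<beta> l ((moves ?n ! i) v, 0, u)}) \<le> real_of_int ?n ^ 3 / 10000000"
      by (rule C) (use i f_c[OF _ u i] in auto)
  next
    show "real (card {v \<in> ?C. h l \<tau> (\<beta> l (v, 0, u)) \<noteq> \<beta> l (drift ?n (drift_unit l) v, 0, u)}) \<le> real_of_int ?n ^ 3 / 10000000"
      by (rule C) (use f_\<tau>[OF _ u] in auto)
  qed
qed

lemma finite_index_not_rigid: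
  assumes G: "group G" and S: "subgroup S G" and fin: "finite (rcosets\<^bsub>G\<^esub> S)" and H: "H = G\<lparr>carrier := S\<rparr>"
  shows "\<not> UB_flexibly_BS_rigid G"
  using approximable_finite_index[OF G S fin _ same_stabilizers_model[unfolded H]] not_approximable
  unfolding H by blast

end

text \<open>From the second factor only a homomorphism to the integers that attains 1 is used, which
  treats both cases of the theorem at once. In the free factor the first two generators supply
  \<open>a\<close> and \<open>b\<close>; \<open>generator\<close> lets all others act
  trivially.\<close>

lemma product_finite_index_not_rigid:
  assumes G: "group G" and S: "subgroup S G" and fin: "finite (rcosets\<^bsub>G\<^esub> S)" and m: "2 \<le> m"
    and iso: "G\<lparr>carrier := S\<rparr> \<cong> free_group_rank m \<times>\<times> \<Lambda>" and \<Lambda>: "group \<Lambda>"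
    and \<epsilon>: "\<epsilon> \<in> hom \<Lambda> integer_group" and t: "t \<in> carrier \<Lambda>" "\<epsilon> t = 1"
  shows "\<not> UB_flexibly_BS_rigid G"
proof -
  let ?H = "G\<lparr>carrier := S\<rparr>" and ?F = "free_group_rank m"
  let ?D = "?F \<times>\<times> \<Lambda>"
  interpret H: group ?H using subgroup.subgroup_is_group[OF S G] .
  interpret F: group ?F by (rule group_free_group)
  interpret L: group \<Lambda> by (rule \<Lambda>)
  interpret D: group ?D by (rule DirProd_group[OF group_free_group \<Lambda>])
  obtain \<psi> where \<psi>: "\<psi> \<in> iso ?H ?D" using iso by (auto simp: is_iso_def)
  define \<theta> where "\<theta> = inv_into (carrier ?H) \<psi>"
  have \<psi>h: "\<psi> \<in> hom ?H ?D" and bij: "bij_betw \<psi> (carrier ?H) (carrier ?D)"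
    using \<psi> by (auto simp: iso_def)
  have \<theta>c: "\<theta> x \<in> carrier ?H" and \<psi>\<theta>: "\<psi> (\<theta> x) = x" if "x \<in> carrier ?D" for x
    using bij that unfolding \<theta>_def by (auto simp: bij_betw_def inv_into_into f_inv_into_f simp del: partial_object.simps)
  have "\<theta> \<in> hom ?D ?H"
    using H.iso_set_sym[OF \<psi>] by (simp add: \<theta>_def iso_def)
  then have \<theta>m: "\<theta> (x \<otimes>\<^bsub>?D\<^esub> y) = \<theta> x \<otimes>\<^bsub>?H\<^esub> \<theta> y" if "x \<in> carrier ?D" "y \<in> carrier ?D" for x y
    using that by (rule hom_mult)
  have gen: "[(i, True)] \<in> carrier ?F" if "i < 2" for i
    using that m by (auto simp: free_group_def reduced_Cons)
  let ?g = "\<lambda>i. ([(i, True)], \<one>\<^bsub>\<Lambda>\<^esub>)" and ?t = "([], t)"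
  have gD: "?g i \<in> carrier ?D" if "i < 2" for i using gen[OF that] by simp
  have tD: "?t \<in> carrier ?D" using t by (simp add: free_group_def)
  have comm: "?t \<otimes>\<^bsub>?D\<^esub> ?g i = ?g i \<otimes>\<^bsub>?D\<^esub> ?t" for i
    using t by (simp add: DirProd_def free_group_def)
  have \<epsilon>1: "\<epsilon> \<one>\<^bsub>\<Lambda>\<^esub> = 0" using hom_mult[OF \<epsilon>, of "\<one>\<^bsub>\<Lambda>\<^esub>" "\<one>\<^bsub>\<Lambda>\<^esub>"] by simp
  have \<psi>c: "\<psi> x \<in> carrier ?D" if "x \<in> carrier ?H" for x using hom_in_carrier[OF \<psi>h that] .
  have "central_extension_data ?H {..<m} (fst \<circ> \<psi>) (\<epsilon> \<circ> (snd \<circ> \<psi>)) (\<theta> (?g 0)) (\<theta> (?g 1)) (\<theta> ?t)"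
  proof
    show "fst \<circ> \<psi> \<in> hom ?H ?F"
      using \<psi>c hom_mult[OF \<psi>h] by (intro homI) (auto simp: DirProd_def mem_Times_iff case_prod_unfold)
    show "\<epsilon> \<circ> (snd \<circ> \<psi>) \<in> hom ?H integer_group"
      using \<psi>c hom_mult[OF \<psi>h] hom_mult[OF \<epsilon>]
      by (intro homI) (auto simp: DirProd_def mem_Times_iff case_prod_unfold)
    show "\<theta> (?g 0) \<in> carrier ?H" "\<theta> (?g 1) \<in> carrier ?H" "\<theta> ?t \<in> carrier ?H"
      using \<theta>c gD tD by (metis pos2 one_less_numeral_iff semiring_norm(76))+
    show "\<theta> ?t \<otimes>\<^bsub>?H\<^esub> \<theta> (?g 0) = \<theta> (?g 0) \<otimes>\<^bsub>?H\<^esub> \<theta> ?t" "\<theta> ?t \<otimes>\<^bsub>?H\<^esub> \<theta> (?g 1) = \<theta> (?g 1) \<otimes>\<^bsub>?H\<^esub> \<theta> ?t"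
      using \<theta>m[OF tD gD] \<theta>m[OF gD tD] comm by (metis pos2 one_less_numeral_iff semiring_norm(76))+
  qed (use \<psi>\<theta>[OF gD] \<psi>\<theta>[OF tD] \<epsilon>1 t in \<open>simp_all\<close>)
  then show ?thesis
    by (rule central_extension_data.finite_index_not_rigid[OF _ G S fin refl])
qed

theorem proposition1p29:
  fixes G :: "('a, 'b) monoid_scheme"
  assumes "group G"
    and "(\<exists>H m n. subgroup H G \<and> finite (rcosets\<^bsub>G\<^esub> H) \<and> 2 \<le> m \<and> 2 \<le> n \<and>
            G\<lparr>carrier := H\<rparr> \<cong> free_group_rank m \<times>\<times> free_group_rank n) \<or>
         (\<exists>H m d. subgroup H G \<and> finite (rcosets\<^bsub>G\<^esub> H) \<and> 2 \<le> m \<and> 1 \<le> d \<and>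
            G\<lparr>carrier := H\<rparr> \<cong> free_group_rank m \<times>\<times> product_group {..<d :: nat} (\<lambda>_. integer_group))"
  shows "\<not> UB_flexibly_BS_rigid G"
  using assms(2)
proof (elim disjE exE conjE)
  fix H m n
  assume H: "subgroup H G" "finite (rcosets\<^bsub>G\<^esub> H)" "2 \<le> m"
    and n: "2 \<le> n" and iso: "G\<lparr>carrier := H\<rparr> \<cong> free_group_rank m \<times>\<times> free_group_rank n"
  interpret Z: group integer_group by simp
  \<comment> \<open>The exponent sum, which takes the value 1 on every generator.\<close>
  have "Z.eval_word (\<lambda>_. 1) \<in> hom (free_group_rank n) integer_group"
    by (rule Z.eval_word_hom) simp
  moreover have "[(0, True)] \<in> carrier (free_group_rank n)"
    using n by (auto simp: free_group_def reduced_Cons)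
  moreover have "Z.eval_word (\<lambda>_. 1) [(0 :: nat, True)] = 1"
    by (simp add: Z.eval_word_def)
  ultimately show ?thesis
    by (rule product_finite_index_not_rigid[OF assms(1) H iso group_free_group])
next
  fix H m and d :: nat
  assume H: "subgroup H G" "finite (rcosets\<^bsub>G\<^esub> H)" "2 \<le> m"
    and d: "1 \<le> d"
    and iso: "G\<lparr>carrier := H\<rparr> \<cong> free_group_rank m \<times>\<times> product_group {..<d} (\<lambda>_. integer_group)"
  let ?\<Lambda> = "product_group {..<d} (\<lambda>_. integer_group)"
  have "group ?\<Lambda>" by (rule product_group) simp
  \<comment> \<open>Projection to coordinate 0, available because \<open>1 \<le> d\<close>; the
    vector of ones is a preimage of 1.\<close>
  moreover have "(\<lambda>x. x 0) \<in> hom ?\<Lambda> integer_group"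
    using d by (intro homI) (auto simp: mult_product_group)
  moreover have "(\<lambda>i\<in>{..<d}. 1) \<in> carrier ?\<Lambda>" by simp
  moreover have "(\<lambda>i\<in>{..<d}. 1) 0 = (1 :: int)" using d by simp
  ultimately show ?thesis
    by (rule product_finite_index_not_rigid[OF assms(1) H iso])
qed

end
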